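(* Let $\mathcal{A}$ be an S-ring over a dihedral $2$-group $D$ of order $2^{n+1}$, and suppose that $\mathrm{rk}(\mathcal{A})\le 5$. Then at least one of the following holds: (1) $\mathcal{A}$ is isomorphic to an S-ring over $\mathbb{Z}_{2}\times\mathbb{Z}_{2^n}$; (2) $\mathcal{A}$ is a proper dot product or a proper wreath product; (3) $\mathrm{rk}(\mathcal{A})=5$ and $\mathcal{A}$ is associated with a divisible difference set in the cyclic group $\mathbb{Z}_{2^n}$.
   Context: S-rings. Let $D$ be a finite group with identity $e$. For $X\subseteq D$ put $\underline{X}=\sum_{x\in X}x\in\mathbb{Z}D$ and $\mathrm{rad}(X)=\{g\in D: gX=Xg=X\}$. A subring $\mathcal{A}$ of $\mathbb{Z}D$ is an S-ring over $D$ if there is a partition $\mathcal{S}(\mathcal{A})$ of $D$ (whose classes are called basic sets) such that $\{e\}\in\mathcal{S}(\mathcal{A})$; $X\in\mathcal{S}(\mathcal{A})$ implies $X^{-1}\in\mathcal{S}(\mathcal{A})$; and $\mathcal{A}=\mathrm{Span}_{\mathbb{Z}}\{\underline{X}: X\in\mathcal{S}(\mathcal{A})\}$. The rank is $\mathrm{rk}(\mathcal{A})=|\mathcal{S}(\mathcal{A})|$. An $\mathcal{A}$-group is a subgroup of $D$ that is a union of basic sets. Isomorphism. For $X\subseteq D$ let $R_D(X)=\{(g,xg): g\in D,\ x\in X\}$. S-rings $\mathcal{A}$ over $D$ and $\mathcal{A}'$ over $D'$ are isomorphic if there is a bijection $f:D\to D'$ carrying the set of relations $\{R_D(X): X\in\mathcal{S}(\mathcal{A})\}$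 onto $\{R_{D'}(X'): X'\in\mathcal{S}(\mathcal{A}')\}$. Dot product. If $D=D_1D_2$ with subgroups $D_1\cap D_2=\{e\}$, and $\mathcal{A}_1,\mathcal{A}_2$ are S-rings over $D_1,D_2$ commuting with each other, then $\mathcal{A}_1\cdot\mathcal{A}_2=\mathrm{Span}\{\underline{X_1X_2}: X_i\in\mathcal{S}(\mathcal{A}_i)\}$ is an S-ring over $D$, called the dot product; it is proper if $D_1\ne \{e\}\ne D_2$. Wreath product. $\mathcal{A}$ is a proper wreath product if there is an $\mathcal{A}$-group $L$, normal in $D$, with $\{e\}\ne L\ne D$, such that $L\le\mathrm{rad}(X)$ for every basic set $X$ not contained in $L$. Divisible difference sets. Let $G$ be a group and $N\le G$ a subgroup. A subset $T\subseteq G$ is a divisible difference set in $G$ relative to $N$ if there are integers $\lambda_1,\lambda_2\ge 0$ with $\underline{T}\cdot\underline{T^{-1}}=|T|\,e+\lambda_1\,\underline{N\setminus\{e\}}+\lambda_2\,\underline{G\setminus N}$. Let $C\cong\mathbb{Z}_{2^n}$ be the cyclic subgroup of index $2$ in the dihedral group $D$ all of whose complement $D\setminus C$ consists of involutions. A rank $5$ S-ring $\mathcal{A}$ over $D$ is associated with a divisible difference set in $C$ if there are a subgroup $H\le C$, an element $s\in D\setminus C$, and a divisible difference set $T\subseteq C$ relative to $H$, for which $|T\cap xH|$ does not depend on $x\in T$, such that $\mathcal{S}(\mathcal{A})=\{\{e\},\ H\setminus\{e\},\ C\setminus H,\ Ts,\ (C\setminus T)s\}$. *)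

theory Defs
  imports "HOL-Algebra.Elementary_Groups" "HOL-Algebra.Subrings" "HOL-Library.Disjoint_Sets" "HOL-Library.Indicator_Function"
begin

(* The integral group ring of a finite group G. The element sum_g f(g) g is encoded by its
   coefficient function f, which is required to vanish outside the carrier. Hence for a subgroup H
   the ring Z[H] is literally a subset of Z[G], and for X <= G the element sum_{x in X} x is
   the integer-valued function "indicator X". *)
definition group_ring :: "('a, 'b) monoid_scheme \<Rightarrow> ('a \<Rightarrow> int) ring" where
  "group_ring G =
     \<lparr> carrier = {f. \<forall>x. x \<notin> carrier G \<longrightarrow> f x = 0},
       monoid.mult = (\<lambda>f g x. \<Sum>(a, b) \<in> {(a, b) \<in> carrier G \<times> carrier G. a \<otimes>\<^bsub>G\<^esub> b = x}. f a * g b),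
       monoid.one = indicator {\<one>\<^bsub>G\<^esub>},
       ring.zero = (\<lambda>x. 0),
       ring.add = (\<lambda>f g x. f x + g x) \<rparr>"

(* Z-linear combinations of the elements of F; used for finite F only. *)
definition int_span :: "('a \<Rightarrow> int) set \<Rightarrow> ('a \<Rightarrow> int) set" where
  "int_span F = {(\<lambda>x. \<Sum>f\<in>F. c f * f x) | c. True}"

definition sring_partition :: "('a, 'b) monoid_scheme \<Rightarrow> ('a \<Rightarrow> int) set \<Rightarrow> 'a set set \<Rightarrow> bool" where
  "sring_partition G A S \<longleftrightarrow>
     partition_on (carrier G) S \<and>
     {\<one>\<^bsub>G\<^esub>} \<in> S \<and>
     (\<forall>X\<in>S. set_inv\<^bsub>G\<^esub> X \<in> S) \<and>
     A = int_span (indicator ` S)"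

definition sring :: "('a, 'b) monoid_scheme \<Rightarrow> ('a \<Rightarrow> int) set \<Rightarrow> bool" where
  "sring G A \<longleftrightarrow>
     group G \<and> finite (carrier G) \<and> subring A (group_ring G) \<and> (\<exists>S. sring_partition G A S)"

(* S(A); well defined for an S-ring A by the lemma sring_partition_unique below. *)
definition basic_sets :: "('a, 'b) monoid_scheme \<Rightarrow> ('a \<Rightarrow> int) set \<Rightarrow> 'a set set" where
  "basic_sets G A = (THE S. sring_partition G A S)"

definition sring_rank :: "('a, 'b) monoid_scheme \<Rightarrow> ('a \<Rightarrow> int) set \<Rightarrow> nat" where
  "sring_rank G A = card (basic_sets G A)"

definition sring_subgroup :: "('a, 'b) monoid_scheme \<Rightarrow> ('a \<Rightarrow> int) set \<Rightarrow> 'a set \<Rightarrow> bool" where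
  "sring_subgroup G A H \<longleftrightarrow> subgroup H G \<and> (\<exists>U \<subseteq> basic_sets G A. H = \<Union>U)"

definition set_rad :: "('a, 'b) monoid_scheme \<Rightarrow> 'a set \<Rightarrow> 'a set" where
  "set_rad G X = {g \<in> carrier G. g <#\<^bsub>G\<^esub> X = X \<and> X #>\<^bsub>G\<^esub> g = X}"

definition cayley_rel :: "('a, 'b) monoid_scheme \<Rightarrow> 'a set \<Rightarrow> ('a \<times> 'a) set" where
  "cayley_rel G X = {(g, x \<otimes>\<^bsub>G\<^esub> g) | g x. g \<in> carrier G \<and> x \<in> X}"

definition sring_iso ::
  "('a, 'b) monoid_scheme \<Rightarrow> ('a \<Rightarrow> int) set \<Rightarrow> ('c, 'd) monoid_scheme \<Rightarrow> ('c \<Rightarrow> int) set \<Rightarrow> bool" where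
  "sring_iso G A G' A' \<longleftrightarrow>
     (\<exists>f. bij_betw f (carrier G) (carrier G') \<and>
          (\<lambda>R. map_prod f f ` R) ` cayley_rel G ` basic_sets G A = cayley_rel G' ` basic_sets G' A')"

(* "A1 and A2 commute" is read elementwise, in the group ring of the whole group G. *)
definition proper_dot_product :: "('a, 'b) monoid_scheme \<Rightarrow> ('a \<Rightarrow> int) set \<Rightarrow> bool" where
  "proper_dot_product G A \<longleftrightarrow>
     (\<exists>G1 G2 A1 A2.
        subgroup G1 G \<and> subgroup G2 G \<and>
        G1 <#>\<^bsub>G\<^esub> G2 = carrier G \<and> G1 \<inter> G2 = {\<one>\<^bsub>G\<^esub>} \<and>
        G1 \<noteq> {\<one>\<^bsub>G\<^esub>} \<and> G2 \<noteq> {\<one>\<^bsub>G\<^esub>} \<and>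
        sring (G\<lparr>carrier := G1\<rparr>) A1 \<and> sring (G\<lparr>carrier := G2\<rparr>) A2 \<and>
        (\<forall>a1\<in>A1. \<forall>a2\<in>A2. a1 \<otimes>\<^bsub>group_ring G\<^esub> a2 = a2 \<otimes>\<^bsub>group_ring G\<^esub> a1) \<and>
        A = int_span {indicator (X1 <#>\<^bsub>G\<^esub> X2) | X1 X2.
              X1 \<in> basic_sets (G\<lparr>carrier := G1\<rparr>) A1 \<and> X2 \<in> basic_sets (G\<lparr>carrier := G2\<rparr>) A2})"

definition proper_wreath_product :: "('a, 'b) monoid_scheme \<Rightarrow> ('a \<Rightarrow> int) set \<Rightarrow> bool" where
  "proper_wreath_product G A \<longleftrightarrow>
     (\<exists>L. sring_subgroup G A L \<and> L \<lhd> G \<and> L \<noteq> {\<one>\<^bsub>G\<^esub>} \<and> L \<noteq> carrier G \<and>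
          (\<forall>X \<in> basic_sets G A. \<not> X \<subseteq> L \<longrightarrow> L \<subseteq> set_rad G X))"

definition divisible_difference_set :: "('a, 'b) monoid_scheme \<Rightarrow> 'a set \<Rightarrow> 'a set \<Rightarrow> bool" where
  "divisible_difference_set G N T \<longleftrightarrow>
     subgroup N G \<and> T \<subseteq> carrier G \<and>
     (\<exists>l1 l2 :: nat.
        indicator T \<otimes>\<^bsub>group_ring G\<^esub> indicator (set_inv\<^bsub>G\<^esub> T) =
        (\<lambda>x. int (card T) * indicator {\<one>\<^bsub>G\<^esub>} x
             + int l1 * indicator (N - {\<one>\<^bsub>G\<^esub>}) x
             + int l2 * indicator (carrier G - N) x))"

(* The elements outside C are different from the identity, so the last condition says that
   they are involutions. *)
definition dihedral_cyclic_part :: "('a, 'b) monoid_scheme \<Rightarrow> 'a set \<Rightarrow> bool" where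
  "dihedral_cyclic_part G C \<longleftrightarrow>
     subgroup C G \<and> cyclic_group (G\<lparr>carrier := C\<rparr>) \<and> card (rcosets\<^bsub>G\<^esub> C) = 2 \<and>
     (\<forall>s \<in> carrier G - C. s \<otimes>\<^bsub>G\<^esub> s = \<one>\<^bsub>G\<^esub>)"

definition dihedral_group :: "('a, 'b) monoid_scheme \<Rightarrow> bool" where
  "dihedral_group G \<longleftrightarrow> group G \<and> (\<exists>C. dihedral_cyclic_part G C)"

definition associated_with_dds :: "('a, 'b) monoid_scheme \<Rightarrow> ('a \<Rightarrow> int) set \<Rightarrow> bool" where
  "associated_with_dds G A \<longleftrightarrow>
     (\<exists>C H s T.
        dihedral_cyclic_part G C \<and> subgroup H (G\<lparr>carrier := C\<rparr>) \<and> s \<in> carrier G - C \<and>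
        divisible_difference_set (G\<lparr>carrier := C\<rparr>) H T \<and>
        (\<forall>x\<in>T. \<forall>y\<in>T. card (T \<inter> (x <#\<^bsub>G\<^esub> H)) = card (T \<inter> (y <#\<^bsub>G\<^esub> H))) \<and>
        basic_sets G A = {{\<one>\<^bsub>G\<^esub>}, H - {\<one>\<^bsub>G\<^esub>}, C - H, T #>\<^bsub>G\<^esub> s, (C - T) #>\<^bsub>G\<^esub> s})"

lemma indicator_in_int_span:
  assumes "finite F" "f \<in> F"
  shows "f \<in> int_span F"
proof -
  have "f = (\<lambda>x. \<Sum>g\<in>F. (if g = f then 1 else 0) * g x)"
    using assms by (simp add: if_distrib[where f = "\<lambda>c. c * _"] sum.delta cong: if_cong)
  then show ?thesis
    unfolding int_span_def by (intro CollectI exI[of _ "\<lambda>g. if g = f then 1 else 0"]) simp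
qed

lemma int_span_const:
  assumes "partition_on P S" "f \<in> int_span (indicator ` S)" "X \<in> S" "x \<in> X" "y \<in> X"
  shows "f x = f y"
proof -
  have "indicator Y x = (indicator Y y :: int)" if "Y \<in> S" for Y
    using assms(1,3-5) that by (auto simp: partition_on_def disjoint_def indicator_def)
  then show ?thesis
    using assms(2) unfolding int_span_def by (auto intro!: sum.cong)
qed

lemma sring_partition_unique:
  assumes fin: "finite (carrier G)" and S: "sring_partition G A S" and S': "sring_partition G A S'"
  shows "S = S'"
proof -
  have key: "S1 \<subseteq> S2" if 1: "sring_partition G A S1" and 2: "sring_partition G A S2" for S1 S2
  proof
    fix X assume X: "X \<in> S1"
    have p: "partition_on (carrier G) S1" "partition_on (carrier G) S2"
      using 1 2 by (auto simp: sring_partition_def)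
    then have f: "finite S1" "finite S2"
      using fin finite_elements by blast+
    have sub: "U \<subseteq> V" if "U \<in> T1" "V \<in> T2" "x \<in> U" "x \<in> V"
      "partition_on (carrier G) T1" "indicator V \<in> int_span (indicator ` T1)" for U V T1 T2 x
    proof
      fix y assume "y \<in> U"
      then have "(indicator V x :: int) = indicator V y"
        using int_span_const[OF that(5,6,1)] that(3) by blast
      with that show "y \<in> V" by (auto simp: indicator_def split: if_splits)
    qed
    have A: "A = int_span (indicator ` S1)" "A = int_span (indicator ` S2)"
      using 1 2 by (auto simp: sring_partition_def)
    obtain x where x: "x \<in> X" "x \<in> carrier G"
      using p X by (metis partition_onD1 partition_onD3 UnionI equals0I)
    then obtain Y where Y: "Y \<in> S2" "x \<in> Y"
      using p by (metis partition_onD1 UnionE)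
    have "indicator X \<in> int_span (indicator ` S1)" "indicator Y \<in> int_span (indicator ` S2)"
      using f X Y by (auto intro: indicator_in_int_span)
    then have "X \<subseteq> Y" "Y \<subseteq> X"
      using sub[OF X Y(1) x(1) Y(2) p(1)] sub[OF Y(1) X Y(2) x(1) p(2)] A by auto
    with Y show "X \<in> S2" by auto
  qed
  show ?thesis using key[OF S S'] key[OF S' S] by auto
qed

lemma sring_partition_basic_sets:
  assumes "sring G A"
  shows "sring_partition G A (basic_sets G A)"
  using assms sring_partition_unique unfolding sring_def basic_sets_def
  by (metis (no_types, lifting) theI)

lemma group_ring_mult:
  assumes "group G"
  shows "f \<otimes>\<^bsub>group_ring G\<^esub> g =
    (\<lambda>x. if x \<in> carrier G then \<Sum>a\<in>carrier G. f a * g (inv\<^bsub>G\<^esub> a \<otimes>\<^bsub>G\<^esub> x) else 0)"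
proof
  interpret group G by fact
  fix x
  show "(f \<otimes>\<^bsub>group_ring G\<^esub> g) x =
    (if x \<in> carrier G then \<Sum>a\<in>carrier G. f a * g (inv\<^bsub>G\<^esub> a \<otimes>\<^bsub>G\<^esub> x) else 0)"
  proof (cases "x \<in> carrier G")
    case True
    have "(\<Sum>(a, b) \<in> {(a, b) \<in> carrier G \<times> carrier G. a \<otimes>\<^bsub>G\<^esub> b = x}. f a * g b) =
        (\<Sum>a\<in>carrier G. f a * g (inv\<^bsub>G\<^esub> a \<otimes>\<^bsub>G\<^esub> x))"
      by (rule sum.reindex_bij_witness[where i = "\<lambda>a. (a, inv\<^bsub>G\<^esub> a \<otimes>\<^bsub>G\<^esub> x)" and j = fst])
         (use True in \<open>auto simp: m_assoc[symmetric]\<close>)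
    with True show ?thesis by (simp add: group_ring_def)
  next
    case False
    then show ?thesis by (auto simp: group_ring_def intro!: sum.neutral)
  qed
qed

lemma ring_group_ring:
  assumes "group G" and fin: "finite (carrier G)"
  shows "ring (group_ring G)"
proof -
  interpret group G by fact
  have c: "carrier (group_ring G) = {f. \<forall>x. x \<notin> carrier G \<longrightarrow> f x = 0}"
    and o: "\<one>\<^bsub>group_ring G\<^esub> = indicator {\<one>\<^bsub>G\<^esub>}" and z: "\<zero>\<^bsub>group_ring G\<^esub> = (\<lambda>x. 0)"
    and p: "\<And>f g. f \<oplus>\<^bsub>group_ring G\<^esub> g = (\<lambda>x. f x + g x)"
    by (simp_all add: group_ring_def)
  note m = group_ring_mult[OF assms(1)]
  show ?thesis
  proof (rule ringI)
    show "abelian_group (group_ring G)"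
    proof (rule abelian_groupI)
      fix f assume "f \<in> carrier (group_ring G)"
      then show "\<exists>g\<in>carrier (group_ring G). g \<oplus>\<^bsub>group_ring G\<^esub> f = \<zero>\<^bsub>group_ring G\<^esub>"
        by (intro bexI[of _ "\<lambda>x. - f x"]) (auto simp: c p z)
    qed (auto simp: c p z)
    show "Group.monoid (group_ring G)"
    proof (rule monoidI)
      fix f g h assume "f \<in> carrier (group_ring G)" "g \<in> carrier (group_ring G)" "h \<in> carrier (group_ring G)"
      have "(\<Sum>a\<in>carrier G. (\<Sum>b\<in>carrier G. f b * g (inv\<^bsub>G\<^esub> b \<otimes>\<^bsub>G\<^esub> a)) * h (inv\<^bsub>G\<^esub> a \<otimes>\<^bsub>G\<^esub> x)) =
        (\<Sum>b\<in>carrier G. f b * (\<Sum>a\<in>carrier G. g a * h (inv\<^bsub>G\<^esub> a \<otimes>\<^bsub>G\<^esub> (inv\<^bsub>G\<^esub> b \<otimes>\<^bsub>G\<^esub> x))))"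
        if x: "x \<in> carrier G" for x
      proof -
        have "(\<Sum>a\<in>carrier G. (\<Sum>b\<in>carrier G. f b * g (inv\<^bsub>G\<^esub> b \<otimes>\<^bsub>G\<^esub> a)) * h (inv\<^bsub>G\<^esub> a \<otimes>\<^bsub>G\<^esub> x)) =
          (\<Sum>b\<in>carrier G. \<Sum>a\<in>carrier G. f b * (g (inv\<^bsub>G\<^esub> b \<otimes>\<^bsub>G\<^esub> a) * h (inv\<^bsub>G\<^esub> a \<otimes>\<^bsub>G\<^esub> x)))"
          unfolding sum_distrib_right by (subst sum.swap) (simp add: mult.assoc)
        also have "\<dots> = (\<Sum>b\<in>carrier G. \<Sum>a\<in>carrier G. f b * (g a * h (inv\<^bsub>G\<^esub> a \<otimes>\<^bsub>G\<^esub> (inv\<^bsub>G\<^esub> b \<otimes>\<^bsub>G\<^esub> x))))"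
        proof (rule sum.cong[OF refl])
          fix b assume b: "b \<in> carrier G"
          have l_cancel: "inv\<^bsub>G\<^esub> b \<otimes>\<^bsub>G\<^esub> (b \<otimes>\<^bsub>G\<^esub> a) = a" "b \<otimes>\<^bsub>G\<^esub> (inv\<^bsub>G\<^esub> b \<otimes>\<^bsub>G\<^esub> a) = a"
            if "a \<in> carrier G" for a
            using b that by (simp_all add: m_assoc[symmetric])
          show "(\<Sum>a\<in>carrier G. f b * (g (inv\<^bsub>G\<^esub> b \<otimes>\<^bsub>G\<^esub> a) * h (inv\<^bsub>G\<^esub> a \<otimes>\<^bsub>G\<^esub> x))) =
            (\<Sum>a\<in>carrier G. f b * (g a * h (inv\<^bsub>G\<^esub> a \<otimes>\<^bsub>G\<^esub> (inv\<^bsub>G\<^esub> b \<otimes>\<^bsub>G\<^esub> x))))"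
            by (rule sum.reindex_bij_witness[where i = "\<lambda>a. b \<otimes>\<^bsub>G\<^esub> a" and j = "\<lambda>a. inv\<^bsub>G\<^esub> b \<otimes>\<^bsub>G\<^esub> a"])
               (use b x l_cancel in \<open>auto simp: m_assoc inv_mult_group\<close>)
        qed
        finally show ?thesis by (simp add: sum_distrib_left)
      qed
      then show "f \<otimes>\<^bsub>group_ring G\<^esub> g \<otimes>\<^bsub>group_ring G\<^esub> h = f \<otimes>\<^bsub>group_ring G\<^esub> (g \<otimes>\<^bsub>group_ring G\<^esub> h)"
        by (auto simp: m fun_eq_iff cong: if_cong)
    next
      fix f assume f: "f \<in> carrier (group_ring G)"
      show "\<one>\<^bsub>group_ring G\<^esub> \<otimes>\<^bsub>group_ring G\<^esub> f = f"
        using f fin by (auto simp: m o c fun_eq_iff indicator_def if_distrib[where f = "\<lambda>c. c * _"] sum.delta cong: if_cong)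
      have "(\<Sum>a\<in>carrier G. f a * indicator {\<one>\<^bsub>G\<^esub>} (inv\<^bsub>G\<^esub> a \<otimes>\<^bsub>G\<^esub> x)) = f x"
        if x: "x \<in> carrier G" for x
      proof -
        have "inv\<^bsub>G\<^esub> a \<otimes>\<^bsub>G\<^esub> x = \<one>\<^bsub>G\<^esub> \<longleftrightarrow> a = x" if "a \<in> carrier G" for a
          using that x by (metis inv_closed inv_equality inv_inv l_inv)
        then have "(\<Sum>a\<in>carrier G. f a * indicator {\<one>\<^bsub>G\<^esub>} (inv\<^bsub>G\<^esub> a \<otimes>\<^bsub>G\<^esub> x)) =
          (\<Sum>a\<in>carrier G. if a = x then f a else 0)"
          by (auto intro!: sum.cong simp: indicator_def)
        with x fin show ?thesis by simp
      qed
      then show "f \<otimes>\<^bsub>group_ring G\<^esub> \<one>\<^bsub>group_ring G\<^esub> = f"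
        using f by (auto simp: m o c fun_eq_iff)
    qed (auto simp: c m o indicator_def)
  qed (auto simp: m p fun_eq_iff algebra_simps sum.distrib)
qed

end

theory Submission
  imports Defs "HOL-Computational_Algebra.Polynomial"
begin

text \<open>
  Write \<open>D\<close> as the set of all \<open>c\<^sup>i\<close> and \<open>c\<^sup>i s\<close> with \<open>i\<close> modulo \<open>N = 2\<^sup>n\<close>, and let \<open>z = c\<^sup>M\<close> with \<open>M = N / 2\<close>
  be the central involution. The faithful representation of degree two over the integers of the
  \<open>N\<close>-th cyclotomic field vanishes exactly on the \<open>z\<close>-invariant elements of the group ring, so it
  controls the basic sets that are split by \<open>z\<close>. Since 2 is totally ramified, a product divisible by 4
  has a factor divisible by 2, and a set whose image is divisible by 2 is not split; this excludes
  most splittings.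

  Let \<open>K\<close> be the union of the basic sets that consist of rotations. If \<open>K\<close> is trivial, the basic set
  of \<open>z\<close> contains a reflection, and comparing the faithful representation with the rational
  characters shows that the partition is invariant under inversion of rotations and under the
  reflection of the points \<open>c\<^sup>i s\<close> in one of them. For such partitions the structure constants do not
  change when \<open>s\<close> is made to commute with \<open>c\<close>. If \<open>K\<close> is not trivial and its complement is a single
  basic set, the S-ring is a wreath product. Otherwise \<open>1\<close> and the basic set of \<open>z\<close> form a subgroup \<open>H\<close>
  by the rank bound. If no basic set outside \<open>K\<close> is split by \<open>z\<close>, the S-ring is a wreath product. If
  exactly two are split, they consist of reflections, and either \<open>K\<close> is the whole cyclic group and
  a divisible difference set arises, or one of them is a difference set of odd order in a coset of
  \<open>H\<close>, hence a single element up to complement. If three are split and \<open>H\<close> is not the whole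
  cyclic group, the structure constants give a cubic with an integer root, which leads to a
  contradiction; otherwise a character of order two of the cyclic group does.
\<close>

section \<open>Integer polynomials in a root of unity of 2-power order\<close>

text \<open>An indicator takes the values 0 and 1, so its values at two points connected by the
  central involution z differ by 0, 1 or -1, and an even difference vanishes: this turns
  divisibility by 2 into invariance. The factor 4 has to be supplied. It comes from the difference
  of the coefficients at 1 and at z in the square of a basic set, an analogue of the order of a
  difference set, controlled by the parity of the number of points in a coset of a subgroup. Except
  in the wreath case with a single basic set outside \<open>K\<close>, all basic sets are symmetric;
  then the matrices of the faithful representation commute, have a real scalar diagonal
  \<open>Al\<close>, and have the eigenvalues \<open>Al\<close> plus or minus the modulus of
  \<open>Be\<close>. The obstacle is that these numbers are irrational in general. Three devices
  remove it: a rational linear character that occurs among the eigenvalues; the vanishing of a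
  rational diagonal entry when the coefficients at 1 and z agree; and the tower of quadratic
  extensions generated by roots of unity of 2-power order, in which no cubic irrationality
  lives.\<close>

text \<open>The range of \<open>ev x\<close> is the subring of the complex numbers generated by \<open>x\<close>.\<close>

definition ev :: "complex \<Rightarrow> int poly \<Rightarrow> complex" where
  "ev x p = poly (map_poly of_int p) x"

lemma ev_0 [simp]: "ev x 0 = 0"
  by (simp add: ev_def)

lemma ev_pCons [simp]: "ev x (pCons a p) = of_int a + x * ev x p"
  by (simp add: ev_def map_poly_pCons)

lemma ev_1 [simp]: "ev x 1 = 1"
  by (simp add: one_pCons)

lemma ev_add [simp]: "ev x (p + q) = ev x p + ev x q"
  by (induct p q rule: poly_induct2) (simp_all add: algebra_simps)

lemma ev_smult [simp]: "ev x (smult a p) = of_int a * ev x p"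
  by (induct p) (simp_all add: algebra_simps)

lemma ev_uminus [simp]: "ev x (- p) = - ev x p"
  using ev_smult[of x "-1" p] by simp

lemma ev_diff [simp]: "ev x (p - q) = ev x p - ev x q"
  using ev_add[of x p "- q"] by simp

lemma ev_mult [simp]: "ev x (p * q) = ev x p * ev x q"
  by (induct p) (simp_all add: algebra_simps)

lemma ev_power [simp]: "ev x (p ^ k) = ev x p ^ k"
  by (induct k) simp_all

lemma ev_monom [simp]: "ev x (monom a k) = of_int a * x ^ k"
  by (induct k) (simp_all add: monom_0 monom_Suc)

lemma ev_sum: "ev x (sum f A) = (\<Sum>i\<in>A. ev x (f i))"
  by (induct A rule: infinite_finite_induct) simp_all

lemma ev_one_eq: "ev 1 p = of_int (poly p 1)"
  by (induct p) simp_all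

definition zt :: "nat \<Rightarrow> complex" where
  "zt m = cis (pi / 2 ^ m)"

lemma zt_0: "zt 0 = - 1"
  by (simp add: zt_def cis_pi)

lemma zt_Suc: "zt (Suc m) ^ 2 = zt m"
  by (simp add: zt_def power2_eq_square cis_mult)

lemma zt_pow: "zt m ^ (2 ^ m) = - 1"
proof (induct m)
  case (Suc m)
  have "zt (Suc m) ^ (2 ^ Suc m) = (zt (Suc m) ^ 2) ^ (2 ^ m)"
    by (simp add: power_mult)
  then show ?case using Suc by (simp add: zt_Suc)
qed (simp add: zt_0)

text \<open>The value at 1 is carried along because its parity is the residue of
  \<open>ev (zt m) p\<close> at the prime above 2.\<close>

lemma even_odd_parts:
  "\<exists>e d :: int poly. (\<forall>x. ev x p = ev (x ^ 2) e + x * ev (x ^ 2) d) \<and> poly p 1 = poly e 1 + poly d 1"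
proof (induct p)
  case 0
  show ?case by (intro exI[of _ 0]) simp
next
  case (pCons a p)
  then obtain e d where ed: "\<And>x. ev x p = ev (x ^ 2) e + x * ev (x ^ 2) d" "poly p 1 = poly e 1 + poly d 1"
    by blast
  show ?case
    by (intro exI[of _ "pCons a d"] exI[of _ e]) (simp add: ed algebra_simps power2_eq_square)
qed

text \<open>Reduction modulo the prime above 2 is well defined on the ring of integers
  generated by a root of unity of 2-power order.\<close>

lemma ev_zt_zero_even: "ev (zt m) p = 0 \<Longrightarrow> even (poly p 1)"
proof (induct m arbitrary: p)
  case 0
  obtain e d where ed: "\<And>x. ev x p = ev (x ^ 2) e + x * ev (x ^ 2) d" "poly p 1 = poly e 1 + poly d 1"
    using even_odd_parts[of p] by blast
  have "poly e 1 = poly d 1"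
    using 0 ed(1)[of "-1"] by (simp add: zt_0 ev_one_eq)
  then show ?case using ed(2) by simp
next
  case (Suc m)
  obtain e d where ed: "\<And>x. ev x p = ev (x ^ 2) e + x * ev (x ^ 2) d" "poly p 1 = poly e 1 + poly d 1"
    using even_odd_parts[of p] by blast
  have "ev (zt m) e = - (zt (Suc m) * ev (zt m) d)"
    using Suc.prems ed(1)[of "zt (Suc m)"] by (simp add: zt_Suc add_eq_0_iff)
  then have "ev (zt m) e ^ 2 = zt m * ev (zt m) d ^ 2"
    by (simp add: power_mult_distrib zt_Suc)
  \<comment> \<open>The relative norm to the next lower level. At 1 this polynomial is the
    difference of the squares of the values of \<open>e\<close> and \<open>d\<close>, which has the
    parity of \<open>poly p 1\<close>.\<close>
  then have "ev (zt m) (e ^ 2 - [:0, 1:] * d ^ 2) = 0"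
    by simp
  from Suc.hyps[OF this] show ?case
    using ed(2) by simp
qed

text \<open>Total ramification of 2: modulo 2, repeated squaring turns \<open>X - 1\<close> into
  \<open>X ^ (2 ^ m) + 1\<close>, which vanishes at \<open>zt m\<close>. Oddness of \<open>h\<close>
  at 1 says that the cofactor is prime to the prime above 2.\<close>

lemma zt_minus_one_pow: "\<exists>h. (zt m - 1) ^ (2 ^ m) = 2 * ev (zt m) h \<and> odd (poly h 1)"
proof -
  have "\<exists>h. [:-1, 1:] ^ (2 ^ m) = monom 1 (2 ^ m) + 1 + 2 * (h :: int poly)"
  proof (induct m)
    case 0
    show ?case by (intro exI[of _ "-1"]) (simp add: monom_Suc monom_0 one_pCons numeral_poly)
  next
    case (Suc m)
    then obtain h :: "int poly" where h: "[:-1, 1:] ^ (2 ^ m) = monom 1 (2 ^ m) + 1 + 2 * h"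
      by blast
    have m2: "monom (1::int) (2 ^ Suc m) = monom 1 (2 ^ m) ^ 2"
      by (simp add: monom_power mult.commute)
    have "[:-1, 1:] ^ (2 ^ Suc m) = ([:-1, 1:] ^ (2 ^ m)) ^ (2::nat)"
      by (simp add: power_mult[symmetric] mult.commute)
    also have "\<dots> = (monom 1 (2 ^ m) + 1 + 2 * h) ^ 2"
      by (simp only: h)
    also have "\<dots> = monom 1 (2 ^ Suc m) + 1 +
        2 * (monom 1 (2 ^ m) + 2 * h * (monom 1 (2 ^ m) + 1) + 2 * h ^ 2)"
      unfolding m2 by (simp add: power2_eq_square algebra_simps)
    finally show ?case by blast
  qed
  then obtain h :: "int poly" where h: "[:-1, 1:] ^ (2 ^ m) = monom 1 (2 ^ m) + 1 + 2 * h"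
    by blast
  have "poly ([:-1, 1:] ^ (2 ^ m)) 1 = poly (monom 1 (2 ^ m) + 1 + 2 * h) 1"
    by (simp only: h)
  then have "0 = 2 + 2 * poly h 1"
    by (simp add: poly_power poly_monom power_0_left)
  then have "poly h 1 = -1" by simp
  moreover have "ev (zt m) ([:-1, 1:] ^ (2 ^ m)) = ev (zt m) (monom 1 (2 ^ m) + 1 + 2 * h)"
    by (simp only: h)
  then have "(zt m - 1) ^ (2 ^ m) = 2 * ev (zt m) h"
    by (simp add: zt_pow numeral_poly)
  ultimately show ?thesis by (intro exI[of _ h]) simp
qed

text \<open>Division by \<open>X - 1\<close> modulo 2, repeated until the quotient no longer
  vanishes at 1; \<open>i\<close> is the multiplicity of the root 1 of \<open>p\<close> modulo
  2.\<close>

lemma odd_coeff_split: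
  assumes "odd (coeff (p :: int poly) j)"
  shows "\<exists>i g r. i \<le> degree p \<and> p = 2 * g + [:-1, 1:] ^ i * r \<and> odd (poly r 1)"
  using assms
proof (induct "degree p" arbitrary: p j rule: less_induct)
  case less
  show ?case
  proof (cases "odd (poly p 1)")
    case True
    then show ?thesis by (intro exI[of _ 0] exI[of _ 0] exI[of _ p]) simp
  next
    case False
    then obtain c where c: "poly p 1 = 2 * c" by blast
    define q where "q = synthetic_div p 1"
    have pq: "p = [:-1, 1:] * q + [:2 * c:]"
      using synthetic_div_correct'[of 1 p] c by (simp add: q_def)
    have "\<exists>j. odd (coeff q j)"
    proof (rule ccontr)
      assume "\<not> ?thesis"
      then have ev: "\<And>j. even (coeff q j)" by blast
      have "even (coeff p j)"
        by (subst pq) (cases j, simp_all add: ev coeff_pCons)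
      then show False using less.prems by simp
    qed
    then obtain j' where j': "odd (coeff q j')" by blast
    have dp: "degree p > 0"
    proof (rule ccontr)
      assume "\<not> ?thesis"
      then have "q = 0" by (simp add: q_def synthetic_div_eq_0_iff)
      then show False using j' by simp
    qed
    have dq: "degree q = degree p - 1"
      by (simp add: q_def degree_synthetic_div)
    then have "degree q < degree p" using dp by simp
    from less.hyps[OF this j'] obtain i g r
      where igr: "i \<le> degree q" "q = 2 * g + [:-1, 1:] ^ i * r" "odd (poly r 1)"
      by blast
    have c2: "[:2 * c:] = 2 * [:c:]"
      by (simp add: numeral_poly)
    have "p = 2 * ([:-1, 1:] * g + [:c:]) + [:-1, 1:] ^ Suc i * r"
      by (subst pq, subst igr(2), subst c2) (simp only: power_Suc ring_distribs mult_ac add_ac)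
    moreover have "Suc i \<le> degree p" using igr(1) dq dp by simp
    ultimately show ?thesis using igr(3) by blast
  qed
qed

text \<open>Since the degree is below \<open>2 ^ m\<close>, the multiplicity \<open>i\<close> is
  below the ramification index. The number \<open>k\<close> is the positive gap between the
  valuations of \<open>ev (zt m) p\<close> and of 2.\<close>

lemma odd_coeff_lift:
  assumes "odd (coeff p j)" "\<And>i. 2 ^ m \<le> i \<Longrightarrow> coeff p i = 0"
  shows "\<exists>k u. k > 0 \<and> (zt m - 1) ^ k * ev (zt m) p = 2 * ev (zt m) u \<and> odd (poly u 1)"
proof -
  obtain i g r where igr: "i \<le> degree p" "p = 2 * g + [:-1, 1:] ^ i * r" "odd (poly r 1)"
    using odd_coeff_split[OF assms(1)] by blast
  have "p \<noteq> 0" using assms(1) by auto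
  then have d: "degree p < 2 ^ m"
    using assms(2)[of "degree p"] by (metis leading_coeff_0_iff not_le)
  obtain h where h: "(zt m - 1) ^ (2 ^ m) = 2 * ev (zt m) h" "odd (poly h 1)"
    using zt_minus_one_pow by blast
  define k where "k = 2 ^ m - i"
  have k: "k > 0" "k + i = 2 ^ m" using d igr(1) by (auto simp: k_def)
  define u where "u = [:-1, 1:] ^ k * g + h * r"
  have "(zt m - 1) ^ k * ev (zt m) p =
      2 * ((zt m - 1) ^ k * ev (zt m) g) + (zt m - 1) ^ (k + i) * ev (zt m) r"
    by (subst igr(2)) (simp add: numeral_poly power_add algebra_simps)
  also have "\<dots> = 2 * ev (zt m) u"
    unfolding add.commute[of k] by (simp add: k(2)[unfolded add.commute[of k]] h(1) u_def algebra_simps)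
  finally have "(zt m - 1) ^ k * ev (zt m) p = 2 * ev (zt m) u" .
  moreover have "odd (poly u 1)"
    using k(1) h(2) igr(3) by (simp add: u_def poly_power)
  ultimately show ?thesis using k(1) by blast
qed

text \<open>In terms of valuations, each factor with an odd coefficient stays strictly below 2, so
  the product of two such factors stays strictly below 4.\<close>

lemma ev_zt_mult_4:
  assumes "ev (zt m) p * ev (zt m) q = 4 * ev (zt m) r"
    and "\<And>i. 2 ^ m \<le> i \<Longrightarrow> coeff p i = 0" "\<And>i. 2 ^ m \<le> i \<Longrightarrow> coeff q i = 0"
  shows "(\<forall>i. even (coeff p i)) \<or> (\<forall>i. even (coeff q i))"
proof (rule ccontr)
  assume "\<not> ?thesis"
  then obtain i j where "odd (coeff p i)" "odd (coeff q j)" by blast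
  then obtain k u k' u' where ku: "k > 0" "(zt m - 1) ^ k * ev (zt m) p = 2 * ev (zt m) u" "odd (poly u 1)"
    and ku': "k' > 0" "(zt m - 1) ^ k' * ev (zt m) q = 2 * ev (zt m) u'" "odd (poly u' 1)"
    using odd_coeff_lift assms(2,3) by metis
  have "4 * (ev (zt m) u * ev (zt m) u') = ((zt m - 1) ^ k * ev (zt m) p) * ((zt m - 1) ^ k' * ev (zt m) q)"
    by (simp add: ku ku')
  also have "\<dots> = (zt m - 1) ^ k * (zt m - 1) ^ k' * (ev (zt m) p * ev (zt m) q)"
    by (simp add: mult_ac)
  also have "\<dots> = 4 * ((zt m - 1) ^ k * (zt m - 1) ^ k' * ev (zt m) r)"
    by (simp add: assms(1))
  finally have "ev (zt m) u * ev (zt m) u' = (zt m - 1) ^ k * (zt m - 1) ^ k' * ev (zt m) r"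
    by simp
  then have "ev (zt m) (u * u' - [:-1, 1:] ^ k * [:-1, 1:] ^ k' * r) = 0"
    by (simp)
  from ev_zt_zero_even[OF this] show False
    using ku(1,3) ku'(3) by (simp add: poly_power)
qed

text \<open>Infinite descent: a zero value makes all coefficients even, and halving them preserves
  both hypotheses.\<close>

lemma ev_zt_inj:
  assumes "ev (zt m) p = 0" "\<And>i. 2 ^ m \<le> i \<Longrightarrow> coeff p i = 0"
  shows "p = 0"
proof -
  have even_all: "even (coeff p i)"
    if p: "ev (zt m) p = 0" "\<And>i. 2 ^ m \<le> i \<Longrightarrow> coeff p i = 0" for p i
  proof (rule ccontr)
    assume "odd (coeff p i)"
    then obtain k u where "(zt m - 1) ^ k * ev (zt m) p = 2 * ev (zt m) u" "odd (poly u 1)"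
      using odd_coeff_lift p(2) by metis
    then show False using ev_zt_zero_even[of m u] p(1) by simp
  qed
  have "\<exists>q. p = smult (2 ^ k) q" for k
  proof (induct k)
    case 0
    show ?case by simp
  next
    case (Suc k)
    then obtain q where q: "p = smult (2 ^ k) q" by blast
    have "[:2:] dvd q"
      using even_all[of q] assms by (simp add: q const_poly_dvd_iff)
    then obtain q' where "q = smult 2 q'" by (auto elim!: dvdE)
    then have "p = smult (2 ^ Suc k) q'" using q by (simp add: mult.commute)
    then show ?case by blast
  qed
  then have dv: "2 ^ k dvd coeff p i" for k i
    by (metis coeff_smult dvd_triv_left)
  have "coeff p i = 0" for i
  proof (rule ccontr)
    assume "coeff p i \<noteq> 0"
    moreover have "\<bar>coeff p i\<bar> < 2 ^ nat \<bar>coeff p i\<bar>"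
      by (metis abs_ge_zero int_nat_eq of_nat_less_two_power)
    ultimately show False
      using dvd_imp_le_int[OF _ dv[of "nat \<bar>coeff p i\<bar>" i]] by simp
  qed
  then show ?thesis by (simp add: poly_eq_iff)
qed

lemma ev_zt_reduce:
  "\<exists>q. (\<forall>i\<ge>2 ^ m. coeff q i = 0) \<and> ev (zt m) q = ev (zt m) p"
proof (induct p)
  case 0
  show ?case by (intro exI[of _ 0]) simp
next
  case (pCons a p)
  then obtain q where q: "\<forall>i\<ge>2 ^ m. coeff q i = 0" "ev (zt m) q = ev (zt m) p" by blast
  define c where "c = coeff q (2 ^ m - 1)"
  define r where "r = pCons a q - smult c (monom 1 (2 ^ m) + 1)"
  have "coeff r i = 0" if "i \<ge> 2 ^ m" for i
  proof (cases "i = 2 ^ m")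
    case True
    then show ?thesis
      by (cases "2 ^ m :: nat") (simp_all add: r_def c_def)
  next
    case False
    then have "i - 1 \<ge> 2 ^ m" "i > 0" using that by auto
    then have "coeff (pCons a q) i = 0" using q(1) by (cases i) auto
    then show ?thesis using False \<open>i > 0\<close> by (simp add: r_def)
  qed
  moreover have "ev (zt m) r = ev (zt m) (pCons a p)"
    using q(2) by (simp add: r_def zt_pow)
  ultimately show ?case by blast
qed

text \<open>Linear independence of 1 and \<open>zt (Suc m)\<close> over the ring one level lower:
  the reduced forms of \<open>e\<close> and \<open>d\<close>, interleaved as even and odd
  coefficients, make up one polynomial to which \<open>ev_zt_inj\<close> applies.\<close>

lemma ev_zt_Suc_indep:
  assumes "ev (zt m) e + zt (Suc m) * ev (zt m) d = 0"
  shows "ev (zt m) d = 0"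
proof -
  obtain e' where e': "\<forall>i\<ge>2 ^ m. coeff e' i = 0" "ev (zt m) e' = ev (zt m) e"
    using ev_zt_reduce by blast
  obtain d' where d': "\<forall>i\<ge>2 ^ m. coeff d' i = 0" "ev (zt m) d' = ev (zt m) d"
    using ev_zt_reduce by blast
  define sq :: "int poly" where "sq = [:0, 0, 1:]"
  have sq: "ev x (pcompose p sq) = ev (x ^ 2) p" for x p
    by (induct p) (simp_all add: pcompose_pCons sq_def power2_eq_square algebra_simps)
  have csq: "coeff (pcompose p sq) i = (if even i then coeff p (i div 2) else 0)" for p i
  proof (induct p arbitrary: i)
    case (pCons a p)
    have "coeff (pcompose (pCons a p) sq) i = coeff (pCons a (pCons 0 (pcompose p sq))) i"
      by (simp add: pcompose_pCons sq_def)
    then show ?case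
      using pCons by (cases i; cases "i - 1") (auto simp: coeff_pCons split: nat.splits)
  qed simp
  define p where "p = pcompose e' sq + pCons 0 (pcompose d' sq)"
  have cp: "coeff p (Suc (2 * i)) = coeff d' i" for i
    by (simp add: p_def csq)
  have "p = 0"
  proof (rule ev_zt_inj[of "Suc m"])
    show "ev (zt (Suc m)) p = 0"
      using assms by (simp add: p_def sq zt_Suc e' d')
    show "coeff p i = 0" if "2 ^ Suc m \<le> i" for i
      using that e'(1) d'(1) by (cases i) (auto simp: p_def csq)
  qed
  then have "d' = 0" using cp by (simp add: poly_eq_iff)
  then show ?thesis using d'(2) by simp
qed

text \<open>If \<open>x\<close> and \<open>x'\<close> are conjugate roots of a cubic, then the third root is
  determined by the trace.\<close>

lemma cubic_third_root:
  fixes a b :: "'a :: field_char_0"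
  assumes "a ^ 3 + 3 * a * b = c2 * (a ^ 2 + b) + c1 * a + c0"
    and "3 * a ^ 2 + b = 2 * c2 * a + c1"
  shows "(c2 - 2 * a) ^ 3 = c2 * (c2 - 2 * a) ^ 2 + c1 * (c2 - 2 * a) + c0"
proof -
  have b: "b = 2 * c2 * a + c1 - 3 * a ^ 2" using assms(2) by (simp add: algebra_simps)
  have "(c2 - 2 * a) ^ 3 - (c2 * (c2 - 2 * a) ^ 2 + c1 * (c2 - 2 * a) + c0) =
      a ^ 3 + 3 * a * b - (c2 * (a ^ 2 + b) + c1 * a + c0)"
    unfolding b by (simp add: power2_eq_square power3_eq_cube algebra_simps)
  then show ?thesis using assms(1) by simp
qed

text \<open>Descent along the quadratic tower: a root that is not already in the lower ring comes
  with its conjugate, and the third root, the trace minus these two, lies one level lower. At level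
  0 the ring is that of the integers.\<close>

lemma cubic_integer_root:
  assumes "x \<in> range (ev (zt m))" "x ^ 3 = of_int c2 * x ^ 2 + of_int c1 * x + of_int c0"
  shows "\<exists>k::int. k ^ 3 = c2 * k ^ 2 + c1 * k + c0"
  using assms
proof (induct m arbitrary: x)
  case 0
  then obtain p where "x = ev (-1) p" by (auto simp: zt_0)
  moreover have "ev (-1) p = of_int (poly p (-1))" by (induct p) simp_all
  ultimately have "(of_int (poly p (-1) ^ 3) :: complex) =
      of_int (c2 * poly p (-1) ^ 2 + c1 * poly p (-1) + c0)"
    using 0 by simp
  then show ?case unfolding of_int_eq_iff by blast
next
  case (Suc m)
  then obtain p where p: "x = ev (zt (Suc m)) p" by auto
  obtain e d where ed: "\<And>x. ev x p = ev (x ^ 2) e + x * ev (x ^ 2) d"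
    using even_odd_parts[of p] by blast
  define y where "y = zt m"
  define u where "u = ev y e"
  define w where "w = ev y d"
  define s where "s = zt (Suc m)"
  have s2: "s ^ 2 = y" by (simp add: s_def y_def zt_Suc)
  have x: "x = u + s * w" by (simp add: p ed u_def w_def s_def y_def zt_Suc)
  have eq: "(u ^ 3 + 3 * u * (y * w ^ 2) - (of_int c2 * (u ^ 2 + y * w ^ 2) + of_int c1 * u + of_int c0))
      + s * (w * (3 * u ^ 2 + y * w ^ 2 - (2 * of_int c2 * u + of_int c1))) = 0"
    using Suc.prems(2) unfolding x s2[symmetric]
    by (simp add: power2_eq_square power3_eq_cube algebra_simps)
  \<comment> \<open>\<open>U\<close> and \<open>V\<close> exhibit the two components of the
    equation, free of \<open>s\<close> and with factor \<open>s\<close>, as values of integer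
    polynomials, as \<open>ev_zt_Suc_indep\<close> requires.\<close>
  define U where "U = e ^ 3 + [:3:] * e * ([:0, 1:] * d ^ 2) - ([:c2:] * (e ^ 2 + [:0, 1:] * d ^ 2) + [:c1:] * e + [:c0:])"
  define V where "V = d * ([:3:] * e ^ 2 + [:0, 1:] * d ^ 2 - ([:2:] * [:c2:] * e + [:c1:]))"
  have U: "ev y U = u ^ 3 + 3 * u * (y * w ^ 2) - (of_int c2 * (u ^ 2 + y * w ^ 2) + of_int c1 * u + of_int c0)"
    and V: "ev y V = w * (3 * u ^ 2 + y * w ^ 2 - (2 * of_int c2 * u + of_int c1))"
    by (simp_all add: U_def V_def u_def w_def)
  have V0: "ev y V = 0"
    using ev_zt_Suc_indep[of m U V] eq unfolding y_def[symmetric] s_def[symmetric] U V by simp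
  have "ev y U + s * ev y V = 0" using eq by (simp only: U V)
  then have U0: "ev y U = 0" using V0 by simp
  show ?case
  proof (cases "w = 0")
    case True
    then have "u ^ 3 = of_int c2 * u ^ 2 + of_int c1 * u + of_int c0"
      using U0 U by simp
    moreover have "u \<in> range (ev (zt m))" by (simp add: u_def y_def)
    ultimately show ?thesis using Suc.hyps by blast
  next
    case False
    have "(of_int c2 - 2 * u) ^ 3 = of_int c2 * (of_int c2 - 2 * u) ^ 2 + of_int c1 * (of_int c2 - 2 * u) + of_int c0"
      by (rule cubic_third_root[of u "y * w ^ 2"]) (use U0 V0 U V False in auto)
    moreover have "of_int c2 - 2 * u = ev (zt m) ([:c2:] - [:2:] * e)"
      by (simp add: u_def y_def)
    then have "of_int c2 - 2 * u \<in> range (ev (zt m))" by blast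
    ultimately show ?thesis using Suc.hyps by blast
  qed
qed

section \<open>Convolution and Fourier transform on the dihedral group\<close>

definition S :: "int \<Rightarrow> (int \<Rightarrow> 'c::comm_monoid_add) \<Rightarrow> 'c" where
  "S N u = (\<Sum>i\<in>{0..<N}. u i)"

definition periodic :: "int \<Rightarrow> (int \<Rightarrow> 'c) \<Rightarrow> bool" where
  "periodic N u \<longleftrightarrow> (\<forall>i. u (i + N) = u i)"

lemma periodic_mult:
  assumes "periodic N u" shows "u (i + k * N) = u i"
proof -
  have *: "u (i + int m * N) = u i" for m i
  proof (induct m)
    case (Suc m)
    have "u (i + int (Suc m) * N) = u ((i + int m * N) + N)" by (simp add: algebra_simps)
    then show ?case using Suc assms by (simp add: periodic_def)
  qed simp
  show ?thesis
  proof (cases "k \<ge> 0")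
    case True
    then show ?thesis using *[of i "nat k"] by simp
  next
    case False
    then show ?thesis using *[of "i + k * N" "nat (- k)"] by simp
  qed
qed

lemma periodic_mod: "periodic N u \<Longrightarrow> u (i mod N) = u i"
  using periodic_mult[of N u "i mod N" "i div N"] by simp

lemma periodic_cong: "periodic N u \<Longrightarrow> N dvd i - j \<Longrightarrow> u i = u j"
  using periodic_mult[of N u j] by (auto elim!: dvdE simp: algebra_simps)

lemma S_shift:
  assumes "N > 0" "periodic N u"
  shows "S N (\<lambda>i. u (i + k)) = S N u"
  unfolding S_def
  by (rule sum.reindex_bij_witness[of _ "\<lambda>i. (i - k) mod N" "\<lambda>i. (i + k) mod N"])
    (use assms in \<open>auto simp: periodic_mod mod_simps\<close>)

lemma S_reflect:
  assumes "N > 0" "periodic N u"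
  shows "S N (\<lambda>i. u (k - i)) = S N u"
  unfolding S_def
  by (rule sum.reindex_bij_witness[of _ "\<lambda>i. (k - i) mod N" "\<lambda>i. (k - i) mod N"])
    (use assms in \<open>auto simp: periodic_mod mod_simps\<close>)

lemma S_cong: "(\<And>i. u i = v i) \<Longrightarrow> S N u = S N v"
  by (simp add: S_def)

lemma S_add: "S N (\<lambda>i. u i + v i) = S N u + S N v"
  by (simp add: S_def sum.distrib)

lemma S_diff: "S N (\<lambda>i. u i - v i) = S N u - (S N v :: 'c :: ab_group_add)"
  by (simp add: S_def sum_subtractf)

lemma S_cmult: "S N (\<lambda>i. c * u i) = c * (S N u :: 'c :: semiring_0)"
  by (simp add: S_def sum_distrib_left)

lemma S_swap: "S N (\<lambda>i. S N (\<lambda>j. u i j)) = S N (\<lambda>j. S N (\<lambda>i. u i j))"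
  unfolding S_def by (rule sum.swap)

lemma S_nonneg: "(\<And>i. (0::'c::ordered_comm_monoid_add) \<le> u i) \<Longrightarrow> 0 \<le> S N u"
  by (simp add: S_def sum_nonneg)

lemma S_zero_iff:
  assumes "N > 0" "periodic N u" "\<And>i. (0::int) \<le> u i"
  shows "S N u = 0 \<longleftrightarrow> (\<forall>i. u i = 0)"
proof
  assume "S N u = 0"
  then have *: "u i = 0" if "i \<in> {0..<N}" for i
    using assms(3) that by (simp add: S_def sum_nonneg_eq_0_iff)
  show "\<forall>i. u i = 0"
  proof
    fix i show "u i = 0"
      using *[of "i mod N"] assms(1,2) by (simp add: periodic_mod)
  qed
qed (simp add: S_def)

lemma S_delta:
  assumes "N > 0" "periodic N (u :: int \<Rightarrow> 'c :: semiring_1)"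
  shows "S N (\<lambda>i. (if N dvd i - k then 1 else 0) * u i) = u k"
proof -
  have "S N (\<lambda>i. (if N dvd i - k then 1 else 0) * u i) = (\<Sum>i\<in>{0..<N}. if i = k mod N then u i else 0)"
    unfolding S_def
  proof (rule sum.cong[OF refl])
    fix i assume "i \<in> {0..<N}"
    then have "N dvd i - k \<longleftrightarrow> i = k mod N"
      by (metis atLeastLessThan_iff mod_eq_dvd_iff mod_pos_pos_trivial)
    then show "(if N dvd i - k then 1 else 0) * u i = (if i = k mod N then u i else 0)" by simp
  qed
  also have "\<dots> = u k" using assms by (simp add: periodic_mod)
  finally show ?thesis .
qed

lemma S_of_int: "S N (\<lambda>i. of_int (u i)) = of_int (S N u)"
  by (simp add: S_def)

lemma S_divide:
  assumes "h > 0" "l > 0"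
  shows "S (h * l) u = S h (\<lambda>i. S l (\<lambda>j. u (i + h * j)))"
proof -
  have "S h (\<lambda>i. S l (\<lambda>j. u (i + h * j))) = (\<Sum>x\<in>{0..<h} \<times> {0..<l}. u (fst x + h * snd x))"
    by (simp add: S_def sum.cartesian_product case_prod_unfold)
  also have "\<dots> = (\<Sum>k\<in>{0..<h * l}. u k)"
  proof (rule sum.reindex_bij_witness[of _ "\<lambda>k. (k mod h, k div h)" "\<lambda>x. fst x + h * snd x"])
    fix x assume "x \<in> {0..<h} \<times> {0..<l}"
    then obtain i j where x: "x = (i, j)" "0 \<le> i" "i < h" "0 \<le> j" "j \<le> l - 1" by auto
    show "((fst x + h * snd x) mod h, (fst x + h * snd x) div h) = x"
      using x assms by auto
    have "h * j \<le> h * (l - 1)" using x assms by (intro mult_left_mono) auto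
    then show "fst x + h * snd x \<in> {0..<h * l}" using x assms by (auto simp: algebra_simps)
  next
    fix k assume k: "k \<in> {0..<h * l}"
    have "h * (k div h) \<le> k" using assms(1) by (metis mult_div_mod_eq le_add_same_cancel1 pos_mod_sign)
    then have "h * (k div h) < h * l" using k by simp
    then have "k div h < l" using assms by simp
    then show "(k mod h, k div h) \<in> {0..<h} \<times> {0..<l}"
      using k assms by (simp add: pos_imp_zdiv_nonneg_iff)
  qed auto
  finally show ?thesis by (simp add: S_def)
qed

lemma even_S: "(\<And>i. even (u i :: int)) \<Longrightarrow> even (S N u)"
  by (simp add: S_def dvd_sum)

text \<open>A pair \<open>(False, i)\<close> stands for the rotation \<open>c\<^sup>i\<close>, a pair \<open>(True, i)\<close> for the
  reflection \<open>c\<^sup>i s\<close>; elements of the group algebra are functions of period \<open>N\<close>.\<close>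

type_synonym pt = "bool \<times> int"

text \<open>Exponents are not reduced, so this is multiplication in the infinite dihedral group; the
  order of \<open>c\<close> enters only through the periodicity of functions.\<close>

definition pm :: "pt \<Rightarrow> pt \<Rightarrow> pt" where
  "pm x y = (fst x \<noteq> fst y, if fst x then snd x - snd y else snd x + snd y)"

definition pinv :: "pt \<Rightarrow> pt" where
  "pinv x = (fst x, if fst x then snd x else - snd x)"

lemma pm_simps [simp]:
  "pm (False, i) (q, j) = (q, i + j)"
  "pm (True, i) (q, j) = (\<not> q, i - j)"
  by (simp_all add: pm_def)

lemma pinv_simps [simp]:
  "pinv (False, i) = (False, - i)"
  "pinv (True, i) = (True, i)"
  by (simp_all add: pinv_def)

lemma pm_assoc: "pm (pm x y) z = pm x (pm y z)"
  by (cases x; cases y; cases z; cases "fst x"; cases "fst y") auto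

lemma pinv_pinv [simp]: "pinv (pinv x) = x"
  by (cases x; cases "fst x") auto

lemma pinv_pm: "pinv (pm x y) = pm (pinv y) (pinv x)"
  by (cases x; cases y; cases "fst x"; cases "fst y") auto

lemma pm_pinv_cancel [simp]: "pm (pinv x) (pm x y) = y" "pm x (pm (pinv x) y) = y"
  by (cases x; cases y; cases "fst x"; cases "fst y"; force)+

lemma pm_pinv_cancel' [simp]: "pm (pm y x) (pinv x) = y" "pm (pm y (pinv x)) x = y"
  by (cases x; cases y; cases "fst x"; cases "fst y"; force)+

definition per :: "int \<Rightarrow> (pt \<Rightarrow> 'c) \<Rightarrow> bool" where
  "per N f \<longleftrightarrow> (\<forall>p. periodic N (\<lambda>i. f (p, i)))"

definition tot :: "int \<Rightarrow> (pt \<Rightarrow> 'c::comm_monoid_add) \<Rightarrow> 'c" where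
  "tot N f = S N (\<lambda>i. f (False, i)) + S N (\<lambda>i. f (True, i))"

definition conv :: "int \<Rightarrow> (pt \<Rightarrow> int) \<Rightarrow> (pt \<Rightarrow> int) \<Rightarrow> pt \<Rightarrow> int" where
  "conv N f g x = tot N (\<lambda>y. f y * g (pm (pinv y) x))"

lemma perD: "per N f \<Longrightarrow> periodic N (\<lambda>i. f (p, i))"
  by (simp add: per_def)

lemma per_neg: "periodic N u \<Longrightarrow> periodic N (\<lambda>i. u (- i))"
  using periodic_mult[of N u _ "-1"] by (auto simp: periodic_def)

lemma per_shift:
  assumes u: "periodic N u"
  shows "periodic N (\<lambda>i. u (i + k))" "periodic N (\<lambda>i. u (k + i))"
    "periodic N (\<lambda>i. u (i - k))" "periodic N (\<lambda>i. u (k - i))"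
proof -
  have *: "u (k + i + N) = u (k + i)" "u (i - k + N) = u (i - k)" "u (k - (i + N) + N) = u (k - (i + N))" for i
    using u unfolding periodic_def by blast+
  then show "periodic N (\<lambda>i. u (i + k))" "periodic N (\<lambda>i. u (k + i))"
    "periodic N (\<lambda>i. u (i - k))" "periodic N (\<lambda>i. u (k - i))"
    by (simp_all add: periodic_def algebra_simps)
qed

lemma tot_pm_left:
  assumes "N > 0" "per N f"
  shows "tot N (\<lambda>y. f (pm x y)) = tot N f"
proof (cases x)
  case (Pair p i)
  then show ?thesis
    using S_shift[OF assms(1) perD[OF assms(2)]] S_reflect[OF assms(1) perD[OF assms(2)]]
    by (cases p) (simp_all add: tot_def add.commute[of i] add.commute[of "S N (\<lambda>i. f (True, i))"])
qed

lemma per_pm: assumes "per N f" shows "per N (\<lambda>y. f (pm y x))" "per N (\<lambda>y. f (pm x y))" "per N (\<lambda>y. f (pinv y))"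
proof -
  have f: "periodic N (\<lambda>i. f (p, i))" for p using assms by (rule perD)
  show "per N (\<lambda>y. f (pm y x))" "per N (\<lambda>y. f (pm x y))"
    using per_shift(1)[OF f] per_shift(2)[OF f] per_shift(3)[OF f] per_shift(4)[OF f]
    unfolding per_def by (cases x; cases "fst x"; auto simp: all_bool_eq)+
  show "per N (\<lambda>y. f (pinv y))"
    using f per_neg[OF f] unfolding per_def by (auto simp: all_bool_eq)
qed

lemma per_mult: "per N f \<Longrightarrow> per N g \<Longrightarrow> per N (\<lambda>y. f y * g y)"
  by (simp add: per_def periodic_def)

lemma tot_cong: "(\<And>x. f x = g x) \<Longrightarrow> tot N f = tot N g"
  by (simp add: tot_def)

lemma tot_add: "tot N (\<lambda>x. f x + g x) = tot N f + tot N g"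
  by (simp add: tot_def S_add add_ac)

lemma tot_diff: "tot N (\<lambda>x. f x - g x) = tot N f - (tot N g :: 'c :: ab_group_add)"
  by (simp add: tot_def S_diff algebra_simps)

lemma tot_cmult: "tot N (\<lambda>x. c * f x) = c * (tot N f :: 'c :: comm_semiring_0)"
  by (simp add: tot_def S_cmult algebra_simps)

lemma tot_swap: "tot N (\<lambda>x. tot N (\<lambda>y. f x y)) = tot N (\<lambda>y. tot N (\<lambda>x. f x y))"
proof -
  note * = S_swap[of N "\<lambda>i j. f (p, i) (q, j)" for p q]
  show ?thesis
    unfolding tot_def S_add using *[of False False] *[of False True] *[of True False] *[of True True]
    by (simp only: add_ac)
qed

lemma tot_zero_iff:
  assumes "N > 0" "per N f" "\<And>x. (0::int) \<le> f x"
  shows "tot N f = 0 \<longleftrightarrow> (\<forall>x. f x = 0)"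
proof -
  have "0 \<le> S N (\<lambda>i. f (False, i))" "0 \<le> S N (\<lambda>i. f (True, i))"
    using assms(3) by (simp_all add: S_nonneg)
  then have "tot N f = 0 \<longleftrightarrow> S N (\<lambda>i. f (False, i)) = 0 \<and> S N (\<lambda>i. f (True, i)) = 0"
    unfolding tot_def by linarith
  also have "\<dots> \<longleftrightarrow> (\<forall>i. f (False, i) = 0) \<and> (\<forall>i. f (True, i) = 0)"
    using assms by (simp add: S_zero_iff perD)
  finally show ?thesis by (auto simp: all_bool_eq split_paired_All)
qed

lemma conv_False: "conv N f g (False, j) =
    S N (\<lambda>i. f (False, i) * g (False, j - i)) + S N (\<lambda>i. f (True, i) * g (True, i - j))"
  by (simp add: conv_def tot_def)

lemma conv_True: "conv N f g (True, j) =
    S N (\<lambda>i. f (False, i) * g (True, j - i)) + S N (\<lambda>i. f (True, i) * g (False, i - j))"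
  by (simp add: conv_def tot_def)

text \<open>Inversion reverses products. For a symmetric S-ring this is the source of
  commutativity.\<close>

lemma conv_pinv:
  assumes "N > 0" "per N f" "per N g" "\<And>x. f (pinv x) = f x" "\<And>x. g (pinv x) = g x"
  shows "conv N f g (pinv x) = conv N g f x"
proof -
  have "conv N f g (pinv x) = tot N (\<lambda>y. f y * g (pm x y))"
    unfolding conv_def using assms(5)[of "pm x _"] by (simp add: pinv_pm)
  also have "\<dots> = tot N (\<lambda>y. f (pm (pinv x) y) * g y)"
    using tot_pm_left[OF assms(1), of "\<lambda>y. f (pm (pinv x) y) * g y" x] assms(2,3)
    by (simp add: per_mult per_pm)
  also have "\<dots> = conv N g f x"
    unfolding conv_def using assms(4)[of "pm (pinv _) x"]
    by (simp add: pinv_pm mult.commute)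
  finally show ?thesis .
qed

section \<open>Fourier transform on the rotations and the representations of degree two\<close>

definition w :: "int \<Rightarrow> int \<Rightarrow> int \<Rightarrow> complex" where
  "w N k i = cis (2 * pi * of_int k * of_int i / of_int N)"

lemma w_add: "w N k (i + j) = w N k i * w N k j"
  by (simp add: w_def cis_mult ring_distribs add_divide_distrib)

lemma w_0 [simp]: "w N k 0 = 1" "w N 0 i = 1"
  by (simp_all add: w_def)

lemma w_uminus: "w N k (- i) = cnj (w N k i)"
  by (simp add: w_def cis_cnj)

lemma w_N: "N > 0 \<Longrightarrow> periodic N (w N k)"
proof -
  assume "N > 0"
  then have "w N k N = 1"
    using cis_multiple_2pi[of "of_int k"] by (simp add: w_def)
  then show ?thesis by (simp add: periodic_def w_add)
qed

definition hat :: "int \<Rightarrow> int \<Rightarrow> (int \<Rightarrow> int) \<Rightarrow> complex" where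
  "hat N k u = S N (\<lambda>i. of_int (u i) * w N k i)"

lemma hat_add: "hat N k (\<lambda>i. u i + v i) = hat N k u + hat N k v"
  by (simp add: hat_def S_add ring_distribs)

lemma hat_diff: "hat N k (\<lambda>i. u i - v i) = hat N k u - hat N k v"
  by (simp add: hat_def S_diff ring_distribs)

lemma hat_cmult: "hat N k (\<lambda>i. c * u i) = of_int c * hat N k u"
  by (simp add: hat_def mult.assoc S_cmult)

lemma hat_neg:
  assumes "N > 0" "periodic N u"
  shows "hat N k (\<lambda>i. u (- i)) = cnj (hat N k u)"
proof -
  have "hat N k (\<lambda>i. u (- i)) = S N (\<lambda>i. of_int (u i) * w N k (- i))"
    unfolding hat_def
    using S_reflect[OF assms(1), of "\<lambda>i. of_int (u i) * w N k (- i)" 0] assms per_neg[OF w_N[OF assms(1)]]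
    by (simp add: periodic_def)
  then show ?thesis by (simp add: hat_def S_def w_uminus)
qed

lemma hat_conv:
  assumes "N > 0" "periodic N v"
  shows "hat N k (\<lambda>j. S N (\<lambda>i. u i * v (j - i))) = hat N k u * hat N k v"
proof -
  have "hat N k (\<lambda>j. S N (\<lambda>i. u i * v (j - i))) =
      S N (\<lambda>j. S N (\<lambda>i. of_int (u i) * of_int (v (j - i)) * w N k j))"
    by (simp add: hat_def S_of_int[symmetric] S_def sum_distrib_right)
  also have "\<dots> = S N (\<lambda>i. of_int (u i) * w N k i * S N (\<lambda>j. of_int (v (j - i)) * w N k (j - i)))"
    by (subst S_swap) (simp add: S_cmult[symmetric] mult_ac flip: w_add)
  also have "\<dots> = S N (\<lambda>i. of_int (u i) * w N k i * hat N k v)"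
    unfolding hat_def
    using S_shift[OF assms(1), of "\<lambda>j. of_int (v j) * w N k j" "- _"] assms w_N[OF assms(1)]
    by (simp add: periodic_def)
  finally show ?thesis by (simp add: hat_def S_def sum_distrib_right)
qed

lemma hat_corr:
  assumes "N > 0" "periodic N v"
  shows "hat N k (\<lambda>j. S N (\<lambda>i. u i * v (i - j))) = hat N k u * cnj (hat N k v)"
  using hat_conv[OF assms(1) per_neg[OF assms(2)], of k u] hat_neg[OF assms] by simp

text \<open>The first row of the matrix of \<open>f\<close> in the representation that sends \<open>c\<close> to the diagonal
  matrix with entries \<open>w N k 1\<close> and its conjugate, and \<open>s\<close> to the permutation matrix; the second
  row consists of the conjugates of \<open>be\<close> and \<open>al\<close>.\<close>

definition al :: "int \<Rightarrow> int \<Rightarrow> (pt \<Rightarrow> int) \<Rightarrow> complex" where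
  "al N k f = hat N k (\<lambda>i. f (False, i))"

definition be :: "int \<Rightarrow> int \<Rightarrow> (pt \<Rightarrow> int) \<Rightarrow> complex" where
  "be N k f = hat N k (\<lambda>i. f (True, i))"

lemma al_conv:
  assumes "N > 0" "per N f" "per N g"
  shows "al N k (conv N f g) = al N k f * al N k g + be N k f * cnj (be N k g)"
  unfolding al_def be_def conv_False
  using hat_conv[OF assms(1) perD[OF assms(3), of False]] hat_corr[OF assms(1) perD[OF assms(3), of True]]
  by (simp add: hat_add)

lemma be_conv:
  assumes "N > 0" "per N f" "per N g"
  shows "be N k (conv N f g) = al N k f * be N k g + be N k f * cnj (al N k g)"
  unfolding al_def be_def conv_True
  using hat_conv[OF assms(1) perD[OF assms(3), of True]] hat_corr[OF assms(1) perD[OF assms(3), of False]]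
  by (simp add: hat_add)

lemma al_real:
  assumes "N > 0" "per N f" "\<And>x. f (pinv x) = f x"
  shows "cnj (al N k f) = al N k f"
  unfolding al_def using hat_neg[OF assms(1) perD[OF assms(2)], of k False] assms(3)[of "(False, _)"] by simp

lemma al_linear:
  "al N k (\<lambda>x. f x + g x) = al N k f + al N k g" "be N k (\<lambda>x. f x + g x) = be N k f + be N k g"
  "al N k (\<lambda>x. f x - g x) = al N k f - al N k g" "be N k (\<lambda>x. f x - g x) = be N k f - be N k g"
  "al N k (\<lambda>x. c * f x) = of_int c * al N k f" "be N k (\<lambda>x. c * f x) = of_int c * be N k f"
  by (simp_all add: al_def be_def hat_add hat_diff hat_cmult)

context
  fixes m :: nat
begin

abbreviation (input) "MM \<equiv> (2::int) ^ m"
abbreviation (input) "NN \<equiv> (2::int) ^ Suc m"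

lemma w_zt: "i \<ge> 0 \<Longrightarrow> w NN 1 i = zt m ^ nat i"
  by (simp add: w_def zt_def DeMoivre mult_ac)

text \<open>The character \<open>w\<close> changes sign under translation by half the period, so the
  two halves of the sum fold into one polynomial of degree below \<open>2 ^ m\<close> in the root of
  unity.\<close>

lemma hat_ev:
  fixes u :: "int \<Rightarrow> int"
  defines "p \<equiv> (\<Sum>i<2 ^ m. monom (u (int i) - u (int i + MM)) i)"
  shows "hat NN 1 u = ev (zt m) p"
    and "i < 2 ^ m \<Longrightarrow> coeff p i = u (int i) - u (int i + MM)"
    and "2 ^ m \<le> i \<Longrightarrow> coeff p i = 0"
proof -
  have wm: "w NN 1 (i + MM) = - w NN 1 i" for i
    using w_zt[of MM] zt_pow[of m] by (simp add: w_add nat_power_eq)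
  have pos: "MM > 0" by simp
  have "{0..<NN} = {0..<MM} \<union> {MM..<NN}"
    by (rule ivl_disj_un_two(3)[symmetric]) simp_all
  then have "hat NN 1 u = (\<Sum>i\<in>{0..<MM}. of_int (u i) * w NN 1 i) + (\<Sum>i\<in>{MM..<NN}. of_int (u i) * w NN 1 i)"
    unfolding hat_def S_def by (simp only:) (rule sum.union_disjoint; force)
  also have "(\<Sum>i\<in>{MM..<NN}. of_int (u i) * w NN 1 i) = (\<Sum>i\<in>{0..<MM}. of_int (u (i + MM)) * w NN 1 (i + MM))"
    by (rule sum.reindex_bij_witness[of _ "\<lambda>i. i + MM" "\<lambda>i. i - MM"]) auto
  also have "(\<Sum>i\<in>{0..<MM}. of_int (u i) * w NN 1 i) + \<dots> =
      (\<Sum>i\<in>{0..<MM}. of_int (u i - u (i + MM)) * w NN 1 i)"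
    unfolding sum.distrib[symmetric]
    by (rule sum.cong[OF refl]) (simp only: wm of_int_diff left_diff_distrib mult_minus_right add_uminus_conv_diff)
  also have "\<dots> = (\<Sum>i<2 ^ m. of_int (u (int i) - u (int i + MM)) * zt m ^ i)"
  proof (rule sum.reindex_bij_witness[of _ int nat])
    fix i assume i: "i \<in> {0..<MM}"
    then show "int (nat i) = i" "nat i \<in> {..<2 ^ m}" by (simp_all add: nat_less_iff)
    show "of_int (u (int (nat i)) - u (int (nat i) + MM)) * zt m ^ nat i = of_int (u i - u (i + MM)) * w NN 1 i"
      using i by (simp only: w_zt atLeastLessThan_iff int_nat_eq if_True)
  next
    fix i :: nat assume "i \<in> {..<2 ^ m}"
    then show "nat (int i) = i" "int i \<in> {0..<MM}" by simp_all
  qed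
  finally show "hat NN 1 u = ev (zt m) p"
    by (simp add: p_def ev_sum)
  show "i < 2 ^ m \<Longrightarrow> coeff p i = u (int i) - u (int i + MM)"
    by (simp add: p_def coeff_sum)
  show "2 ^ m \<le> i \<Longrightarrow> coeff p i = 0"
    by (auto simp add: p_def coeff_sum intro!: sum.neutral)
qed

text \<open>The coefficients in \<open>hat_ev\<close> cover half a period only; moving on by half a
  period negates the difference, hence the closure of \<open>P\<close> under negation.\<close>

lemma all_half:
  fixes u :: "int \<Rightarrow> int"
  assumes "periodic NN u" "\<And>i. i < 2 ^ m \<Longrightarrow> P (u (int i) - u (int i + MM))" "\<And>c. P c \<Longrightarrow> P (- c)"
  shows "P (u i - u (i + MM))"
proof -
  define j where "j = i mod MM"
  have "j \<ge> 0" "j < MM" unfolding j_def by (rule pos_mod_sign pos_mod_bound, simp)+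
  have *: "u (j + k * NN) = u j" "u (j + MM + k * NN) = u (j + MM)" for k
    by (rule periodic_mult[OF assms(1)])+
  have "nat j < 2 ^ m" using \<open>j \<ge> 0\<close> \<open>j < MM\<close> by (simp add: nat_less_iff)
  from assms(2)[OF this] have P: "P (u j - u (j + MM))" using \<open>j \<ge> 0\<close> by simp
  have i: "i = j + (i div MM) * MM" unfolding j_def by (metis mod_div_mult_eq)
  show ?thesis
  proof (cases "even (i div MM)")
    case True
    then obtain k where "i div MM = 2 * k" by blast
    then have i: "i = j + k * NN" "i + MM = (j + MM) + k * NN" using i by (simp_all add: mult_ac)
    have "u i = u j" "u (i + MM) = u (j + MM)" unfolding i(2) unfolding i(1) by (rule *)+
    then show ?thesis using P by simp
  next
    case False
    then obtain k where "i div MM = 2 * k + 1" by (auto elim: oddE)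
    then have i: "i = (j + MM) + k * NN" "i + MM = j + (k + 1) * NN"
      using i by (simp_all add: ring_distribs)
    have "u i = u (j + MM)" "u (i + MM) = u j" unfolding i(2) unfolding i(1) by (rule *)+
    moreover have "u (j + MM) - u j = - (u j - u (j + MM))" by simp
    ultimately show ?thesis using assms(3)[OF P] by (simp only:)
  qed
qed

lemma hat_zero_iff:
  assumes "periodic NN u"
  shows "hat NN 1 u = 0 \<longleftrightarrow> (\<forall>i. u (i + MM) = u i)"
proof
  assume 0: "hat NN 1 u = 0"
  have "u (int i) - u (int i + MM) = 0" if "i < 2 ^ m" for i
    using ev_zt_inj[of m, OF 0[unfolded hat_ev(1)] hat_ev(3)] hat_ev(2)[OF that, of u] by simp
  then show "\<forall>i. u (i + MM) = u i"
    using all_half[OF assms, of "\<lambda>c. c = 0"] by auto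
next
  assume *: "\<forall>i. u (i + MM) = u i"
  show "hat NN 1 u = 0" unfolding hat_ev(1) using * by (simp add: ev_sum)
qed

lemma hat_range: "hat NN 1 u \<in> range (ev (zt m))"
  unfolding hat_ev(1) by blast

lemma hat_mult_4:
  assumes "periodic NN u" "periodic NN v" "hat NN 1 u * hat NN 1 v = 4 * ev (zt m) r"
  shows "(\<forall>i. even (u i - u (i + MM))) \<or> (\<forall>i. even (v i - v (i + MM)))"
proof -
  define P where "P u = (\<Sum>i<2 ^ m. monom (u (int i) - u (int i + MM)) i)" for u :: "int \<Rightarrow> int"
  note P = hat_ev[where u = u, folded P_def] hat_ev[where u = v, folded P_def]
  have "(\<forall>i. even (coeff (P u) i)) \<or> (\<forall>i. even (coeff (P v) i))"
    by (rule ev_zt_mult_4[of m _ _ r]) (use assms(3) P in auto)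
  then show ?thesis
  proof
    assume e: "\<forall>i. even (coeff (P u) i)"
    have "even (u i - u (i + MM))" for i
      by (rule all_half[OF assms(1), of even]) (use e P(2) in \<open>metis\<close>, simp)
    then show ?thesis by blast
  next
    assume e: "\<forall>i. even (coeff (P v) i)"
    have "even (v i - v (i + MM))" for i
      by (rule all_half[OF assms(2), of even]) (use e P(5) in \<open>metis\<close>, simp)
    then show ?thesis by blast
  qed
qed

end

section \<open>Counting lemmas\<close>

lemma even_card_involution:
  assumes "finite A" "\<And>a. a \<in> A \<Longrightarrow> f a \<in> A" "\<And>a. a \<in> A \<Longrightarrow> f (f a) = a" "\<And>a. a \<in> A \<Longrightarrow> f a \<noteq> a"
  shows "even (card A)"
  using assms
proof (induct "card A" arbitrary: A rule: less_induct)
  case less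
  show ?case
  proof (cases "A = {}")
    case False
    then obtain a where a: "a \<in> A" by blast
    let ?B = "A - {a, f a}"
    have fa: "f a \<in> A" "f a \<noteq> a" using less.prems a by auto
    have B: "f b \<in> ?B" if "b \<in> ?B" for b
    proof -
      have b: "b \<in> A" "b \<noteq> a" "b \<noteq> f a" using that by auto
      have "f (f b) = b" "f (f a) = a" using less.prems(3) b a by auto
      then have "f b \<noteq> a" "f b \<noteq> f a" using b by auto
      then show ?thesis using less.prems(2) b by auto
    qed
    have "card {a, f a} \<le> card A" using a fa less.prems(1) by (intro card_mono) auto
    then have c: "card A = card ?B + 2"
      using a fa less.prems(1) by (simp add: card_Diff_subset)
    have "even (card ?B)"
      using less.hyps[of ?B] c B less.prems by auto
    then show ?thesis using c by simp
  qed simp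
qed

text \<open>The summands at \<open>i\<close> and \<open>x - i\<close> are equal and cancel modulo 2.
  Only the fixed points of this involution remain, and there the summand is
  \<open>f i * f i = f i\<close>.\<close>

lemma S_square_parity:
  fixes f :: "int \<Rightarrow> int"
  assumes "N > 0" "periodic N f" "\<And>i. f i = 0 \<or> f i = 1"
  shows "even (S N (\<lambda>i. f i * f (x - i)) - S N (\<lambda>i. if N dvd 2 * i - x then f i else 0))"
proof -
  define A where "A = {i \<in> {0..<N}. f i = 1 \<and> f (x - i) = 1 \<and> \<not> N dvd 2 * i - x}"
  have *: "f i * f (x - i) - (if N dvd 2 * i - x then f i else 0) = (if i \<in> A then 1 else 0)"
    if "i \<in> {0..<N}" for i
  proof (cases "N dvd 2 * i - x")
    case True
    then have "f (x - i) = f i" using periodic_cong[OF assms(2), of i "x - i"] by (simp add: algebra_simps)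
    then show ?thesis using True assms(3)[of i] by (auto simp: A_def)
  next
    case False
    then show ?thesis using that assms(3)[of i] assms(3)[of "x - i"] by (auto simp: A_def)
  qed
  have 1: "S N (\<lambda>i. f i * f (x - i)) - S N (\<lambda>i. if N dvd 2 * i - x then f i else 0) =
      (\<Sum>i\<in>{0..<N}. if i \<in> A then 1 else 0)"
    unfolding S_def sum_subtractf[symmetric] by (rule sum.cong[OF refl *])
  have 2: "(\<Sum>i\<in>{0..<N}. if i \<in> A then 1 else (0::int)) = int (card A)"
    by (subst sum.inter_restrict[symmetric]) (auto simp: A_def intro!: arg_cong[where f = card])
  have "even (card A)"
  proof (rule even_card_involution)
    show "finite A" unfolding A_def by (rule finite_subset[of _ "{0..<N}"]) auto
    fix a assume a: "a \<in> A"
    have m: "(x - a) mod N \<in> {0..<N}" using assms(1) by simp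
    have 1: "f ((x - a) mod N) = f (x - a)" by (rule periodic_mod[OF assms(2)])
    have 2: "f (x - (x - a) mod N) = f a"
      by (rule periodic_cong[OF assms(2)]) (simp add: mod_eq_dvd_iff[symmetric] mod_simps)
    have 3: "N dvd 2 * ((x - a) mod N) - x \<longleftrightarrow> N dvd 2 * a - x"
    proof -
      have "2 * ((x - a) mod N) - x = - (2 * a - x) - 2 * (N * ((x - a) div N))"
        by (simp add: minus_mult_div_eq_mod[symmetric] algebra_simps)
      moreover have "N dvd 2 * (N * ((x - a) div N))" by simp
      ultimately show ?thesis by (metis dvd_diff_left_iff dvd_minus_iff)
    qed
    show "(x - a) mod N \<in> A" using a m 1 2 3 by (simp add: A_def)
    have "(x - (x - a) mod N) mod N = a mod N" by (simp add: mod_simps)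
    then show "(x - (x - a) mod N) mod N = a" using a by (simp add: A_def)
    show "(x - a) mod N \<noteq> a"
    proof
      assume "(x - a) mod N = a"
      then have "N dvd (x - a) - a" by (metis mod_mod_trivial mod_eq_dvd_iff)
      then have "N dvd 2 * a - x" by (metis dvd_minus_iff minus_diff_eq mult_2 diff_diff_eq)
      then show False using a by (simp add: A_def)
    qed
  qed
  then show ?thesis unfolding 1 2 by simp
qed

text \<open>Halving inside \<open>P\<close> can be iterated: after \<open>r\<close> rounds
  \<open>x\<close> is \<open>2 ^ r\<close> times an element of \<open>P\<close>, modulo
  \<open>2 ^ r\<close>.\<close>

lemma doubling_descent:
  assumes "\<And>x. P x \<Longrightarrow> \<exists>y. P y \<and> (2::int) ^ r dvd 2 * y - x" "P x"
  shows "(2::int) ^ r dvd x"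
proof -
  have "\<exists>y. P y \<and> 2 ^ r dvd 2 ^ k * y - x" for k
  proof (induct k)
    case 0
    then show ?case using assms(2) by (intro exI[of _ x]) simp
  next
    case (Suc k)
    then obtain y where y: "P y" "2 ^ r dvd 2 ^ k * y - x" by blast
    obtain y' where y': "P y'" "2 ^ r dvd 2 * y' - y" using assms(1)[OF y(1)] by blast
    have "2 ^ Suc k * y' - x = 2 ^ k * (2 * y' - y) + (2 ^ k * y - x)" by (simp add: algebra_simps)
    then have "2 ^ r dvd 2 ^ Suc k * y' - x" using y(2) y'(2) by (simp only: dvd_add dvd_mult)
    then show ?case using y'(1) by blast
  qed
  then obtain y where "2 ^ r dvd 2 ^ r * y - x" by blast
  then show ?thesis by (metis dvd_diff_right_iff dvd_triv_left)
qed

lemma S_double: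
  assumes "g > 0"
  shows "S (2 * g) u = S g (\<lambda>i. u i + u (i + g))"
proof -
  have "{0..<2::int} = {0, 1}" by auto
  then have "S 2 v = v 0 + v 1" for v :: "int \<Rightarrow> 'a" by (simp add: S_def)
  then show ?thesis using S_divide[OF assms, of 2 u] by (simp add: mult.commute)
qed

text \<open>Modulo 2 the square shows that the set contains the involution \<open>g\<close> of the
  cyclic group and is otherwise invariant under it. Modulo 4 the rest \<open>v\<close>, read modulo
  \<open>g\<close>, satisfies \<open>v * v = v\<close> modulo 2. Hence each of its elements is twice
  another one, and doubling descent pushes it to 0, which is excluded.\<close>

lemma square_mod_4:
  fixes u :: "int \<Rightarrow> int"
  assumes "periodic (2 ^ k) u" "\<And>i. u i = 0 \<or> u i = 1" "u 0 = 0"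
    and sq: "\<And>x. 4 dvd S (2 ^ k) (\<lambda>i. u i * u (x - i)) - (if 2 ^ k dvd x then 1 else 0)"
    and "u x = 1"
  shows "2 ^ k dvd 2 * x"
proof (cases k)
  case 0
  then show ?thesis by simp
next
  case (Suc k')
  define g :: int where "g = 2 ^ k'"
  define h :: int where "h = 2 ^ k"
  have h: "h = 2 * g" "h > 0" "g > 0" by (simp_all add: h_def g_def Suc)
  note per = assms(1)[folded h_def]
  note sq = sq[folded h_def]
  have fixpts: "S h (\<lambda>i. if h dvd 2 * i - 2 * j then u i else 0) = u j + u (j + g)" for j
  proof -
    define q where "q i = (if g dvd i - j then u i else 0)" for i
    have ha: "h dvd 2 * i - 2 * j \<longleftrightarrow> g dvd i - j" for i
    proof -
      have "2 * i - 2 * j = 2 * (i - j)" by simp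
      then show ?thesis unfolding h(1) by (simp only: dvd_mult_cancel_left) simp
    qed
    have "S h (\<lambda>i. if h dvd 2 * i - 2 * j then u i else 0) = S g (\<lambda>i. (if g dvd i - j then 1 else 0) * (u i + u (i + g)))"
      unfolding h(1) S_double[OF h(3)] unfolding h(1)[symmetric] ha
    proof (rule S_cong)
      fix i
      have "i + g - j = (i - j) + g" by simp
      then have "g dvd i + g - j \<longleftrightarrow> g dvd i - j" by (simp only: dvd_add_triv_right_iff)
      then show "(if g dvd i - j then u i else 0) + (if g dvd i + g - j then u (i + g) else 0) =
          (if g dvd i - j then 1 else 0) * (u i + u (i + g))" by simp
    qed
    also have "\<dots> = u j + u (j + g)"
    proof (rule S_delta[OF h(3)])
      show "periodic g (\<lambda>i. u i + u (i + g))"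
        using per by (simp add: periodic_def h(1) add.assoc mult_2[symmetric] add.commute)
    qed
    finally show ?thesis .
  qed
  have par: "even (S h (\<lambda>i. u i * u (2 * j - i)) - (u j + u (j + g)))" for j
    using S_square_parity[OF h(2) per assms(2), of "2 * j"] fixpts[of j] by simp
  have "4 dvd S h (\<lambda>i. u i * u (2 * 0 - i)) - 1" using sq[of 0] by simp
  then have "even (S h (\<lambda>i. u i * u (2 * 0 - i)) - 1)" by (rule dvd_trans[rotated]) simp
  then have "odd (u g)"
    using par[of 0] assms(3) by simp
  then have ug: "u g = 1" using assms(2)[of g] by auto
  have swap: "u (j + g) = u j" if "\<not> g dvd j" for j
  proof -
    have "\<not> h dvd 2 * j" using that by (simp add: h(1))
    then have "4 dvd S h (\<lambda>i. u i * u (2 * j - i))" using sq[of "2 * j"] by simp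
    then have "even (S h (\<lambda>i. u i * u (2 * j - i)))" by (rule dvd_trans[rotated]) simp
    then have "even (u j + u (j + g))" using par[of j] by simp
    then show ?thesis using assms(2)[of j] assms(2)[of "j + g"] by auto
  qed
  define v where "v i = u i - (if h dvd i - g then 1 else 0)" for i
  have per_v: "periodic g v"
    unfolding periodic_def
  proof
    fix i
    show "v (i + g) = v i"
    proof (cases "g dvd i")
      case True
      then obtain a where a: "i = g * a" by blast
      have u0: "u (h * b) = 0" "u (g + h * b) = 1" for b
        using periodic_mult[OF per, of 0 b] periodic_mult[OF per, of g b] assms(3) ug by (simp_all add: mult.commute)
      have v0: "v (g * c) = 0" for c
      proof (cases "even c")
        case True
        then obtain b where c: "c = 2 * b" by blast
        have "\<not> h dvd g * c - g"
        proof
          assume "h dvd g * c - g"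
          then have "g * 2 dvd g * (c - 1)" by (simp add: h(1) algebra_simps)
          then have "2 dvd c - 1" using h(3) by simp
          then show False using True by simp
        qed
        then show ?thesis using u0(1)[of b] c by (simp add: v_def h(1) mult_ac)
      next
        case False
        then obtain b where c: "c = 2 * b + 1" by (elim oddE)
        then have "g * c = g + h * b" by (simp add: h(1) algebra_simps)
        then show ?thesis using u0(2)[of b] by (simp add: v_def)
      qed
      show ?thesis using v0[of "a + 1"] v0[of a] by (simp add: a ring_distribs)
    next
      case False
      have "g dvd h" by (simp add: h(1))
      have "\<not> g dvd i - g" using False dvd_diff_left_iff[of g g i] by simp
      then have "\<not> h dvd i - g" "\<not> h dvd i + g - g"
        using False dvd_trans[OF \<open>g dvd h\<close>] by auto
      then show ?thesis using swap[OF False] by (simp add: v_def)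
    qed
  qed
  have v01: "v i = 0 \<or> v i = 1" for i
  proof (cases "h dvd i - g")
    case True
    then have "u i = u g" by (rule periodic_cong[OF per])
    then show ?thesis using True ug by (simp add: v_def)
  qed (use assms(2)[of i] in \<open>auto simp: v_def\<close>)
  have v0: "v 0 = 0"
  proof -
    have "\<not> h dvd g" using h zdvd_imp_le[of h g] by auto
    then show ?thesis by (simp add: v_def assms(3))
  qed
  have u_v: "u i = v i + (if h dvd i - g then 1 else 0)" for i by (simp add: v_def)
  have per_hv: "periodic h v" using periodic_mult[OF per_v, of _ 2] by (simp add: periodic_def h(1))
  \<comment> \<open>Expansion of the square of \<open>v\<close> plus the point \<open>g\<close>: the
    point squares to the identity, the mixed terms give \<open>2 * v\<close>, and the invariance of
    \<open>v\<close> under \<open>g\<close> doubles the sum over a half period.\<close>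
  have conv: "S h (\<lambda>i. u i * u (x - i)) = 2 * S g (\<lambda>i. v i * v (x - i)) + 2 * v x + (if h dvd x then 1 else 0)" for x
  proof -
    let ?d = "\<lambda>i. if h dvd i - g then 1 else (0::int)"
    have "S h (\<lambda>i. u i * u (x - i)) = S h (\<lambda>i. v i * v (x - i)) + S h (\<lambda>i. ?d i * u (x - i)) + S h (\<lambda>i. v i * ?d (x - i))"
      unfolding S_add[symmetric] by (rule S_cong) (simp add: u_v algebra_simps)
    also have "S h (\<lambda>i. ?d i * u (x - i)) = u (x - g)"
      by (rule S_delta[OF h(2)]) (rule per_shift(4)[OF per])
    also have "S h (\<lambda>i. v i * ?d (x - i)) = v (x - g)"
    proof -
      have "S h (\<lambda>i. v i * ?d (x - i)) = S h (\<lambda>i. (if h dvd i - (x - g) then 1 else 0) * v i)"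
      proof (rule S_cong)
        fix i
        have "x - i - g = - (i - (x - g))" by simp
        then have "h dvd x - i - g \<longleftrightarrow> h dvd i - (x - g)" by (simp only: dvd_minus_iff)
        then show "v i * ?d (x - i) = (if h dvd i - (x - g) then 1 else 0) * v i" by simp
      qed
      then show ?thesis using S_delta[OF h(2) per_hv] by simp
    qed
    also have "S h (\<lambda>i. v i * v (x - i)) = 2 * S g (\<lambda>i. v i * v (x - i))"
    proof -
      have "v (i + g) * v (x - (i + g)) = v i * v (x - i)" for i
        using per_v periodic_mult[OF per_v, of "x - i" "-1"] by (simp add: periodic_def diff_diff_eq)
      then have "S h (\<lambda>i. v i * v (x - i)) = S g (\<lambda>i. 2 * (v i * v (x - i)))"
        unfolding h(1) S_double[OF h(3)] by (intro S_cong) simp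
      then show ?thesis by (simp add: S_cmult)
    qed
    also have "v (x - g) = v x" using periodic_mult[OF per_v, of x "-1"] by simp
    also have "u (x - g) = v x + (if h dvd x then 1 else 0)"
    proof -
      have "h dvd (x - g) - g \<longleftrightarrow> h dvd x"
      proof -
        have "(x - g) - g = x - h" by (simp add: h(1))
        then show ?thesis by (simp only: dvd_diff_left_iff dvd_refl)
      qed
      then show ?thesis using u_v[of "x - g"] periodic_mult[OF per_v, of x "-1"] by simp
    qed
    finally show ?thesis by simp
  qed
  have key: "\<exists>y. v y = 1 \<and> 2 ^ k' dvd 2 * y - x" if x: "v x = 1" for x
  proof -
    have "4 dvd 2 * S g (\<lambda>i. v i * v (x - i)) + 2 * v x" using sq[of x] conv[of x] by simp
    then have "odd (S g (\<lambda>i. v i * v (x - i)))" using x by presburger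
    then have "odd (S g (\<lambda>i. if g dvd 2 * i - x then v i else 0))"
      using S_square_parity[OF h(3) per_v v01, of x] by simp
    then have "\<not> (\<forall>i. even (if g dvd 2 * i - x then v i else 0))"
      using even_S[of "\<lambda>i. if g dvd 2 * i - x then v i else 0" g] by blast
    then obtain i where i: "odd (if g dvd 2 * i - x then v i else 0)" by blast
    then have "g dvd 2 * i - x" "odd (v i)" by (auto split: if_splits)
    then show ?thesis using v01[of i] by (intro exI[of _ i]) (auto simp: g_def)
  qed
  have no: "v x \<noteq> 1" for x
  proof
    assume "v x = 1"
    then have "g dvd x" using doubling_descent[of "\<lambda>x. v x = 1" k' x] key by (simp add: g_def)
    then have "v x = v 0" using periodic_cong[OF per_v, of x 0] by simp
    then show False using \<open>v x = 1\<close> v0 by simp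
  qed
  have "h dvd x - g" using no[of x] v01[of x] assms(5) by (auto simp: v_def split: if_splits)
  then have "h dvd 2 * (x - g) + h" by (intro dvd_add dvd_mult dvd_refl)
  also have "2 * (x - g) + h = 2 * x" by (simp add: h(1))
  finally show ?thesis by (simp add: h_def)
qed

text \<open>The parameter equation of a difference set in a 2-group, when the order is an odd square.\<close>

lemma odd_order_trivial:
  fixes k t :: int
  assumes eq: "k * (2 ^ s - k) = t ^ 2 * (2 ^ s - 1)" and "odd t" "0 < k" "k < 2 ^ s"
  shows "k = 1 \<or> k = 2 ^ s - 1"
proof -
  have one: "k = 1 \<or> k = 2 ^ s - 1" if "t ^ 2 = 1"
  proof -
    have "(k - 1) * (k - (2 ^ s - 1)) = 0" using eq that by (simp add: algebra_simps)
    then show ?thesis by simp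
  qed
  consider "s = 0" | "s = 1" | r where "s = r + 2"
    by (metis One_nat_def add_2_eq_Suc' not0_implies_Suc)
  then show ?thesis
  proof cases
    case (3 r)
    define g :: int where "g = 2 ^ r"
    have g: "g > 0" "2 ^ s = 4 * g" by (simp_all add: g_def 3 power_add)
    define T where "T = \<bar>t\<bar>"
    \<comment> \<open>Completing the square in \<open>k\<close>; with \<open>2 ^ s = 4 * g\<close>
      the equation becomes a factorization of the difference of the squares of \<open>Y\<close> and
      \<open>T\<close>.\<close>
    define Y where "Y = \<bar>2 * g - k\<bar>"
    have T: "T ^ 2 = t ^ 2" "T > 0" "odd T" using assms(2) by (auto simp: T_def)
    have YT: "Y ^ 2 - T ^ 2 = 4 * g * (g - T ^ 2)"
      using eq unfolding T(1) g(2) Y_def power2_abs by (simp add: power2_eq_square algebra_simps)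
    have Y2: "Y < 2 * g" "Y \<ge> 0" using assms(3,4) g by (auto simp: Y_def)
    have "even (Y ^ 2 - T ^ 2)" unfolding YT by simp
    then have "odd Y" using T(3) by simp
    obtain a where a: "Y = T + 2 * a" using \<open>odd Y\<close> T(3) by (metis dvd_def even_diff add_diff_cancel_left' diff_add_cancel odd_even_add add.commute even_add diff_diff_eq2 add_diff_eq)
    define b where "b = a + T"
    have "4 * (a * b) = 4 * (g * (g - T ^ 2))"
      using YT by (simp add: a b_def power2_eq_square algebra_simps)
    then have ab: "a * b = g * (g - T ^ 2)" by simp
    have "Y ^ 2 \<ge> 0" by simp
    have "T ^ 2 * (4 * g - 1) = 4 * g ^ 2 - Y ^ 2"
      using YT by (simp add: power2_eq_square algebra_simps)
    with \<open>Y ^ 2 \<ge> 0\<close> have "T ^ 2 * (4 * g - 1) \<le> 4 * g ^ 2" by simp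
    have T2g: "T < 2 * g"
    proof (rule ccontr)
      assume "\<not> T < 2 * g"
      then have "2 * g \<le> T" by simp
      then have "(2 * g) ^ 2 \<le> T ^ 2" using g(1) by (intro power_mono) auto
      then have "(2 * g) ^ 2 * (4 * g - 1) \<le> T ^ 2 * (4 * g - 1)" using g(1) by (intro mult_right_mono) auto
      also have "\<dots> \<le> 4 * g ^ 2" by fact
      finally have "4 * g ^ 2 * (4 * g - 1) \<le> 4 * g ^ 2 * 1" by (simp add: power_mult_distrib)
      then have "4 * g - 1 \<le> 1" using g(1) by (simp add: mult_le_cancel_left_pos)
      then show False using g(1) by simp
    qed
    have "g dvd a * b" using ab by simp
    \<comment> \<open>\<open>b - a = T\<close> is odd, so one of the two factors is prime to the
      power of two \<open>g\<close>, and the other one absorbs it. The size bounds then leave a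
      single multiple of \<open>g\<close>.\<close>
    have "odd a \<or> odd b" using \<open>odd T\<close> by (auto simp: b_def)
    then have "coprime g a \<or> coprime g b" by (auto simp: g_def)
    then have "g dvd a \<or> g dvd b"
      using \<open>g dvd a * b\<close> coprime_dvd_mult_left_iff[of g b a] coprime_dvd_mult_right_iff[of g a b]
      by auto
    then show ?thesis
    proof
      assume ga: "g dvd a"
      have "\<bar>a\<bar> < g" using a Y2 T2g T(2) by linarith
      then have "a = 0" using ga zdvd_not_zless[of "\<bar>a\<bar>" g] by (cases "a = 0") auto
      then have "g = T ^ 2" using ab g(1) by simp
      then have "odd g" using T(3) by simp
      then have "r = 0" by (simp add: g_def)
      then have "T ^ 2 = 1" using \<open>g = T ^ 2\<close> by (simp add: g_def)
      then show ?thesis using one T(1) by simp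
    next
      assume gb: "g dvd b"
      have "0 < b" "b < 2 * g" using a Y2 T2g T(2) by (auto simp: b_def)
      then have "b = g" using gb by (auto elim!: dvdE simp: zero_less_mult_iff)
      then have "a = g - T ^ 2" using ab g(1) by (simp add: mult.commute)
      then have "T = T ^ 2" using \<open>b = g\<close> by (simp add: b_def)
      then have "T = 1" using T(2) by (simp add: power2_eq_square)
      then show ?thesis using one T(1) by simp
    qed
  qed (use assms in auto)
qed

text \<open>Fraction-free elimination: multiplying by the pivot entry replaces division. It will
  supply an integer polynomial annihilating an element of the S-ring.\<close>

lemma int_dependency:
  fixes v :: "'i \<Rightarrow> 's \<Rightarrow> int"
  assumes "finite A" "finite I" "card A < card I"
  shows "\<exists>c. (\<exists>i\<in>I. c i \<noteq> 0) \<and> (\<forall>x\<in>A. (\<Sum>i\<in>I. c i * v i x) = 0)"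
  using assms
proof (induct A arbitrary: I v rule: finite_induct)
  case empty
  then obtain i where "i \<in> I" by fastforce
  then show ?case by (intro exI[of _ "\<lambda>_. 1"]) auto
next
  case (insert x A)
  show ?case
  proof (cases "\<forall>i\<in>I. v i x = 0")
    case True
    then show ?thesis using insert.hyps(3)[of I v] insert.prems insert.hyps by auto
  next
    case False
    then obtain j where j: "j \<in> I" "v j x \<noteq> 0" by blast
    define J where "J = I - {j}"
    have "card A < card J" "finite J" using insert.prems insert.hyps j by (auto simp: J_def)
    from insert.hyps(3)[OF this(2,1), of "\<lambda>i y. v j x * v i y - v i x * v j y"]
    obtain c where c: "\<exists>i\<in>J. c i \<noteq> 0" "\<forall>y\<in>A. (\<Sum>i\<in>J. c i * (v j x * v i y - v i x * v j y)) = 0"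
      by (elim exE conjE)
    define d where "d i = (if i = j then - (\<Sum>i\<in>J. c i * v i x) else v j x * c i)" for i
    have sum: "(\<Sum>i\<in>I. d i * v i y) = (\<Sum>i\<in>J. c i * (v j x * v i y - v i x * v j y))" for y
    proof -
      have "(\<Sum>i\<in>I. d i * v i y) = d j * v j y + (\<Sum>i\<in>J. d i * v i y)"
        using j insert.prems unfolding J_def by (intro sum.remove) auto
      also have "(\<Sum>i\<in>J. d i * v i y) = (\<Sum>i\<in>J. v j x * c i * v i y)"
        by (rule sum.cong) (auto simp: J_def d_def)
      finally have "(\<Sum>i\<in>I. d i * v i y) = (\<Sum>i\<in>J. v j x * c i * v i y) - (\<Sum>i\<in>J. c i * v i x) * v j y"
        by (simp add: d_def)
      also have "\<dots> = (\<Sum>i\<in>J. c i * (v j x * v i y - v i x * v j y))"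
        unfolding sum_distrib_right sum_subtractf[symmetric] by (rule sum.cong[OF refl]) (simp add: algebra_simps)
      finally show ?thesis .
    qed
    have "\<exists>i\<in>I. d i \<noteq> 0" using c(1) j by (auto simp: d_def J_def)
    moreover have "(\<Sum>i\<in>I. d i * v i y) = 0" if "y \<in> insert x A" for y
      using that c(2) unfolding sum by (auto simp: algebra_simps)
    ultimately show ?thesis by blast
  qed
qed

lemma int_subgroup_two_power:
  fixes P :: "int \<Rightarrow> bool"
  assumes "\<And>i j. P i \<Longrightarrow> P j \<Longrightarrow> P (i - j)" "P (2 ^ n)"
  obtains r where "r \<le> n" "\<And>i. P i \<longleftrightarrow> 2 ^ r dvd i"
proof -
  have P0: "P 0" using assms(1)[OF assms(2) assms(2)] by simp
  have Pneg: "P i \<Longrightarrow> P (- i)" for i using assms(1)[OF P0, of i] by simp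
  have Padd: "P i \<Longrightarrow> P j \<Longrightarrow> P (i + j)" for i j using assms(1)[OF _ Pneg[of j], of i] by simp
  define h where "h = (LEAST k::nat. k > 0 \<and> P (int k))"
  have "\<exists>k::nat. k > 0 \<and> P (int k)" using assms(2) by (intro exI[of _ "2 ^ n"]) simp
  then have h: "h > 0" "P (int h)" unfolding h_def by (metis (mono_tags, lifting) LeastI)+
  have Pm: "P (int h * q)" for q
  proof -
    have *: "P (int h * int k)" for k
    proof (induct k)
      case (Suc k)
      then have "P (int h + int h * int k)" by (rule Padd[OF h(2)])
      then show ?case by (simp add: ring_distribs)
    qed (simp add: P0)
    show ?thesis
      using *[of "nat q"] Pneg[OF *[of "nat (- q)"]] by (cases "q \<ge> 0") auto
  qed
  have iff: "P i \<longleftrightarrow> int h dvd i" for i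
  proof
    assume "P i"
    then have "P (i - int h * (i div int h))" using Pm assms(1) by blast
    then have Pmod: "P (i mod int h)" by (simp add: minus_mult_div_eq_mod)
    have "i mod int h = 0"
    proof (rule ccontr)
      assume "i mod int h \<noteq> 0"
      moreover have "0 \<le> i mod int h" "i mod int h < int h" using h(1) by simp_all
      ultimately have "0 < nat (i mod int h)" "P (int (nat (i mod int h)))" "nat (i mod int h) < h"
        using Pmod by (auto simp: nat_less_iff)
      then show False using not_less_Least[of "nat (i mod int h)" "\<lambda>k. k > 0 \<and> P (int k)"] by (simp add: h_def)
    qed
    then show "int h dvd i" by presburger
  next
    assume "int h dvd i"
    then show "P i" using Pm by auto
  qed
  have "int h dvd 2 ^ n" using iff assms(2) by blast
  then have "h dvd 2 ^ n" by (metis of_nat_dvd_iff of_nat_numeral of_nat_power)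
  then obtain r where "r \<le> n" "h = 2 ^ r" by (auto simp: divides_primepow_nat)
  then show ?thesis using that[of r] iff by simp
qed

section \<open>Partitions closed under convolution\<close>

definition ind :: "('a \<Rightarrow> bool) \<Rightarrow> 'a \<Rightarrow> int" where
  "ind P x = (if P x then 1 else 0)"

lemma ind_simps [simp]: "P x \<Longrightarrow> ind P x = 1" "\<not> P x \<Longrightarrow> ind P x = 0" "ind P x * ind P x = ind P x"
  "0 \<le> ind P x" "ind P x = 1 \<longleftrightarrow> P x" "ind P x = 0 \<longleftrightarrow> \<not> P x"
  by (auto simp: ind_def)

lemma conv_add: "conv N f (\<lambda>x. g x + h x) x = conv N f g x + conv N f h x"
  by (simp add: conv_def tot_add[symmetric] ring_distribs)

lemma conv_cmult: "conv N f (\<lambda>x. c * g x) x = c * conv N f g x"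
  unfolding conv_def tot_cmult[symmetric] by (rule tot_cong) simp

text \<open>The same predicate as \<open>per\<close>, named separately because translation by half
  the period is multiplication by the central involution.\<close>

definition zinv :: "int \<Rightarrow> (pt \<Rightarrow> 'c) \<Rightarrow> bool" where
  "zinv M f \<longleftrightarrow> (\<forall>p. periodic M (\<lambda>i. f (p, i)))"

lemma zinv_iff: "zinv M f \<longleftrightarrow> (\<forall>p i. f (p, i + M) = f (p, i))"
  by (simp add: zinv_def periodic_def)

lemma zinv_eq_per: "zinv = per"
  by (simp add: zinv_def per_def fun_eq_iff)

lemma zinv_conv: "zinv M g \<Longrightarrow> zinv M (conv N f g)"
proof -
  assume g: "zinv M g"
  have "conv N f g (p, i + M) = conv N f g (p, i)" for p i
  proof -
    have "g (pm (pinv y) (p, i + M)) = g (pm (pinv y) (p, i))" for y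
      using perD[OF per_pm(2)[OF g[unfolded zinv_eq_per], of "pinv y"], of p] by (simp add: periodic_def)
    then show ?thesis by (simp add: conv_def)
  qed
  then show ?thesis by (simp add: zinv_iff)
qed

text \<open>\<open>E\<close> is the relation of lying in the same basic set, pulled back to the points, and \<open>Fun\<close>
  below is the S-ring; \<open>c\<^sup>M\<close> is the central involution.\<close>

locale coordinate_sring =
  fixes m :: nat and N M :: int and E :: "pt \<Rightarrow> pt \<Rightarrow> bool"
  assumes N_def: "N = 2 ^ Suc m" and M_def: "M = 2 ^ m"
    and E_refl: "E x x" and E_sym: "E x y \<Longrightarrow> E y x" and E_trans: "E x y \<Longrightarrow> E y z \<Longrightarrow> E x z"
    and E_per: "E (p, i) (p, i + N)"
    and E_one: "E (False, 0) (p, i) \<longleftrightarrow> \<not> p \<and> N dvd i"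
    and E_inv: "E x y \<Longrightarrow> E (pinv x) (pinv y)"
    and E_conv: "(\<And>x y. E x y \<Longrightarrow> f x = f y) \<Longrightarrow> (\<And>x y. E x y \<Longrightarrow> g x = g y) \<Longrightarrow> E x y \<Longrightarrow>
      conv N f g x = conv N f g y"
begin

lemma N_M: "N = 2 * M" and M_pos: "M > 0" and N_pos: "N > 0" and MN: "M dvd N"
  by (simp_all add: N_def M_def)

lemma N_dvd: "N dvd i \<Longrightarrow> M dvd i" "N dvd i + M \<Longrightarrow> M dvd i"
  using dvd_trans[OF MN, of i] dvd_trans[OF MN, of "i + M"] by simp_all

definition Fun :: "(pt \<Rightarrow> int) set" where
  "Fun = {f. \<forall>x y. E x y \<longrightarrow> f x = f y}"

definition one :: "pt \<Rightarrow> int" where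
  "one = ind (\<lambda>x. \<not> fst x \<and> N dvd snd x)"

lemma FunI: "(\<And>x y. E x y \<Longrightarrow> f x = f y) \<Longrightarrow> f \<in> Fun"
  unfolding Fun_def by blast

lemma FunD: "f \<in> Fun \<Longrightarrow> E x y \<Longrightarrow> f x = f y"
  unfolding Fun_def by blast

lemma Fun_per: "f \<in> Fun \<Longrightarrow> per N f"
  unfolding per_def periodic_def using FunD E_per E_sym by metis

lemma Fun_add: "f \<in> Fun \<Longrightarrow> g \<in> Fun \<Longrightarrow> (\<lambda>x. f x + g x) \<in> Fun"
  by (rule FunI) (metis FunD)

lemma Fun_diff: "f \<in> Fun \<Longrightarrow> g \<in> Fun \<Longrightarrow> (\<lambda>x. f x - g x) \<in> Fun"
  by (rule FunI) (metis FunD)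

lemma Fun_cmult: "f \<in> Fun \<Longrightarrow> (\<lambda>x. c * f x) \<in> Fun"
  by (rule FunI) (metis FunD)

lemma Fun_0: "(\<lambda>x. 0) \<in> Fun"
  by (rule FunI) simp

lemma Fun_conv: "f \<in> Fun \<Longrightarrow> g \<in> Fun \<Longrightarrow> conv N f g \<in> Fun"
  by (rule FunI, rule E_conv) (auto dest: FunD)

lemma E_one': "E x y \<Longrightarrow> \<not> fst x \<and> N dvd snd x \<Longrightarrow> \<not> fst y \<and> N dvd snd y"
  by (metis (full_types) E_one E_sym E_trans prod.exhaust_sel)

lemma ind_Fun: "(\<And>x y. E x y \<Longrightarrow> P x \<Longrightarrow> P y) \<Longrightarrow> ind P \<in> Fun"
  by (rule FunI) (metis E_sym ind_def)

lemma one_Fun: "one \<in> Fun"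
  unfolding one_def using E_one' by (rule ind_Fun)

lemma class_Fun: "ind (E x) \<in> Fun"
  using E_trans by (rule ind_Fun)

abbreviation "Al f \<equiv> al N 1 f"
abbreviation "Be f \<equiv> be N 1 f"

lemma one_simps: "one (True, i) = 0" "one (False, i) = (if N dvd i then 1 else 0)"
  by (auto simp: one_def)

lemma al_one: "al N k one = 1" and be_one: "be N k one = 0"
proof -
  show "be N k one = 0" by (simp add: be_def hat_def one_simps S_def)
  have "al N k one = S N (\<lambda>i. (if N dvd i - 0 then 1 else 0) * w N k i)"
    unfolding al_def hat_def one_simps by (rule S_cong) simp
  also have "\<dots> = 1" using S_delta[OF N_pos w_N[OF N_pos], of 0] by simp
  finally show "al N k one = 1" .
qed

lemma Al_Be_zero:
  assumes "per N f"
  shows "Al f = 0 \<longleftrightarrow> (\<forall>i. f (False, i + M) = f (False, i))"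
    and "Be f = 0 \<longleftrightarrow> (\<forall>i. f (True, i + M) = f (True, i))"
  using hat_zero_iff[of m "\<lambda>i. f (False, i)", folded N_def M_def] perD[OF assms, of False]
    hat_zero_iff[of m "\<lambda>i. f (True, i)", folded N_def M_def] perD[OF assms, of True]
  by (simp_all add: al_def be_def)

lemma zinv_Al_Be: "per N f \<Longrightarrow> zinv M f \<longleftrightarrow> Al f = 0 \<and> Be f = 0"
  by (auto simp: Al_Be_zero zinv_iff all_bool_eq)

text \<open>Subtracting \<open>k\<close> times the identity makes the diagonal entry 0, so an
  integral entry can only come from an imbalance between 1 and the central involution.\<close>

lemma Al_int:
  assumes "per N f" "Al f = of_int k"
  shows "f (False, 0) - f (False, M) = k" and "\<not> M dvd i \<Longrightarrow> f (False, i + M) = f (False, i)"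
proof -
  let ?g = "\<lambda>x. f x - k * one x"
  have "Al ?g = 0" using assms(2) by (simp add: al_linear al_one)
  moreover have "per N ?g" using assms(1) Fun_per[OF one_Fun] by (simp add: per_def periodic_def)
  ultimately have g: "?g (False, i + M) = ?g (False, i)" for i by (simp add: Al_Be_zero)
  have "\<not> N dvd M" using N_M M_pos zdvd_imp_le[of N M] by auto
  then show "f (False, 0) - f (False, M) = k" using g[of 0] by (simp add: one_simps)
  assume "\<not> M dvd i"
  then have "\<not> N dvd i" "\<not> N dvd i + M"
    using N_dvd by blast+
  then show "f (False, i + M) = f (False, i)" using g[of i] by (simp add: one_simps)
qed

lemma Al_off:
  assumes "per N f" "\<And>i. \<not> M dvd i \<Longrightarrow> f (False, i + M) = f (False, i)"
  shows "Al f = of_int (f (False, 0) - f (False, M))"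
proof -
  let ?g = "\<lambda>x. f x - (f (False, 0) - f (False, M)) * one x"
  have perf: "periodic N (\<lambda>i. f (False, i))" using assms(1) by (rule perD)
  have g: "?g (False, i + M) = ?g (False, i)" for i
  proof (cases "M dvd i")
    case True
    then obtain a where a: "i = M * a" by blast
    have d: "N dvd M * b \<longleftrightarrow> even b" for b using M_pos by (simp add: N_M)
    have f: "f (False, M * b) = (if even b then f (False, 0) else f (False, M))" for b
    proof (cases "even b")
      case True
      then have "N dvd M * b - 0" by (simp add: d)
      from periodic_cong[OF perf this] show ?thesis using True by simp
    next
      case False
      then have "N dvd M * b - M" using d[of "b - 1"] by (simp add: right_diff_distrib)
      from periodic_cong[OF perf this] show ?thesis using False by simp
    qed
    have "i + M = M * (a + 1)" by (simp add: a ring_distribs)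
    moreover have "?g (False, M * (a + 1)) = ?g (False, M * a)"
      unfolding one_simps f d by simp
    ultimately show ?thesis by (simp only: a)
  next
    case False
    then have "\<not> N dvd i" "\<not> N dvd i + M"
      using N_dvd by blast+
    then show ?thesis using assms(2)[OF False] by (simp add: one_simps)
  qed
  have "per N ?g" using assms(1) Fun_per[OF one_Fun] by (simp add: per_def periodic_def)
  then have "Al ?g = 0" using g by (simp add: Al_Be_zero)
  then show ?thesis by (simp add: al_linear al_one)
qed

lemma even_S_periodic:
  fixes u :: "int \<Rightarrow> int"
  assumes "periodic M u"
  shows "even (S N u)"
proof -
  have "S N u = S M (\<lambda>i. 2 * u i)"
    unfolding N_M S_double[OF M_pos] by (rule S_cong) (use assms in \<open>simp add: periodic_def\<close>)
  then show ?thesis by (simp add: S_cmult)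
qed

end

locale symmetric_sring = coordinate_sring +
  assumes E_pinv: "E x (pinv x)"
begin

lemma Fun_pinv: "f \<in> Fun \<Longrightarrow> f (pinv x) = f x"
  using FunD E_pinv by metis

lemma conv_comm: "f \<in> Fun \<Longrightarrow> g \<in> Fun \<Longrightarrow> conv N f g = conv N g f"
proof
  fix x assume f: "f \<in> Fun" and g: "g \<in> Fun"
  have "conv N f g (pinv x) = conv N g f x"
    by (rule conv_pinv[OF N_pos Fun_per[OF f] Fun_per[OF g]]) (simp_all add: Fun_pinv f g)
  then show "conv N f g x = conv N g f x"
    using Fun_pinv[OF Fun_conv[OF f g], of x] by simp
qed

lemma cnj_al: "f \<in> Fun \<Longrightarrow> cnj (al N k f) = al N k f"
  by (rule al_real[OF N_pos Fun_per]) (simp_all add: Fun_pinv)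

lemma Al_conv: "f \<in> Fun \<Longrightarrow> g \<in> Fun \<Longrightarrow> al N k (conv N f g) = al N k f * al N k g + be N k f * cnj (be N k g)"
  by (simp add: al_conv[OF N_pos Fun_per Fun_per])

lemma Be_conv: "f \<in> Fun \<Longrightarrow> g \<in> Fun \<Longrightarrow> be N k (conv N f g) = al N k f * be N k g + be N k f * al N k g"
  by (simp add: be_conv[OF N_pos Fun_per Fun_per] cnj_al)

lemma Be_comm:
  assumes "f \<in> Fun" "g \<in> Fun"
  shows "be N k f * cnj (be N k g) = be N k g * cnj (be N k f)"
  using Al_conv[OF assms, of k] Al_conv[OF assms(2,1), of k] conv_comm[OF assms] by (simp add: mult.commute)

text \<open>The conjugate of \<open>Be f\<close> is the transform of the reflection values in
  reverse order, so \<open>hat_mult_4\<close> applies; both of its alternatives say the same about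
  \<open>f\<close>.\<close>

lemma Be_no_4:
  assumes "f \<in> Fun" "Be f * cnj (Be f) = 4 * of_int c"
  shows "even (f (True, i) - f (True, i + M))"
proof -
  have per: "periodic N (\<lambda>i. f (True, i))" using assms(1) by (intro perD Fun_per)
  have "hat N 1 (\<lambda>i. f (True, i)) * hat N 1 (\<lambda>i. f (True, - i)) = 4 * ev (zt m) [:c:]"
    using assms(2) hat_neg[OF N_pos per, of 1] by (simp add: be_def)
  from hat_mult_4[of m, folded N_def M_def, OF per per_neg[OF per] this]
  have "(\<forall>i. even (f (True, i) - f (True, i + M))) \<or> (\<forall>i. even (f (True, - i) - f (True, - (i + M))))" .
  then show ?thesis
  proof
    assume *: "\<forall>i. even (f (True, - i) - f (True, - (i + M)))"
    show ?thesis using *[rule_format, of "- i - M"] by (simp add: algebra_simps)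
  qed simp
qed

text \<open>The one-element basic set commutes with every basic set \<open>W\<close>. The
  coefficients of the two products at the rotation with exponent \<open>i\<close> are the values of
  \<open>W\<close> at the reflections with exponents \<open>g - i\<close> and
  \<open>g + i\<close>.\<close>

lemma singleton_sym:
  assumes "\<And>x. E (True, g) x \<Longrightarrow> fst x \<and> N dvd snd x - g"
  shows "E (True, g + i) (True, g - i)"
proof -
  define d where "d = ind (E (True, g))"
  have d: "d = ind (\<lambda>x. fst x \<and> N dvd snd x - g)"
  proof -
    have "E (True, g) x" if x: "fst x \<and> N dvd snd x - g" for x
    proof -
      have "periodic N (\<lambda>i. d (True, i))" unfolding d_def by (rule perD[OF Fun_per[OF class_Fun]])
      from periodic_cong[OF this, of "snd x" g] have "d (True, snd x) = d (True, g)"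
        using x by simp
      moreover have "d (True, g) = 1" using E_refl by (simp add: d_def)
      moreover have "(True, snd x) = x" using x by (cases x) simp
      ultimately show ?thesis by (simp add: d_def)
    qed
    then have "E (True, g) x \<longleftrightarrow> fst x \<and> N dvd snd x - g" for x using assms by blast
    then show ?thesis unfolding d_def ind_def by simp
  qed
  define W where "W = ind (E (True, g + i))"
  have dF: "d \<in> Fun" and WF: "W \<in> Fun" unfolding d_def W_def by (rule class_Fun)+
  have W: "periodic N (\<lambda>i. W (p, i))" for p using WF by (intro perD Fun_per)
  have d_simps: "d (True, i) = (if N dvd i - g then 1 else 0)" "d (False, i) = 0" for i
    by (simp_all add: d ind_def)
  have "conv N d W (False, i) = W (True, g - i)"
    using S_delta[OF N_pos per_shift(3)[OF W, of True i], of g]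
    by (simp add: conv_False d_simps S_def[of N "\<lambda>i. 0"])
  moreover have "conv N W d (False, i) = W (True, g + i)"
  proof -
    have dd: "N dvd j - i - g \<longleftrightarrow> N dvd j - (g + i)" for j by (simp add: algebra_simps)
    show ?thesis
      using S_delta[OF N_pos W, of "g + i" True]
      by (simp add: conv_False d_simps S_def[of N "\<lambda>i. 0"] dd mult.commute)
  qed
  ultimately have "W (True, g - i) = W (True, g + i)" using conv_comm[OF dF WF] by simp
  then show ?thesis using E_refl[of "(True, g + i)"] by (simp add: W_def ind_def split: if_splits)
qed

end

section \<open>Trivial intersection with the cyclic part\<close>

lemma zinv_D: "zinv M f \<Longrightarrow> M dvd i - j \<Longrightarrow> f (p, i) = f (p, j)"
  unfolding zinv_def by (rule periodic_cong) auto

context symmetric_sring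
begin

text \<open>The part of the S-ring that is invariant under the central involution except at \<open>1\<close> and \<open>c\<^sup>M\<close>
  determines a coarser partition \<open>E1\<close>.\<close>

definition Fun1 :: "(pt \<Rightarrow> int) set" where
  "Fun1 = {f \<in> Fun. \<forall>p i. p \<or> \<not> M dvd i \<longrightarrow> f (p, i + M) = f (p, i)}"

definition E1 :: "pt \<Rightarrow> pt \<Rightarrow> bool" where
  "E1 x y \<longleftrightarrow> (\<forall>f\<in>Fun1. f x = f y)"

lemma Fun1_Fun: "f \<in> Fun1 \<Longrightarrow> f \<in> Fun" by (simp add: Fun1_def)

lemma Fun1_E1: "f \<in> Fun1 \<Longrightarrow> E1 x y \<Longrightarrow> f x = f y" by (simp add: E1_def)

lemma E1_refl: "E1 x x" and E1_sym: "E1 x y \<Longrightarrow> E1 y x" and E1_trans: "E1 x y \<Longrightarrow> E1 y z \<Longrightarrow> E1 x z"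
  by (auto simp: E1_def)

lemma E_E1: "E x y \<Longrightarrow> E1 x y"
  using FunD Fun1_Fun unfolding E1_def by blast

lemma E1_pinv: "E1 x (pinv x)"
  using E_E1 E_pinv by blast

lemma E1_split: "p \<or> \<not> M dvd i \<Longrightarrow> E1 (p, i) (p, i + M)"
proof -
  assume "p \<or> \<not> M dvd i"
  then have "f (p, i + M) = f (p, i)" if "f \<in> Fun1" for f using that unfolding Fun1_def by blast
  then show ?thesis unfolding E1_def by metis
qed

lemma zinv_Fun1: "f \<in> Fun \<Longrightarrow> zinv M f \<Longrightarrow> f \<in> Fun1"
  by (simp add: Fun1_def zinv_iff)

lemma one_Fun1: "one \<in> Fun1"
  using one_Fun N_dvd by (auto simp: Fun1_def one_def ind_def)

lemma E1_one: "E1 x y \<Longrightarrow> \<not> fst x \<and> N dvd snd x \<Longrightarrow> \<not> fst y \<and> N dvd snd y"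
  using Fun1_E1[OF one_Fun1, of x y] by (auto simp: one_def ind_def split: if_splits)

lemma ind_Fun1: assumes "\<And>x y. E1 x y \<Longrightarrow> P x \<Longrightarrow> P y" shows "ind P \<in> Fun1"
proof -
  have "ind P \<in> Fun" using assms E_E1 by (intro ind_Fun) blast
  moreover have "ind P (p, i + M) = ind P (p, i)" if "p \<or> \<not> M dvd i" for p i
    using assms[OF E1_split[OF that]] assms[OF E1_sym[OF E1_split[OF that]]] by (auto simp: ind_def)
  ultimately show ?thesis by (simp add: Fun1_def)
qed

lemma M_dvd_cases:
  assumes "M dvd i" obtains "N dvd i" | "N dvd i - M"
proof -
  obtain a where a: "i = M * a" using assms by blast
  show ?thesis
  proof (cases "even a")
    case True
    then show ?thesis using that(1) by (auto simp: a N_M)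
  next
    case False
    then obtain b where "a = 2 * b + 1" by (elim oddE)
    then have "i - M = N * b" by (simp add: a N_M ring_distribs)
    then show ?thesis using that(2) by simp
  qed
qed

lemma off_zinv:
  assumes "per N f" "\<And>p i. p \<or> \<not> M dvd i \<Longrightarrow> f (p, i + M) = f (p, i)" "f (False, 0) = f (False, M)"
  shows "zinv M f"
  unfolding zinv_iff
proof (intro allI)
  fix p i
  show "f (p, i + M) = f (p, i)"
  proof (cases "p \<or> \<not> M dvd i")
    case False
    then have p: "p = False" and "M dvd i" by auto
    have per: "periodic N (\<lambda>i. f (False, i))" by (rule perD[OF assms(1)])
    from \<open>M dvd i\<close> show ?thesis
    proof (cases rule: M_dvd_cases)
      case 1
      then have "f (False, i) = f (False, 0)" "f (False, i + M) = f (False, M)"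
        using periodic_cong[OF per, of i 0] periodic_cong[OF per, of "i + M" M] by auto
      then show ?thesis using p assms(3) by simp
    next
      case 2
      then have "N dvd i + M" using dvd_add[OF 2, of N] N_M by (simp add: algebra_simps)
      then have "f (False, i) = f (False, M)" "f (False, i + M) = f (False, 0)"
        using 2 periodic_cong[OF per, of i M] periodic_cong[OF per, of "i + M" 0] by auto
      then show ?thesis using p assms(3) by simp
    qed
  qed (use assms(2) in blast)
qed

text \<open>The class of the central involution under \<open>E1\<close>, with 1 added because
  \<open>E1\<close> keeps 1 isolated. It will turn out to be a subgroup.\<close>

definition L :: "pt \<Rightarrow> bool" where
  "L x \<longleftrightarrow> E1 (False, M) x \<or> \<not> fst x \<and> N dvd snd x"

lemma L_E1: "L x \<Longrightarrow> E1 x y \<Longrightarrow> L y"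
  unfolding L_def using E1_trans E1_one by blast

lemma L_one: "N dvd i \<Longrightarrow> L (False, i)" and L_z: "L (False, M)"
  using E1_refl by (auto simp: L_def)

text \<open>Let \<open>W\<close> be the class of \<open>y\<close>. The coefficient of the square of
  \<open>W\<close> is constant on the class of the central involution, where it attains its maximal
  value, the size of \<open>W\<close>. So every element of \<open>L\<close> stabilizes
  \<open>W\<close>.\<close>

lemma E1_pm_L:
  assumes "\<not> L y" "L g"
  shows "E1 y (pm y g)"
proof (cases "E1 (False, M) g")
  case False
  then obtain i where g: "g = (False, i)" "N dvd i" using assms(2) by (cases g) (auto simp: L_def)
  obtain p j where y: "y = (p, j)" by fastforce
  have "f (p, j) = f (pm (p, j) g)" if "f \<in> Fun1" for f
  proof -
    have "periodic N (\<lambda>i. f (p, i))" using that by (intro perD Fun_per Fun1_Fun)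
    from periodic_cong[OF this, of j "j + i"] periodic_cong[OF this, of j "j - i"]
    have "f (p, j) = f (p, j + i)" "f (p, j) = f (p, j - i)" using g(2) by simp_all
    then show ?thesis unfolding g(1) by (cases p) simp_all
  qed
  then show ?thesis by (simp add: E1_def y)
next
  case True
  define W where "W = ind (E1 y)"
  have W1: "W \<in> Fun1" unfolding W_def using E1_trans by (rule ind_Fun1)
  then have WF: "W \<in> Fun" by (rule Fun1_Fun)
  have not_L: "\<not> E1 y x" if "L x" for x
    using that assms(1) L_E1 E1_sym by blast
  have "zinv M W"
  proof (rule off_zinv[OF Fun_per[OF WF]])
    show "W (False, 0) = W (False, M)" using not_L[OF L_z] not_L[OF L_one, of 0] by (simp add: W_def)
  qed (use W1 in \<open>auto simp: Fun1_def\<close>)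
  then have "conv N W W \<in> Fun1" using WF by (intro zinv_Fun1 Fun_conv zinv_conv)
  from Fun1_E1[OF this True] have eq: "conv N W W (False, M) = conv N W W g" .
  have "W (pm (pinv u) (False, M)) = W u" for u
  proof -
    obtain p b where u: "u = (p, b)" by fastforce
    have "W (True, b - M) = W (True, b)" "W (False, - b + M) = W (False, - b)"
      using zinv_D[OF \<open>zinv M W\<close>, of "b - M" b] zinv_D[OF \<open>zinv M W\<close>, of "- b + M" "- b"] by simp_all
    then have "W (pm (pinv u) (False, M)) = W (pinv u)"
      unfolding u by (cases p) simp_all
    then show ?thesis using Fun_pinv[OF WF] by simp
  qed
  then have "conv N W W (False, M) = tot N W"
    unfolding conv_def by (simp add: W_def)
  then have "tot N (\<lambda>u. W u - W u * W (pm (pinv u) g)) = 0"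
    using eq by (simp add: tot_diff conv_def)
  moreover have "per N (\<lambda>u. W u - W u * W (pm (pinv u) g))"
    using Fun_per[OF WF] per_mult[OF Fun_per[OF WF] per_pm(3)[OF per_pm(1)[OF Fun_per[OF WF]], of g]]
    by (simp add: per_def periodic_def)
  moreover have "0 \<le> W u - W u * W (pm (pinv u) g)" for u by (simp add: W_def ind_def)
  ultimately have "W u - W u * W (pm (pinv u) g) = 0" for u
    using tot_zero_iff[OF N_pos, of "\<lambda>u. W u - W u * W (pm (pinv u) g)"] by blast
  from this[of "pinv y"] have "W (pm y g) = 1"
    using E1_pinv[of y] E1_refl[of y] Fun_pinv[OF WF, of y] by (simp add: W_def)
  then show ?thesis by (simp add: W_def)
qed

lemma L_pinv: "L x \<Longrightarrow> L (pinv x)"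
  using L_E1 E1_pinv by blast

lemma L_pm:
  assumes "L x" "L y" shows "L (pm x y)"
proof (rule ccontr)
  assume no: "\<not> L (pm x y)"
  have "E1 (pm x y) (pm (pm x y) (pinv y))" by (rule E1_pm_L[OF no L_pinv[OF assms(2)]])
  then have "E1 (pm x y) x" by simp
  then show False using no assms(1) L_E1 E1_sym by blast
qed

lemma zinv_L:
  assumes "f \<in> Fun" "zinv M f" "L g"
  shows "f (pm x g) = f x"
proof (cases "L x")
  case False
  then show ?thesis using Fun1_E1[OF zinv_Fun1[OF assms(1,2)] E1_pm_L[OF False assms(3)]] by simp
next
  case True
  have const: "f y = f (False, 0)" if "L y" for y
  proof (cases "E1 (False, M) y")
    case True
    then have "f y = f (False, M)" using Fun1_E1[OF zinv_Fun1[OF assms(1,2)]] by metis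
    then show ?thesis using zinv_D[OF assms(2), of M 0] by simp
  next
    case False
    then have "\<not> fst y" "N dvd snd y - 0" using that by (auto simp: L_def)
    then show ?thesis using periodic_cong[OF perD[OF Fun_per[OF assms(1)]], of "snd y" 0 False] by (cases y) auto
  qed
  show ?thesis using const[OF True] const[OF L_pm[OF True assms(3)]] by simp
qed

text \<open>The linear character that sends \<open>c\<close> to 1 and \<open>s\<close> to
  -1.\<close>

definition th :: "(pt \<Rightarrow> int) \<Rightarrow> int" where
  "th f = S N (\<lambda>i. f (False, i)) - S N (\<lambda>i. f (True, i))"

lemma th_al: "of_int (th f) = al N 0 f - be N 0 f"
  by (simp add: th_def al_def be_def hat_def S_of_int)

lemma th_conv:
  assumes "f \<in> Fun" "g \<in> Fun" shows "th (conv N f g) = th f * th g"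
proof -
  have "cnj (be N 0 g) = be N 0 g" by (simp add: be_def hat_def S_of_int)
  then have "(of_int (th (conv N f g)) :: complex) = of_int (th f * th g)"
    unfolding of_int_mult th_al by (simp add: Al_conv assms Be_conv algebra_simps)
  then show ?thesis by (simp only: of_int_eq_iff)
qed

lemma th_linear: "th (\<lambda>x. f x + g x) = th f + th g" "th (\<lambda>x. f x - g x) = th f - th g"
    "th (\<lambda>x. c * f x) = c * th f" "th one = 1"
proof -
  have "(of_int (th one) :: complex) = 1" unfolding th_al by (simp add: al_one be_one)
  then show "th one = 1" by simp
qed (simp_all add: th_def S_add S_diff S_cmult algebra_simps)

text \<open>Horner evaluation, under convolution, of the integer polynomial with coefficient list
  \<open>cs\<close> (constant term first) at the element \<open>g\<close>.\<close>

primrec pe :: "(pt \<Rightarrow> int) \<Rightarrow> int list \<Rightarrow> pt \<Rightarrow> int" where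
  "pe g [] = (\<lambda>x. 0)"
| "pe g (a # cs) = (\<lambda>x. a * one x + conv N g (pe g cs) x)"

primrec pw :: "(pt \<Rightarrow> int) \<Rightarrow> nat \<Rightarrow> pt \<Rightarrow> int" where
  "pw g 0 = one"
| "pw g (Suc k) = conv N g (pw g k)"

lemma pe_Fun: "g \<in> Fun \<Longrightarrow> pe g cs \<in> Fun"
  by (induct cs) (simp_all add: Fun_0 Fun_add Fun_cmult one_Fun Fun_conv)

lemma pe_pw: "pe g cs x = (\<Sum>i<length cs. cs ! i * pw g i x)"
proof (induct cs arbitrary: x)
  case (Cons a cs)
  have lin: "conv N g (\<lambda>y. \<Sum>i<k. c i * h i y) x = (\<Sum>i<k. c i * conv N g (h i) x)" for k :: nat and c h x
    by (induct k) (simp_all add: conv_add conv_cmult, simp add: conv_def tot_def S_def)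
  have "pe g cs = (\<lambda>y. \<Sum>i<length cs. cs ! i * pw g i y)" using Cons by blast
  then show ?case by (simp add: lin sum.lessThan_Suc_shift del: sum.lessThan_Suc)
qed simp

lemma pe_dependent:
  assumes "g \<in> Fun"
  shows "\<exists>cs. (\<exists>a\<in>set cs. a \<noteq> 0) \<and> (\<forall>x. pe g cs x = 0)"
proof -
  define R where "R = (UNIV :: bool set) \<times> {0..<N}"
  have "finite R" by (simp add: R_def)
  from int_dependency[OF this, of "{..<Suc (card R)}" "pw g"]
  obtain c where c: "\<exists>i<Suc (card R). c i \<noteq> 0" "\<forall>x\<in>R. (\<Sum>i<Suc (card R). c i * pw g i x) = 0"
    by (auto simp del: sum.lessThan_Suc)
  define cs where "cs = map c [0..<Suc (card R)]"
  have pe: "pe g cs x = (\<Sum>i<Suc (card R). c i * pw g i x)" for x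
    unfolding pe_pw by (rule sum.cong) (auto simp: cs_def simp del: upt_Suc)
  have "pe g cs x = 0" for x
  proof -
    obtain p i where x: "x = (p, i)" by fastforce
    have "periodic N (\<lambda>i. pe g cs (p, i))" by (rule perD[OF Fun_per[OF pe_Fun[OF assms]]])
    from periodic_mod[OF this, of i] have "pe g cs (p, i) = pe g cs (p, i mod N)" by simp
    also have "\<dots> = 0" using c(2) N_pos unfolding pe by (auto simp: R_def simp del: sum.lessThan_Suc)
    finally show ?thesis by (simp add: x)
  qed
  moreover have "\<exists>a\<in>set cs. a \<noteq> 0" using c(1) by (auto simp: cs_def simp del: upt_Suc)
  ultimately show ?thesis by blast
qed

end

text \<open>The situation in which the class of the central involution contains a reflection, so
  that multiplication by an element of \<open>L\<close> exchanges rotations and reflections.\<close>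

locale linked_sring = symmetric_sring +
  fixes g0 :: int
  assumes L_g0: "L (True, g0)"
begin

lemma th_zinv:
  assumes "f \<in> Fun" "zinv M f" shows "th f = 0"
proof -
  have "f (False, i) = f (True, i + g0)" for i
    using zinv_L[OF assms L_g0, of "(False, i)"] by simp
  then show ?thesis
    using S_shift[OF N_pos perD[OF Fun_per[OF assms(1)]], of True g0] by (simp add: th_def)
qed

text \<open>The rational character \<open>th\<close> vanishes on the kernel of the faithful
  representation, so it is one of the two characters occurring in it.\<close>

lemma th_faithful:
  assumes "f \<in> Fun"
  shows "(Al f - of_int (th f)) ^ 2 = Be f * cnj (Be f)"
proof (rule ccontr)
  assume ne: "\<not> ?thesis"
  define g where "g x = f x - th f * one x" for x
  have gF: "g \<in> Fun" unfolding g_def using assms one_Fun by (intro Fun_diff Fun_cmult)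
  have g: "th g = 0" "Al g = Al f - of_int (th f)" "Be g = Be f"
    unfolding g_def by (simp_all add: th_linear al_linear al_one be_one)
  have nu: "Al g ^ 2 - Be g * cnj (Be g) \<noteq> 0" using ne by (simp add: g)
  \<comment> \<open>\<open>Al g ^ 2 - Be g * cnj (Be g)\<close> is the determinant of
    \<open>g\<close>; if it is nonzero, \<open>g\<close> can be cancelled modulo the kernel of the
    faithful representation.\<close>
  have cancel: "Al h = 0 \<and> Be h = 0" if hF: "h \<in> Fun" and h: "Al (conv N g h) = 0" "Be (conv N g h) = 0" for h
  proof -
    have 1: "Al g * Al h + Be g * cnj (Be h) = 0" using h(1) by (simp add: Al_conv gF hF)
    have 2: "Al g * Be h + Be g * Al h = 0" using h(2) by (simp add: Be_conv gF hF)
    have 3: "Al g * cnj (Be h) + cnj (Be g) * Al h = 0"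
      using arg_cong[OF 2, of cnj] by (simp add: cnj_al gF hF)
    have "(Al g ^ 2 - Be g * cnj (Be g)) * Al h =
        Al g * (Al g * Al h + Be g * cnj (Be h)) - Be g * (Al g * cnj (Be h) + cnj (Be g) * Al h)"
      by (simp add: power2_eq_square algebra_simps)
    then have A: "Al h = 0" using 1 3 nu by simp
    have "Be g * cnj (Be h) = 0" "Al g * Be h = 0" using 1 2 A by simp_all
    then have "Be h = 0" using nu by auto
    then show ?thesis using A by simp
  qed
  \<comment> \<open>Vanishing low coefficients are factors \<open>g\<close> and can be cancelled.
    What remains lies in the kernel and has constant term \<open>a\<close> different from 0; its
    value under \<open>th\<close> would be both 0 and \<open>a\<close>.\<close>
  have strip: "\<exists>a bs. a \<noteq> 0 \<and> Al (pe g (a # bs)) = 0 \<and> Be (pe g (a # bs)) = 0"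
    if "\<exists>a\<in>set cs. a \<noteq> 0" "Al (pe g cs) = 0" "Be (pe g cs) = 0" for cs
    using that
  proof (induct cs)
    case (Cons a cs)
    show ?case
    proof (cases "a = 0")
      case True
      then have "Al (conv N g (pe g cs)) = 0" "Be (conv N g (pe g cs)) = 0" using Cons.prems by simp_all
      then show ?thesis using cancel[OF pe_Fun[OF gF]] Cons True by auto
    qed (use Cons.prems in blast)
  qed simp
  obtain cs where cs: "\<exists>a\<in>set cs. a \<noteq> 0" "\<forall>x. pe g cs x = 0" using pe_dependent[OF gF] by blast
  have "pe g cs = (\<lambda>x. 0)" using cs(2) by auto
  then have "Al (pe g cs) = 0" "Be (pe g cs) = 0" by (simp_all add: al_def be_def hat_def S_def)
  then obtain a bs where ab: "a \<noteq> 0" "Al (pe g (a # bs)) = 0" "Be (pe g (a # bs)) = 0"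
    using strip cs(1) by blast
  have "pe g (a # bs) \<in> Fun" by (rule pe_Fun[OF gF])
  then have "th (pe g (a # bs)) = 0"
    using ab(2,3) zinv_Al_Be[OF Fun_per] th_zinv by blast
  moreover have "th (pe g (a # bs)) = a"
    using th_conv[OF gF pe_Fun[OF gF]] g(1) by (simp add: th_linear)
  ultimately show False using ab(1) by simp
qed

lemma th_faithful2:
  assumes "f \<in> Fun" "g \<in> Fun"
  shows "(Al f - of_int (th f)) * (Al g - of_int (th g)) = Be f * cnj (Be g)"
proof -
  have "(Al f + Al g - of_int (th f) - of_int (th g)) ^ 2 = (Be f + Be g) * cnj (Be f + Be g)"
    using th_faithful[OF Fun_add[OF assms]] by (simp add: al_linear th_linear diff_diff_eq)
  moreover have "Al f + Al g - of_int (th f) - of_int (th g) = (Al f - of_int (th f)) + (Al g - of_int (th g))" by simp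
  ultimately have "(Al f - of_int (th f)) ^ 2 + (Al g - of_int (th g)) ^ 2 + 2 * ((Al f - of_int (th f)) * (Al g - of_int (th g))) =
      Be f * cnj (Be f) + Be g * cnj (Be g) + (Be f * cnj (Be g) + Be g * cnj (Be f))"
    by (simp only: power2_sum complex_cnj_add ring_distribs mult.assoc add_ac)
  then have "2 * ((Al f - of_int (th f)) * (Al g - of_int (th g))) = Be f * cnj (Be g) + Be g * cnj (Be f)"
    unfolding th_faithful[OF assms(1)] th_faithful[OF assms(2)] by simp
  also have "\<dots> = 2 * (Be f * cnj (Be g))" using Be_comm[OF assms, of 1] by simp
  finally show ?thesis by simp
qed

text \<open>Under this hypothesis \<open>E1\<close> is no coarser than \<open>E\<close>. Outside
  \<open>L\<close>, multiplication by the reflection in \<open>L\<close> stays within a class, so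
  one can pass from the reflection with exponent \<open>g0 + i\<close> to a rotation, invert it, and
  pass back.\<close>

lemma sym_no_split:
  assumes "\<And>f. f \<in> Fun \<Longrightarrow> Be f = 0 \<and> Al f = of_int (th f)"
  shows "E (True, g0 + i) (True, g0 - i)"
proof -
  have FF: "f \<in> Fun1" if f: "f \<in> Fun" for f
  proof -
    have "f (True, i + M) = f (True, i)" for i using assms[OF f] Al_Be_zero(2)[OF Fun_per[OF f]] by blast
    moreover have "\<not> M dvd i \<Longrightarrow> f (False, i + M) = f (False, i)" for i
      using assms[OF f] Al_int(2)[OF Fun_per[OF f]] by blast
    ultimately have "f (p, i + M) = f (p, i)" if "p \<or> \<not> M dvd i" for p i
      using that by (cases p) simp_all
    then show ?thesis unfolding Fun1_def using f by blast
  qed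
  then have E1_E: "E1 x y \<Longrightarrow> E x y" for x y
  proof -
    assume "E1 x y"
    with Fun1_E1[OF FF[OF class_Fun]]
    have "ind (E x) x = ind (E x) y" by blast
    then show "E x y" using E_refl[of x] by simp
  qed
  show ?thesis
  proof (cases "L (True, g0 + i)")
    case True
    have "L (pm (True, g0 + i) (True, g0))" by (rule L_pm[OF True L_g0])
    then have "L (False, i)" by simp
    then have "L (pm (pinv (False, i)) (True, g0))" using L_pm L_pinv L_g0 by blast
    then have "E1 (False, M) (True, g0 - i)" by (simp add: L_def)
    moreover have "E1 (False, M) (True, g0 + i)" using True by (simp add: L_def)
    ultimately show ?thesis using E1_E E1_sym E1_trans by blast
  next
    case False
    have "E1 (True, g0 + i) (pm (True, g0 + i) (True, g0))" by (rule E1_pm_L[OF False L_g0])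
    then have 1: "E1 (True, g0 + i) (False, i)" by simp
    then have "E1 (True, g0 + i) (False, - i)" using E1_pinv[of "(False, i)"] E1_trans by fastforce
    moreover from this have "\<not> L (False, - i)" using False L_E1 E1_sym by blast
    then have "E1 (False, - i) (pm (False, - i) (True, g0))" using E1_pm_L L_g0 by blast
    ultimately have "E1 (True, g0 + i) (True, g0 - i)" using E1_trans by fastforce
    then show ?thesis by (rule E1_E)
  qed
qed

end

lemma S_dvd_coset:
  fixes e :: "int \<Rightarrow> int"
  assumes "h > 0" "l > 0" "periodic (h * l) e"
  shows "S (h * l) (\<lambda>j. (if h dvd j - i then 1 else 0) * e j) = S l (\<lambda>j. e (i + h * j))"
proof -
  have per: "periodic h (\<lambda>i. S l (\<lambda>j. e (i + h * j)))"
    unfolding periodic_def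
  proof
    fix i
    have "periodic l (\<lambda>j. e (i + h * j))"
      using assms(3) by (simp add: periodic_def ring_distribs add.assoc[symmetric])
    from S_shift[OF assms(2) this, of 1] show "S l (\<lambda>j. e (i + h + h * j)) = S l (\<lambda>j. e (i + h * j))"
      by (simp add: ring_distribs add_ac)
  qed
  have "S (h * l) (\<lambda>j. (if h dvd j - i then 1 else 0) * e j) =
      S h (\<lambda>k. (if h dvd k - i then 1 else 0) * S l (\<lambda>j. e (k + h * j)))"
    unfolding S_divide[OF assms(1,2)] S_cmult[symmetric]
  proof (intro S_cong)
    fix k j
    have "k + h * j - i = (k - i) + h * j" by simp
    then have "h dvd k + h * j - i \<longleftrightarrow> h dvd k - i" using dvd_add_left_iff[of h "h * j" "k - i"] by (simp only: dvd_triv_left)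
    then show "(if h dvd k + h * j - i then 1 else 0) * e (k + h * j) = (if h dvd k - i then 1 else 0) * e (k + h * j)"
      by simp
  qed
  also have "\<dots> = S l (\<lambda>j. e (i + h * j))" by (rule S_delta[OF assms(1) per])
  finally show ?thesis .
qed

lemma S_coset_product:
  fixes e q :: "int \<Rightarrow> int"
  assumes "h > 0" "l > 0" "periodic (h * l) e" "periodic h q"
  shows "S (h * l) (\<lambda>j. e j * q j) = S h (\<lambda>i. S (h * l) (\<lambda>j. (if h dvd j - i then 1 else 0) * e j) * q i)"
proof -
  have q: "q (i + h * j) = q i" for i j
    using periodic_mult[OF assms(4), of i j] by (simp add: mult.commute)
  show ?thesis
    unfolding S_dvd_coset[OF assms(1-3)] unfolding S_divide[OF assms(1,2)] q
    by (rule S_cong) (simp add: S_def sum_distrib_right)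
qed

lemma dvd_half_diff:
  fixes i j :: int
  assumes "2 ^ r dvd 2 * i" "2 ^ r dvd 2 * j" "\<not> 2 ^ r dvd i" "\<not> 2 ^ r dvd j"
  shows "2 ^ r dvd i - j"
proof (cases r)
  case (Suc s)
  obtain a b where ab: "i = 2 ^ s * a" "j = 2 ^ s * b" using assms(1,2) by (auto simp: Suc elim!: dvdE)
  have "odd a" "odd b" using assms(3,4) by (auto simp: ab Suc)
  then obtain c where "a - b = 2 * c" by (metis even_diff dvdE odd_even_add even_add)
  then have "i - j = 2 ^ Suc s * c" by (simp add: ab right_diff_distrib[symmetric])
  then show ?thesis by (simp add: Suc)
qed simp

context symmetric_sring
begin

lemma tot_one: "tot N one = 1"
  using S_delta[OF N_pos, of "\<lambda>i. 1 :: int" 0]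
  by (simp add: tot_def one_simps S_def[of N "\<lambda>i. 0"] periodic_def)

text \<open>Both sides count the pairs in \<open>Y\<close> whose quotient lies in \<open>H\<close>.\<close>

lemma tot_conv_sub:
  assumes "Y \<in> Fun" "H \<in> Fun"
  shows "tot N (\<lambda>x. H x * conv N Y Y x) = tot N (\<lambda>y. Y y * conv N Y H (pinv y))"
proof -
  have inner: "tot N (\<lambda>x. H x * Y (pm (pinv y) x)) = conv N Y H (pinv y)" for y
  proof -
    have "per N (\<lambda>x. H x * Y (pm (pinv y) x))"
      by (intro per_mult per_pm(2) Fun_per assms)
    from tot_pm_left[OF N_pos this, of y]
    have "tot N (\<lambda>x. H x * Y (pm (pinv y) x)) = tot N (\<lambda>x. H (pm y x) * Y x)" by simp
    also have "\<dots> = conv N Y H (pinv y)"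
      unfolding conv_def using Fun_pinv[OF assms(2), of "pm y _"] by (simp add: pinv_pm mult.commute)
    finally show ?thesis .
  qed
  have "tot N (\<lambda>x. H x * conv N Y Y x) = tot N (\<lambda>x. tot N (\<lambda>y. Y y * (H x * Y (pm (pinv y) x))))"
    by (simp add: conv_def tot_cmult[symmetric] mult_ac)
  also have "\<dots> = tot N (\<lambda>y. Y y * tot N (\<lambda>x. H x * Y (pm (pinv y) x)))"
    by (subst tot_swap) (simp add: tot_cmult)
  finally show ?thesis by (simp add: inner)
qed

lemma conv_at_one:
  assumes "Y \<in> Fun" shows "conv N Y Y (False, 0) = tot N (\<lambda>x. Y x * Y x)"
  using Fun_pinv[OF assms, of "(False, _)"] by (simp add: conv_False tot_def)

lemma tot_ind_nonneg: "0 \<le> tot N (ind P)"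
  by (simp add: tot_def S_nonneg)

lemma tot_ind_one:
  assumes "per N (ind P)" "tot N (ind P) = 1" "P (True, i)" "P x"
  shows "fst x \<and> N dvd snd x - i"
proof -
  define d where "d x = ind P x - ind (\<lambda>x. fst x \<and> N dvd snd x - i) x" for x
  have 1: "tot N (ind (\<lambda>x. fst x \<and> N dvd snd x - i)) = 1"
    using S_delta[OF N_pos, of "\<lambda>i. 1 :: int" i]
    by (simp add: tot_def ind_def S_def[of N "\<lambda>i. 0"] periodic_def)
  have P: "P (True, j)" if "N dvd j - i" for j
    using periodic_cong[OF perD[OF assms(1)] that, of True] assms(3) by simp
  have "tot N d = 0" using 1 assms(2) unfolding d_def by (simp add: tot_diff)
  moreover have "per N d"
  proof -
    have "N dvd j + N - i \<longleftrightarrow> N dvd j - i" for j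
      using dvd_add_left_iff[of N N "j - i"] by (simp add: algebra_simps)
    then show ?thesis
      using assms(1) by (simp add: d_def per_def periodic_def ind_def)
  qed
  moreover have "0 \<le> d x" for x using P[of "snd x"] by (cases x) (auto simp: d_def ind_def)
  ultimately have "d x = 0" using tot_zero_iff[OF N_pos, of d] by blast
  then show ?thesis using assms(4) by (auto simp: d_def ind_def split: if_splits)
qed

end

section \<open>Elements whose diagonal entry in the faithful representation is rational\<close>

context linked_sring
begin

definition Fun2 :: "(pt \<Rightarrow> int) set" where
  "Fun2 = {f \<in> Fun. \<forall>i. \<not> M dvd i \<longrightarrow> f (False, i + M) = f (False, i)}"

definition E2 :: "pt \<Rightarrow> pt \<Rightarrow> bool" where
  "E2 x y \<longleftrightarrow> (\<forall>f\<in>Fun2. f x = f y)"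

lemma Fun2_Fun: "f \<in> Fun2 \<Longrightarrow> f \<in> Fun" by (simp add: Fun2_def)

lemma Fun1_Fun2: "f \<in> Fun1 \<Longrightarrow> f \<in> Fun2" by (simp add: Fun1_def Fun2_def)

lemma E2_E1: "E2 x y \<Longrightarrow> E1 x y" using Fun1_Fun2 by (auto simp: E1_def E2_def)

lemma E2_refl: "E2 x x" and E2_sym: "E2 x y \<Longrightarrow> E2 y x" and E2_trans: "E2 x y \<Longrightarrow> E2 y z \<Longrightarrow> E2 x z"
  by (auto simp: E2_def)

lemma E_E2: "E x y \<Longrightarrow> E2 x y"
  using FunD Fun2_Fun unfolding E2_def by blast

lemma class_Fun2: "ind (E2 x) \<in> Fun2"
proof -
  have "ind (E2 x) \<in> Fun" using E2_trans E_E2 by (intro ind_Fun) blast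
  moreover have "ind (E2 x) (False, i + M) = ind (E2 x) (False, i)" if "\<not> M dvd i" for i
  proof -
    have "E2 (False, i + M) (False, i)" using that by (simp add: E2_def Fun2_def)
    then have "E2 x (False, i + M) \<longleftrightarrow> E2 x (False, i)" using E2_trans E2_sym by blast
    then show ?thesis by (simp add: ind_def)
  qed
  ultimately show ?thesis by (simp add: Fun2_def)
qed

lemma Fun2_Al: "f \<in> Fun2 \<Longrightarrow> Al f = of_int (f (False, 0) - f (False, M))"
  by (rule Al_off) (auto simp: Fun2_def intro: Fun_per)

text \<open>The other character \<open>2 Al - th\<close> of the faithful representation takes values in a
  number ring, so some element of its kernel complement has a nonzero rational value.\<close>

lemma exists_rational_split:
  assumes "f \<in> Fun" "\<not> (Be f = 0 \<and> Al f = of_int (th f))"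
  shows "\<exists>h\<in>Fun2. Be h \<noteq> 0"
proof -
  define g where "g x = f x - th f * one x" for x
  have gF: "g \<in> Fun" unfolding g_def using assms(1) one_Fun by (intro Fun_diff Fun_cmult)
  have g: "th g = 0" "Al g = Al f - of_int (th f)" "Be g = Be f"
    unfolding g_def by (simp_all add: th_linear al_linear al_one be_one)
  \<comment> \<open>The two eigenvalues of the faithful representation add up to the trace
    \<open>2 * Al\<close>, and by \<open>th_faithful\<close> one of them is \<open>th\<close>;
    \<open>K\<close> is the other one.\<close>
  define K where "K h = 2 * Al h - of_int (th h)" for h
  have K0: "K g \<noteq> 0" using th_faithful[OF assms(1)] assms(2) by (auto simp: K_def g)
  have K_conv: "K (conv N g h) = K g * K h" if h: "h \<in> Fun" for h
    using th_faithful2[OF gF h] by (simp add: K_def g(1) th_conv gF h Al_conv) (simp add: algebra_simps)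
  have strip: "\<exists>a bs. a \<noteq> 0 \<and> K (pe g (a # bs)) = 0"
    if "\<exists>a\<in>set cs. a \<noteq> 0" "K (pe g cs) = 0" for cs
    using that
  proof (induct cs)
    case (Cons a cs)
    show ?case
    proof (cases "a = 0")
      case True
      then have "K (conv N g (pe g cs)) = 0" using Cons.prems by simp
      then have "K (pe g cs) = 0" using K_conv[OF pe_Fun[OF gF]] K0 by simp
      then show ?thesis using Cons True by auto
    qed (use Cons.prems in blast)
  qed simp
  obtain cs where cs: "\<exists>a\<in>set cs. a \<noteq> 0" "\<forall>x. pe g cs x = 0" using pe_dependent[OF gF] by blast
  have "pe g cs = (\<lambda>x. 0)" using cs(2) by auto
  then have "K (pe g cs) = 0" by (simp add: K_def al_def hat_def S_def th_def)
  then obtain a bs where ab: "a \<noteq> 0" "K (pe g (a # bs)) = 0"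
    using strip cs(1) by blast
  \<comment> \<open>Without the constant term the polynomial is a multiple of \<open>g\<close>:
    \<open>th\<close> vanishes on it and \<open>K\<close> takes the value \<open>- a\<close>, so the
    trace, and with it \<open>Al h\<close>, is rational.\<close>
  define h where "h = conv N g (pe g bs)"
  have hF: "h \<in> Fun" unfolding h_def by (intro Fun_conv gF pe_Fun)
  have th: "th h = 0" unfolding h_def by (simp add: th_conv gF pe_Fun g(1))
  have "K (pe g (a # bs)) = of_int a + K h"
    by (simp add: K_def h_def al_linear al_one th_linear)
  then have K: "2 * Al h = of_int (- a)" using ab(2) th by (simp add: K_def add_eq_0_iff)
  have "Be h \<noteq> 0"
    using th_faithful[OF hF] K ab(1) th by auto
  moreover have "h \<in> Fun2"
  proof -
    have "Al (\<lambda>x. 2 * h x) = of_int (- a)" using K by (simp add: al_linear)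
    from Al_int(2)[OF Fun_per[OF Fun_cmult[OF hF]] this] show ?thesis
      using hF by (simp add: Fun2_def)
  qed
  ultimately show ?thesis by blast
qed

text \<open>On \<open>Fun2\<close> this is \<open>th - Al\<close>, an integer whose absolute value
  is the modulus of \<open>Be f\<close>.\<close>

definition tau :: "(pt \<Rightarrow> int) \<Rightarrow> int" where
  "tau f = th f - (f (False, 0) - f (False, M))"

lemma Be_tau:
  assumes "f \<in> Fun2" "g \<in> Fun2" shows "Be f * cnj (Be g) = of_int (tau f * tau g)"
  using th_faithful2[OF assms[THEN Fun2_Fun]] assms by (simp add: Fun2_Al tau_def algebra_simps)

lemma L_rotations: obtains r where "r \<le> m" "\<And>i. L (False, i) \<longleftrightarrow> 2 ^ r dvd i" "\<And>i. L (True, i) \<longleftrightarrow> 2 ^ r dvd i - g0"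
proof -
  have "L (False, i - j)" if "L (False, i)" "L (False, j)" for i j
    using L_pm[OF that(1) L_pinv[OF that(2)]] by simp
  then obtain r where r: "r \<le> m" "\<And>i. L (False, i) \<longleftrightarrow> 2 ^ r dvd i"
    using int_subgroup_two_power[of "\<lambda>i. L (False, i)" m] L_z unfolding M_def by blast
  have "L (True, i) \<longleftrightarrow> L (False, i - g0)" for i
  proof
    assume "L (True, i)"
    from L_pm[OF this L_g0] show "L (False, i - g0)" by simp
  next
    assume "L (False, i - g0)"
    from L_pm[OF this L_g0] show "L (True, i)" by simp
  qed
  then show ?thesis using that[of r] r by simp
qed

lemma ind_L_Fun1: "ind L \<in> Fun1"
  using L_E1 by (intro ind_Fun1) blast

lemma zinv_ind_L: "zinv M (ind L)"
proof (rule off_zinv[OF Fun_per[OF Fun1_Fun[OF ind_L_Fun1]]])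
  show "ind L (False, 0) = ind L (False, M)" using L_z L_one[of 0] by simp
qed (use ind_L_Fun1 in \<open>auto simp: Fun1_def\<close>)

lemma tot_ind_L: obtains s where "tot N (ind L) = 2 ^ s"
proof -
  obtain r where r: "r \<le> m" "\<And>i. L (False, i) \<longleftrightarrow> 2 ^ r dvd i" "\<And>i. L (True, i) \<longleftrightarrow> 2 ^ r dvd i - g0"
    using L_rotations by blast
  have N: "N = 2 ^ r * 2 ^ (Suc m - r)" using r(1) by (simp add: N_def power_add[symmetric])
  have "S N (\<lambda>j. ind (\<lambda>j. 2 ^ r dvd j - i) j) = 2 ^ (Suc m - r)" for i
    using S_dvd_coset[of "2 ^ r" "2 ^ (Suc m - r)" "\<lambda>j. 1" i, folded N]
    by (simp add: periodic_def ind_def S_def[of "2 ^ (Suc m - r)"])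
  from this[of 0] this[of g0] have "tot N (ind L) = 2 ^ Suc (Suc m - r)"
    by (simp add: tot_def ind_def r(2,3))
  then show ?thesis using that by blast
qed

end

locale linked_sring_split = linked_sring +
  fixes i0 :: int
  assumes split: "\<not> E2 (True, i0) (True, i0 + M)"
    and not_z: "\<not> E2 (True, i0) (False, M)"
begin

definition "Y = ind (E2 (True, i0))"
definition "Y2 = ind (E2 (True, i0 + M))"
definition "c = Y2 (False, M)"
text \<open>The last term occurs exactly if \<open>Y2\<close> contains the central involution. It
  balances 1 against that element, so that \<open>U\<close> becomes invariant.\<close>

definition "U x = Y x + Y2 x + c * one x"
definition "t = th Y"

lemma Y_Fun2: "Y \<in> Fun2" and Y2_Fun2: "Y2 \<in> Fun2"
  by (simp_all add: Y_def Y2_def class_Fun2)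

lemma Y_Fun: "Y \<in> Fun" and Y2_Fun: "Y2 \<in> Fun"
  by (simp_all add: Y_Fun2 Y2_Fun2 Fun2_Fun)

lemma E2_not_one: "\<not> E2 (True, i) (False, 0)"
proof
  assume "E2 (True, i) (False, 0)"
  then have "E1 (False, 0) (True, i)" using E2_E1 E1_sym by blast
  from E1_one[OF this] show False by simp
qed

lemma Y_val: "Y (True, i0) = 1" "Y (True, i0 + M) = 0" "Y (False, 0) = 0" "Y (False, M) = 0"
  "Y2 (True, i0) = 0" "Y2 (True, i0 + M) = 1" "Y2 (False, 0) = 0"
  using split not_z E2_not_one E2_refl E2_sym by (auto simp: Y_def Y2_def)

lemma Y_01: "Y x * Y x = Y x" "0 \<le> Y x" "0 \<le> Y2 x"
  by (simp_all add: Y_def Y2_def)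

lemma tau_Y: "tau Y = t"
  by (simp add: tau_def t_def Y_val)

lemma Be_Y_ne: "Be Y \<noteq> 0"
  using Al_Be_zero(2)[OF Fun_per[OF Y_Fun]] Y_val(1,2) by force

lemma t_ne: "t \<noteq> 0"
  using Be_tau[OF Y_Fun2 Y_Fun2] Be_Y_ne by (auto simp: tau_Y)

text \<open>All products \<open>Be f * cnj (Be g)\<close> over \<open>Fun2\<close> are integers, so
  the values of \<open>Be\<close> there are rational multiples of a single one.\<close>

lemma Be_prop: assumes "f \<in> Fun2" shows "of_int t * Be f = of_int (tau f) * Be Y"
proof -
  have "of_int (t * t) * Be f = Be f * cnj (Be Y) * Be Y"
    using Be_tau[OF Y_Fun2 Y_Fun2] by (simp add: tau_Y mult_ac)
  also have "\<dots> = of_int (tau f * t) * Be Y" using Be_tau[OF assms Y_Fun2] by (simp add: tau_Y)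
  finally have "of_int t * (of_int t * Be f) = of_int t * (of_int (tau f) * Be Y)" by (simp add: mult_ac)
  then show ?thesis using t_ne by simp
qed

text \<open>The combination of \<open>Y\<close> and \<open>Y2\<close> on which \<open>Be\<close>
  vanishes takes equal values at the reflections \<open>i0\<close> and \<open>i0 + M\<close>, which
  separate the two classes.\<close>

lemma tau_Y2: "tau Y2 = - t"
proof -
  let ?f = "\<lambda>x. t * Y2 x - tau Y2 * Y x"
  have F: "?f \<in> Fun" by (intro Fun_diff Fun_cmult Y_Fun Y2_Fun)
  have "Be ?f = 0" using Be_prop[OF Y2_Fun2] by (simp add: al_linear)
  then have "?f (True, i0 + M) = ?f (True, i0)" using Al_Be_zero(2)[OF Fun_per[OF F]] by blast
  then show ?thesis by (simp add: Y_val)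
qed

lemma U_Fun: "U \<in> Fun" and zinv_U: "zinv M U"
proof -
  have U: "U = (\<lambda>x. Y x + Y2 x + c * one x)" by (simp add: U_def fun_eq_iff)
  show F: "U \<in> Fun" unfolding U by (intro Fun_add Fun_cmult Y_Fun Y2_Fun one_Fun)
  have "of_int t * Be U = 0"
    using Be_prop[OF Y2_Fun2] unfolding U by (simp add: al_linear be_one ring_distribs tau_Y2)
  then have "Be U = 0" using t_ne by simp
  moreover have "Al U = 0"
    unfolding U by (simp add: al_linear al_one Fun2_Al Y_Fun2 Y2_Fun2 Y_val c_def)
  ultimately show "zinv M U" using zinv_Al_Be[OF Fun_per[OF F]] by simp
qed

lemma t_odd: "odd t"
proof
  assume "even t"
  then obtain b where "t = 2 * b" by blast
  then have "Be Y * cnj (Be Y) = 4 * of_int (b * b)" using Be_tau[OF Y_Fun2 Y_Fun2] by (simp add: tau_Y)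
  from Be_no_4[OF Y_Fun this, of i0] show False by (simp add: Y_val)
qed

text \<open>In the faithful representation \<open>Y\<close> has diagonal 0 and squares to the scalar
  \<open>t * t\<close>; \<open>G\<close> is the part of the square that lies in the kernel, hence is
  invariant under all of \<open>L\<close>.\<close>

definition "G x = conv N Y Y x - t * t * one x"

lemma G_Fun: "G \<in> Fun" and zinv_G: "zinv M G"
proof -
  have G: "G = (\<lambda>x. conv N Y Y x - t * t * one x)" by (simp add: G_def fun_eq_iff)
  show F: "G \<in> Fun" unfolding G by (intro Fun_diff Fun_cmult Fun_conv Y_Fun one_Fun)
  have "Al Y = 0" by (simp add: Fun2_Al[OF Y_Fun2] Y_val)
  then have "Al G = 0" "Be G = 0"
    using Be_tau[OF Y_Fun2 Y_Fun2]
    unfolding G by (simp_all add: al_linear al_one be_one Al_conv Be_conv Y_Fun tau_Y)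
  then show "zinv M G" using zinv_Al_Be[OF Fun_per[OF F]] by simp
qed

definition "k = tot N Y"
definition "v = tot N (ind L)"
definition "rho = conv N Y (ind L) (True, i0)"

lemma L_Fun: "ind L \<in> Fun"
  using ind_L_Fun1 by (rule Fun1_Fun)

lemma rho: "Y x = 1 \<or> Y2 x = 1 \<Longrightarrow> conv N Y (ind L) x = rho"
proof -
  let ?f = "conv N Y (ind L)"
  have z: "zinv M ?f" using zinv_ind_L by (rule zinv_conv)
  have f: "?f \<in> Fun1" using z by (intro zinv_Fun1 Fun_conv Y_Fun L_Fun)
  have 1: "?f (True, i0 + M) = rho" using z by (simp add: zinv_iff rho_def)
  assume "Y x = 1 \<or> Y2 x = 1"
  then have "E2 (True, i0) x \<or> E2 (True, i0 + M) x" by (simp add: Y_def Y2_def)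
  then have "?f x = ?f (True, i0) \<or> ?f x = ?f (True, i0 + M)"
    using Fun1_E1[OF f] E2_E1 by metis
  then show "?f x = rho" using 1 by (auto simp: rho_def)
qed

text \<open>Both sides of \<open>tot_conv_sub\<close> for \<open>L\<close>: on one side every point
  of \<open>Y\<close> contributes \<open>rho\<close>, on the other the square of \<open>Y\<close> is
  constant on \<open>L\<close> up to the term \<open>t * t\<close> at the identity.\<close>

lemma count: "rho * k = t * t + (k - t * t) * v"
proof -
  have "tot N (\<lambda>x. ind L x * conv N Y Y x) = tot N (\<lambda>y. Y y * conv N Y (ind L) (pinv y))"
    by (rule tot_conv_sub[OF Y_Fun L_Fun])
  also have "\<dots> = tot N (\<lambda>y. rho * Y y)"
  proof (rule tot_cong)
    fix y
    show "Y y * conv N Y (ind L) (pinv y) = rho * Y y"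
      using rho[of "pinv y"] Fun_pinv[OF Y_Fun, of y] by (cases "Y y = 1") (auto simp: Y_def ind_def)
  qed
  also have "\<dots> = rho * k" by (simp add: tot_cmult k_def)
  finally have 1: "tot N (\<lambda>x. ind L x * conv N Y Y x) = rho * k" .
  have "ind L x * conv N Y Y x = t * t * one x + (k - t * t) * ind L x" for x
  proof (cases "L x")
    case True
    have "G x = G (False, 0)" using zinv_L[OF G_Fun zinv_G True, of "(False, 0)"] by (cases x) simp
    also have "\<dots> = k - t * t" using conv_at_one[OF Y_Fun] by (simp add: G_def one_simps Y_01 k_def)
    finally show ?thesis using True by (simp add: G_def)
  next
    case False
    then have "one x = 0" using L_one by (cases x) (auto simp: one_def)
    then show ?thesis using False by simp
  qed
  then have "tot N (\<lambda>x. ind L x * conv N Y Y x) = t * t + (k - t * t) * v"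
    by (simp add: tot_add tot_cmult tot_one v_def)
  then show ?thesis using 1 by simp
qed

text \<open>Unless \<open>L\<close> itself is \<open>U\<close>, the \<open>L\<close>-cosets in \<open>U\<close> form a subset of a
  cyclic 2-group whose square is trivial modulo 4.\<close>

lemma U_rotations:
  assumes c0: "c = 0"
    and r: "r \<le> m" "\<And>i. L (False, i) \<longleftrightarrow> 2 ^ r dvd i" "\<And>i. L (True, i) \<longleftrightarrow> 2 ^ r dvd i - g0"
    and u1: "U (False, x) = 1"
  shows "2 ^ r dvd 2 * x" "\<not> 2 ^ r dvd x"
proof -
  define h :: int where "h = 2 ^ r"
  define l :: int where "l = 2 ^ (Suc m - r)"
  have h: "h > 0" "l > 0" "N = h * l" "h dvd M"
    using r(1) by (simp_all add: h_def l_def N_def M_def power_add[symmetric] le_imp_power_dvd)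
  define u where "u i = U (False, i)" for i
  define a where "a i = Y (False, i)" for i
  define b where "b i = Y (True, g0 + i)" for i
  have UT: "U (True, i) = u (i - g0)" for i
    using zinv_L[OF U_Fun zinv_U L_g0, of "(True, i)"] by (simp add: u_def)
  have u01: "u i = 0 \<or> u i = 1" for i
  proof -
    have "\<not> (E2 (True, i0) y \<and> E2 (True, i0 + M) y)" for y using split E2_sym E2_trans by blast
    then show ?thesis by (auto simp: u_def U_def c0 Y_def Y2_def ind_def)
  qed
  have per_u: "periodic h u"
    unfolding periodic_def u_def
    using zinv_L[OF U_Fun zinv_U, of "(False, h)" "(False, _)"] r(2)[of h] by (simp add: h_def)
  have u0: "u 0 = 0" by (simp add: u_def U_def Y_val c0)
  have u_neg: "u (- i) = u i" for i using Fun_pinv[OF U_Fun, of "(False, i)"] by (simp add: u_def)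
  have a_neg: "a (- i) = a i" for i using Fun_pinv[OF Y_Fun, of "(False, i)"] by (simp add: a_def)
  have per_a: "periodic N a" unfolding a_def by (intro perD Fun_per Y_Fun)
  have per_b: "periodic N b"
    unfolding b_def using per_shift(2)[OF perD[OF Fun_per[OF Y_Fun], of True], of g0] by simp
  have ab_nonneg: "0 \<le> a i" "0 \<le> b i" for i by (simp_all add: a_def b_def Y_01)
  have a_le: "a i \<le> u i" and b_le: "b i \<le> u i" for i
    using Y_01(3)[of "(False, i)"] Y_01(3)[of "(True, g0 + i)"] UT[of "g0 + i"]
    by (simp_all add: a_def b_def u_def U_def c0)
  \<comment> \<open>Rotations and reflections are matched along the reflection \<open>g0\<close> in
    \<open>L\<close>. Taking differences eliminates the \<open>L\<close>-invariant part
    \<open>G\<close> of the square of \<open>Y\<close> and leaves only the scalar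
    \<open>t * t\<close>.\<close>
  define e where "e i = a i - b i" for i
  have per_e: "periodic N e" using per_a per_b by (simp add: periodic_def e_def)
  define D where "D i j = (if h dvd j - i then 1 else 0 :: int)" for i j
  define al where "al i = S N (\<lambda>j. D i j * a j)" for i
  define be where "be i = S N (\<lambda>j. D i j * b j)" for i
  \<comment> \<open>Sums over the cosets of the rotations in \<open>L\<close>: functions on the
    cyclic quotient of order \<open>h\<close>.\<close>
  define et where "et i = S N (\<lambda>j. D i j * e j)" for i
  have et_diff: "et i = al i - be i" for i
    by (simp add: et_def al_def be_def e_def right_diff_distrib S_diff)
  have rho_u: "al i + be i = rho" if "u i = 1" for i
  proof -
    have "conv N Y (ind L) (False, i) = S N (\<lambda>j. D i j * a j) + S N (\<lambda>j. ind L (True, j - i) * Y (True, j))"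
    proof -
      have "h dvd i - j \<longleftrightarrow> h dvd j - i" for j by (metis dvd_minus_iff minus_diff_eq)
      then show ?thesis unfolding conv_False a_def D_def ind_def r(2) h_def[symmetric] by (simp add: mult.commute)
    qed
    also have "S N (\<lambda>j. ind L (True, j - i) * Y (True, j)) = S N (\<lambda>j. ind L (True, (j + g0) - i) * Y (True, j + g0))"
    proof (rule S_shift[OF N_pos, symmetric])
      show "periodic N (\<lambda>j. ind L (True, j - i) * Y (True, j))"
        using per_shift(3)[OF perD[OF Fun_per[OF L_Fun], of True], of i] perD[OF Fun_per[OF Y_Fun], of True]
        by (simp add: periodic_def)
    qed
    also have "\<dots> = be i"
      unfolding be_def D_def b_def ind_def r(3) h_def[symmetric] by (rule S_cong) (simp add: algebra_simps)
    finally have "conv N Y (ind L) (False, i) = al i + be i" by (simp add: al_def)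
    moreover have "Y (False, i) = 1 \<or> Y2 (False, i) = 1"
      using that by (auto simp: u_def U_def c0 Y_def Y2_def ind_def split: if_splits)
    ultimately show ?thesis using rho by simp
  qed
  have et0: "et i = 0" if "u i = 0" for i
  proof -
    have "D i j * e j = 0" for j
    proof (cases "h dvd j - i")
      case True
      then have "u j = 0" using periodic_cong[OF per_u True] that by simp
      then have "a j = 0" "b j = 0" using a_le[of j] b_le[of j] ab_nonneg[of j] by simp_all
      then show ?thesis by (simp add: e_def)
    qed (simp add: D_def)
    then show ?thesis unfolding et_def S_def by (intro sum.neutral) blast
  qed
  have al_even: "even (al i)" for i
    unfolding al_def a_def
  proof (rule even_S_periodic)
    have 1: "D i (j + M) = D i j" for j
    proof -
      obtain q where "M = h * q" using h(4) by blast
      then have "h dvd j + M - i \<longleftrightarrow> h dvd j - i" for j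
        using dvd_add_left_iff[of h M "j - i"] by (simp add: algebra_simps)
      then show ?thesis by (simp add: D_def)
    qed
    have 2: "Y (False, j + M) = Y (False, j)" for j
    proof (cases "M dvd j")
      case False
      then show ?thesis using Y_Fun2 by (simp add: Fun2_def)
    next
      case True
      have z: "Y (False, j) = 0" if "M dvd j" for j
        using that
      proof (cases rule: M_dvd_cases)
        case 1
        then show ?thesis using periodic_cong[OF per_a, of j 0] Y_val by (simp add: a_def)
      next
        case 2
        then show ?thesis using periodic_cong[OF per_a, of j M] Y_val by (simp add: a_def)
      qed
      show ?thesis using z[of j] z[of "j + M"] True by simp
    qed
    show "periodic M (\<lambda>j. D i j * Y (False, j))" by (simp add: periodic_def 1 2)
  qed
  have et_u: "et i = (2 * al i - rho) * u i" for i
    using u01[of i] et0[of i] rho_u[of i] by (auto simp: et_diff)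
  have D_neg: "D (- i) (- j) = D i j" for i j
  proof -
    have "- j - - i = - (j - i)" by simp
    then show ?thesis unfolding D_def by (simp only: dvd_minus_iff)
  qed
  have al_neg: "al (- i) = al i" for i
  proof -
    have "al i = S N (\<lambda>j. D (- i) (0 - j) * a (0 - j))"
      unfolding al_def using D_neg a_neg by (simp add: D_neg)
    also have "\<dots> = al (- i)"
      unfolding al_def
    proof (rule S_reflect[OF N_pos])
      have "h dvd N" by (simp add: h(3))
      then have "h dvd j + N - - i \<longleftrightarrow> h dvd j - - i" for j
        using dvd_add_left_iff[of h N "j - - i"] by (simp add: algebra_simps)
      then show "periodic N (\<lambda>j. D (- i) j * a j)" using per_a by (simp add: periodic_def D_def)
    qed
    finally show ?thesis by simp
  qed
  have et_neg: "et (- i) = et i" for i by (simp add: et_u al_neg u_neg)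
  have per_et: "periodic h et"
    unfolding periodic_def et_def D_def
  proof (intro allI S_cong)
    fix i j
    have "j - (i + h) = (j - i) - h" by simp
    then have "h dvd j - (i + h) \<longleftrightarrow> h dvd j - i" using dvd_diff_left_iff[of h h "j - i"] by (simp add: algebra_simps)
    then show "(if h dvd j - (i + h) then 1 else 0) * e j = (if h dvd j - i then 1 else 0) * e j" by simp
  qed
  have conv_diff: "S N (\<lambda>i. a i * e (k - i)) - S N (\<lambda>i. b i * e (i - k)) = t * t * (if N dvd k then 1 else 0)" for k
  proof -
    have perY: "periodic N (\<lambda>i. Y (p, i))" for p by (intro perD Fun_per Y_Fun)
    have "G (True, k + g0) = G (False, k)" using zinv_L[OF G_Fun zinv_G L_g0, of "(False, k)"] by simp
    then have "conv N Y Y (False, k) - conv N Y Y (True, k + g0) = t * t * (if N dvd k then 1 else 0)"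
      by (simp add: G_def one_simps)
    moreover have "conv N Y Y (False, k) = S N (\<lambda>i. a i * a (k - i)) + S N (\<lambda>i. b i * b (i - k))"
    proof -
      have "periodic N (\<lambda>i. Y (True, i) * Y (True, i - k))"
        using perY per_shift(3)[OF perY, of True k] by (simp add: periodic_def)
      from S_shift[OF N_pos this, of g0] show ?thesis
        by (simp add: conv_False a_def b_def add.commute[of g0] add_diff_eq)
    qed
    moreover have "conv N Y Y (True, k + g0) = S N (\<lambda>i. a i * b (k - i)) + S N (\<lambda>i. b i * a (i - k))"
    proof -
      have "periodic N (\<lambda>i. Y (True, i) * Y (False, i - (k + g0)))"
        using perY per_shift(3)[OF perY, of False "k + g0"] by (simp add: periodic_def)
      from S_shift[OF N_pos this, of g0]
      have "conv N Y Y (True, k + g0) = S N (\<lambda>i. Y (False, i) * Y (True, k + g0 - i)) +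
          S N (\<lambda>i. Y (True, i + g0) * Y (False, i + g0 - (k + g0)))"
        by (simp only: conv_True)
      moreover have "Y (False, i) * Y (True, k + g0 - i) = a i * b (k - i)"
        "Y (True, i + g0) * Y (False, i + g0 - (k + g0)) = b i * a (i - k)" for i
        by (simp_all add: a_def b_def add_diff_eq add.commute)
      ultimately show ?thesis by simp
    qed
    ultimately show ?thesis by (simp add: e_def right_diff_distrib S_diff)
  qed
  have key1: "S N (\<lambda>i. a i * et (k - i)) - S N (\<lambda>i. b i * et (i - k)) = t * t * (if h dvd k then 1 else 0)" for k
  proof -
    have D_per: "D i (j + N) = D i j" "D i (i' - (j + N)) = D i (i' - j)" for i i' j
    proof -
      have "h dvd N" by (simp add: h(3))
      then show "D i (j + N) = D i j" "D i (i' - (j + N)) = D i (i' - j)"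
        using dvd_add_left_iff[of h N "j - i"] dvd_diff_left_iff[of h N "i' - j - i"]
        by (simp_all add: D_def algebra_simps)
    qed
    have 1: "S N (\<lambda>j. D k j * e (j - i)) = et (k - i)" for i
    proof -
      have "periodic N (\<lambda>j. D k j * e (j - i))"
        using per_shift(3)[OF per_e, of i] by (simp add: periodic_def D_per)
      from S_shift[OF N_pos this, of i] show ?thesis
        unfolding et_def D_def by (simp add: algebra_simps)
    qed
    have 2: "S N (\<lambda>j. D k j * e (i - j)) = et (i - k)" for i
    proof -
      have "periodic N (\<lambda>j. D k (i - j) * e j)"
        using per_e D_per(2)[of k i] by (simp add: periodic_def)
      from S_reflect[OF N_pos this, of i]
      have "S N (\<lambda>j. D k j * e (i - j)) = S N (\<lambda>j. D k (i - j) * e j)" by simp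
      moreover have "D k (i - j) = D (i - k) j" for j
      proof -
        have "i - j - k = - (j - (i - k))" by simp
        then show ?thesis unfolding D_def by (simp only: dvd_minus_iff)
      qed
      ultimately show ?thesis by (simp add: et_def)
    qed
    have swap: "S N (\<lambda>j. D k j * S N (\<lambda>i. p i * q i j)) = S N (\<lambda>i. p i * S N (\<lambda>j. D k j * q i j))" for p q
      unfolding S_cmult[symmetric] by (subst S_swap) (simp add: mult_ac)
    have "S N (\<lambda>i. a i * et (k - i)) - S N (\<lambda>i. b i * et (i - k)) =
        S N (\<lambda>j. D k j * (S N (\<lambda>i. a i * e (j - i)) - S N (\<lambda>i. b i * e (i - j))))"
      unfolding right_diff_distrib S_diff swap 1 2 ..
    also have "\<dots> = S N (\<lambda>j. (if N dvd j - 0 then 1 else 0) * (t * t * D k j))"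
      unfolding conv_diff by (rule S_cong) simp
    also have "\<dots> = t * t * D k 0"
      by (rule S_delta[OF N_pos]) (simp add: periodic_def D_per)
    finally show ?thesis by (simp add: D_def)
  qed
  have key2: "S h (\<lambda>i. et i * et (k - i)) = t * t * (if h dvd k then 1 else 0)" for k
  proof -
    have "et (i - k) = et (k - i)" for i using et_neg[of "k - i"] by simp
    then have "S N (\<lambda>i. e i * et (k - i)) = t * t * (if h dvd k then 1 else 0)"
      using key1[of k] by (simp add: e_def left_diff_distrib S_diff)
    moreover have "S N (\<lambda>i. e i * et (k - i)) = S h (\<lambda>i. et i * et (k - i))"
      using S_coset_product[OF h(1,2) per_e[unfolded h(3)] per_shift(4)[OF per_et, of k]]
      by (simp add: et_def D_def h(3)[symmetric])
    ultimately show ?thesis by simp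
  qed
  have "et = (\<lambda>i. S N (\<lambda>j. D i j * e j))" by (simp add: et_def fun_eq_iff)
  then have "S h et = S N e"
    using S_coset_product[OF h(1,2) per_e[unfolded h(3)], of "\<lambda>_. 1"]
    by (simp add: D_def h(3)[symmetric] periodic_def)
  also have "\<dots> = t"
    unfolding e_def S_diff a_def b_def t_def th_def
    using S_shift[OF N_pos perD[OF Fun_per[OF Y_Fun], of True], of g0] by (simp add: add.commute[of g0])
  finally have sum_et: "S h et = t" .
  have "odd rho"
  proof
    assume "even rho"
    then have "even (et i)" for i by (simp add: et_u)
    then have "even (S h et)" by (rule even_S)
    then show False using sum_et t_odd by simp
  qed
  have sq1: "4 dvd s * s - 1" if "odd s" for s :: int
  proof -
    obtain q where "s = 2 * q + 1" using \<open>odd s\<close> by (elim oddE)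
    then have "s * s - 1 = 4 * (q * q + q)" by (simp add: algebra_simps)
    then show ?thesis by simp
  qed
  \<comment> \<open>\<open>al\<close> is even, so \<open>et\<close> agrees with
    \<open>- rho * u\<close> modulo 4. Since odd squares are 1 modulo 4, the square of
    \<open>u\<close> inherits the equation \<open>key2\<close>.\<close>
  have sq: "4 dvd S h (\<lambda>i. u i * u (k - i)) - (if h dvd k then 1 else 0)" for k
  proof -
    have "4 dvd et i * et (k - i) - u i * u (k - i)" for i
    proof -
      obtain p q where pq: "al i = 2 * p" "al (k - i) = 2 * q" using al_even by (metis dvdE)
      have "et i * et (k - i) - u i * u (k - i) =
          (4 * (4 * p * q - p * rho - q * rho) + (rho * rho - 1)) * (u i * u (k - i))"
        by (simp add: et_u pq algebra_simps)
      moreover have "4 dvd 4 * (4 * p * q - p * rho - q * rho) + (rho * rho - 1)"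
        using sq1[OF \<open>odd rho\<close>] by (intro dvd_add) simp_all
      ultimately show ?thesis by (simp only: dvd_mult2)
    qed
    then have "4 dvd S h (\<lambda>i. et i * et (k - i) - u i * u (k - i))"
      unfolding S_def by (intro dvd_sum) simp
    then have "4 dvd t * t * (if h dvd k then 1 else 0) - S h (\<lambda>i. u i * u (k - i))"
      by (simp only: S_diff key2)
    from dvd_diff[OF dvd_mult2[OF sq1[OF t_odd], of "if h dvd k then 1 else 0"] this]
    show ?thesis by (simp add: left_diff_distrib)
  qed
  show "2 ^ r dvd 2 * x"
  proof (rule square_mod_4[OF per_u[unfolded h_def] u01 u0])
    show "4 dvd S (2 ^ r) (\<lambda>i. u i * u (k - i)) - (if 2 ^ r dvd k then 1 else 0)" for k
      using sq[of k] by (simp only: h_def)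
    show "u x = 1" using u1 by (simp add: u_def)
  qed
  show "\<not> 2 ^ r dvd x"
    using periodic_cong[OF per_u, of x 0] u0 u1 by (auto simp: h_def u_def)
qed

text \<open>Either \<open>Y2\<close> contains the central involution and both classes lie in
  \<open>L\<close>, or by \<open>U_rotations\<close> every point of them, read modulo
  \<open>L\<close>, is the unique involution of the cyclic quotient.\<close>

lemma L_coset: assumes "Y y = 1 \<or> Y2 y = 1" shows "L (pm (pinv y) (True, i0))"
proof (cases "c = 0")
  case False
  then have z: "E2 (True, i0 + M) (False, M)" by (auto simp: c_def Y2_def)
  have 1: "E1 (False, M) (True, i0 + M)" using E2_E1[OF E2_sym[OF z]] .
  then have 2: "E1 (False, M) (True, i0)" using E1_trans E1_sym[OF E1_split[of True i0]] by blast
  have "E1 (True, i0) y \<or> E1 (True, i0 + M) y" using assms E2_E1[of _ y] unfolding Y_def Y2_def ind_simps(5) by metis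
  then have "L y" unfolding L_def using 1 2 E1_trans by blast
  moreover have "L (True, i0)" using 2 by (simp add: L_def)
  ultimately show ?thesis using L_pm L_pinv by blast
next
  case True
  obtain r where r: "r \<le> m" "\<And>i. L (False, i) \<longleftrightarrow> 2 ^ r dvd i" "\<And>i. L (True, i) \<longleftrightarrow> 2 ^ r dvd i - g0"
    using L_rotations by blast
  note rot = U_rotations[OF True r]
  have UT: "U (True, i) = U (False, i - g0)" for i
    using zinv_L[OF U_Fun zinv_U L_g0, of "(True, i)"] by simp
  have U1: "U z = 1" if "Y z = 1 \<or> Y2 z = 1" for z
  proof -
    have "\<not> (E2 (True, i0) z \<and> E2 (True, i0 + M) z)" using split E2_sym E2_trans by blast
    then show ?thesis using that by (auto simp: U_def True Y_def Y2_def)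
  qed
  have i0: "2 ^ r dvd 2 * (i0 - g0)" "\<not> 2 ^ r dvd i0 - g0"
    using rot[of "i0 - g0"] UT[of i0] U1[of "(True, i0)"] Y_val(1) by simp_all
  obtain p j where y: "y = (p, j)" by fastforce
  show ?thesis
  proof (cases p)
    case True
    then have "2 ^ r dvd 2 * (j - g0)" "\<not> 2 ^ r dvd j - g0"
      using rot[of "j - g0"] UT[of j] U1[OF assms] y by simp_all
    from dvd_half_diff[OF this(1) i0(1) this(2) i0(2)] show ?thesis
      using True by (simp add: y r(2))
  next
    case False
    then have "2 ^ r dvd 2 * j" "\<not> 2 ^ r dvd j" using rot[of j] U1[OF assms] y by simp_all
    from dvd_half_diff[OF i0(1) this(1) i0(2) this(2)] show ?thesis
      using False by (simp add: y r(3) algebra_simps)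
  qed
qed

text \<open>All of \<open>Y\<close> lies in one coset of \<open>L\<close>, so \<open>rho = k\<close>
  and \<open>count\<close> becomes the parameter equation of a difference set of odd order
  \<open>t ^ 2\<close>. Since \<open>Y2\<close> lies in the same coset, the solution
  \<open>v - 1\<close> makes \<open>Y2\<close> a single point.\<close>

lemma singleton: "\<exists>i1. \<forall>x. E (True, i1) x \<longrightarrow> fst x \<and> N dvd snd x - i1"
proof -
  define lam where "lam y = ind L (pm (pinv y) (True, i0))" for y
  have lam: "lam y = ind L (pm (pinv (True, i0)) y)" for y
    using Fun_pinv[OF L_Fun, of "pm (pinv y) (True, i0)"] by (simp only: lam_def pinv_pm pinv_pinv)
  have tot_lam: "tot N lam = v"
    unfolding lam v_def by (rule tot_pm_left[OF N_pos Fun_per[OF L_Fun]])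
  have "rho = k"
    unfolding rho_def conv_def k_def
  proof (rule tot_cong)
    fix y show "Y y * ind L (pm (pinv y) (True, i0)) = Y y"
      using L_coset[of y] by (cases "Y y = 1") (auto simp: Y_def ind_def)
  qed
  then have eq: "k * (v - k) = t ^ 2 * (v - 1)"
    using count by (simp add: algebra_simps power2_eq_square)
  have le: "k + tot N Y2 \<le> v"
  proof -
    have "0 \<le> lam x - (Y x + Y2 x)" for x
    proof -
      have "\<not> (E2 (True, i0) x \<and> E2 (True, i0 + M) x)" using split E2_sym E2_trans by blast
      then show ?thesis using L_coset[of x] by (auto simp: lam_def Y_def Y2_def ind_def)
    qed
    then have "0 \<le> tot N (\<lambda>x. lam x - (Y x + Y2 x))" by (simp add: tot_def S_nonneg)
    then show ?thesis by (simp add: tot_diff tot_add tot_lam k_def)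
  qed
  have k: "0 < k" "0 < tot N Y2"
  proof -
    have "tot N Y \<noteq> 0" "tot N Y2 \<noteq> 0"
      using tot_zero_iff[OF N_pos Fun_per[OF Y_Fun] Y_01(2)] Y_val(1)
        tot_zero_iff[OF N_pos Fun_per[OF Y2_Fun] Y_01(3)] Y_val(6) by (metis zero_neq_one)+
    then show "0 < k" "0 < tot N Y2"
      using tot_ind_nonneg[of "E2 (True, i0)"] tot_ind_nonneg[of "E2 (True, i0 + M)"]
      by (simp_all add: k_def Y_def Y2_def)
  qed
  obtain s where "v = 2 ^ s" unfolding v_def using tot_ind_L by blast
  then have "k = 1 \<or> k = v - 1"
    using odd_order_trivial[of k s t] eq t_odd k le by simp
  then have "tot N Y = 1 \<or> tot N Y2 = 1" using le k by (auto simp: k_def)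
  then show ?thesis
  proof
    assume "tot N Y = 1"
    from tot_ind_one[OF Fun_per[OF Y_Fun, unfolded Y_def] this[unfolded Y_def] E2_refl] show ?thesis
      using E_E2 by blast
  next
    assume "tot N Y2 = 1"
    from tot_ind_one[OF Fun_per[OF Y2_Fun, unfolded Y2_def] this[unfolded Y2_def] E2_refl] show ?thesis
      using E_E2 by blast
  qed
qed

end

theorem (in linked_sring) symmetric: "\<exists>g. \<forall>i. E (True, g + i) (True, g - i)"
proof (cases "\<forall>f\<in>Fun. Be f = 0 \<and> Al f = of_int (th f)")
  case True
  then show ?thesis using sym_no_split by blast
next
  case False
  then obtain h where h: "h \<in> Fun2" "Be h \<noteq> 0" using exists_rational_split by blast
  then obtain i where "h (True, i + M) \<noteq> h (True, i)"
    using Al_Be_zero(2)[OF Fun_per[OF Fun2_Fun[OF h(1)]]] by blast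
  then have i: "\<not> E2 (True, i) (True, i + M)" using h(1) unfolding E2_def by metis
  \<comment> \<open>If the chosen reflection is in the class of the central involution, its
    translate by \<open>M\<close> is not, and is split as well.\<close>
  have "\<exists>i0. \<not> E2 (True, i0) (True, i0 + M) \<and> \<not> E2 (True, i0) (False, M)"
  proof (cases "E2 (True, i) (False, M)")
    case True
    have "E (True, i) (True, i + M + M)" using E_per[of True i] by (simp add: N_M add.assoc)
    then have "E2 (True, i) (True, i + M + M)" by (rule E_E2)
    then have "\<not> E2 (True, i + M) (True, i + M + M)" "\<not> E2 (True, i + M) (False, M)"
      using i True E2_sym E2_trans by blast+
    then show ?thesis by blast
  qed (use i in blast)
  then obtain i0 where i0: "\<not> E2 (True, i0) (True, i0 + M)" "\<not> E2 (True, i0) (False, M)" by blast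
  interpret linked_sring_split m N M E g0 i0 by unfold_locales (use i0 in auto)
  obtain i1 where "\<And>x. E (True, i1) x \<Longrightarrow> fst x \<and> N dvd snd x - i1" using singleton by blast
  from singleton_sym[OF this] show ?thesis by blast
qed

section \<open>The basic set of the central involution\<close>

text \<open>The reflection of \<open>j\<close> to \<open>- 1 - j\<close> has no fixed point modulo
  an even number; it exchanges the two halves of the period.\<close>

lemma even_S_reflect:
  fixes u :: "int \<Rightarrow> int"
  assumes "l > 0" "periodic (2 * l) u" "\<And>j. u (- 1 - j) = u j"
  shows "even (S (2 * l) u)"
proof -
  have "u (j + l) = u (l - 1 - j)" for j
  proof -
    have "u (l - 1 - j) = u (- 1 - (l - 1 - j))" by (rule assms(3)[symmetric])
    also have "\<dots> = u (- 1 - (l - 1 - j) + 2 * l)" using assms(2) by (simp only: periodic_def)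
    also have "- 1 - (l - 1 - j) + 2 * l = j + l" by simp
    finally show ?thesis by simp
  qed
  then have "S l (\<lambda>j. u (j + l)) = (\<Sum>j\<in>{0..<l}. u (l - 1 - j))"
    by (simp add: S_def)
  also have "\<dots> = S l u"
    unfolding S_def by (rule sum.reindex_bij_witness[of _ "\<lambda>j. l - 1 - j" "\<lambda>j. l - 1 - j"]) auto
  finally show ?thesis unfolding S_double[OF assms(1)] S_add by simp
qed

context symmetric_sring
begin

text \<open>The factors are the transforms of \<open>f\<close> and of \<open>f\<close> minus
  \<open>p\<close> times the identity. In the second alternative of \<open>hat_mult_4\<close>, the
  position 0 forces \<open>p\<close> to be even, which leads back to the first.\<close>

lemma quadratic_no_split:
  assumes "f \<in> Fun" "f (False, 0) = 0" "f (False, M) = 0"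
    and "Al f * (Al f - of_int p) = 4 * of_int c"
  shows "even (f (False, i) - f (False, i + M))"
proof -
  let ?u = "\<lambda>i. f (False, i)" and ?v = "\<lambda>i. f (False, i) - p * one (False, i)"
  have per: "periodic N ?u" using assms(1) by (intro perD Fun_per)
  have per1: "periodic N (\<lambda>i. one (False, i))" by (intro perD Fun_per one_Fun)
  then have pv: "periodic N ?v" using per by (simp add: periodic_def)
  have hv: "hat N 1 ?v = Al f - of_int p"
    using al_one[of 1] by (simp add: hat_diff hat_cmult al_def)
  have "hat N 1 ?u * hat N 1 ?v = 4 * ev (zt m) [:c:]"
    using assms(4) unfolding hv by (simp add: al_def)
  from hat_mult_4[of m, folded N_def M_def, OF per pv this] show ?thesis
  proof
    assume e: "\<forall>i. even (?v i - ?v (i + M))"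
    have "\<not> N dvd M" using N_M M_pos zdvd_imp_le[of N M] by auto
    then have one_M: "one (False, M) = 0" "one (False, 0) = 1" by (simp_all add: one_simps)
    have "even p" using e[rule_format, of 0] assms(2,3) one_M by simp
    moreover have "f (False, i) - f (False, i + M) = (?v i - ?v (i + M)) + p * (one (False, i) - one (False, i + M))"
      by (simp add: algebra_simps)
    ultimately show ?thesis using e by simp
  qed simp
qed

lemma Al_int_zero:
  assumes "f \<in> Fun" "f (False, 0) = f (False, M)" "Al f = of_int k"
  shows "Al f = 0"
  using Al_int(1)[OF Fun_per[OF assms(1)] assms(3)] assms(2,3) by simp

end

locale central_subgroup_sring = symmetric_sring +
  fixes r :: nat
  assumes r_le: "r \<le> m"
    and H_class: "2 ^ r dvd i \<Longrightarrow> \<not> N dvd i \<Longrightarrow> E (False, M) (p, j) \<longleftrightarrow> E (False, i) (p, j)"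
    and H_closed: "E (False, M) (p, j) \<Longrightarrow> \<not> p \<and> 2 ^ r dvd j"
begin

text \<open>\<open>h\<close> is the exponent of a generator of \<open>H\<close> and its index in the
  cyclic group; \<open>l\<close> is the order of \<open>H\<close>.\<close>

definition "h = (2 :: int) ^ r"
definition "l = (2 :: int) ^ (Suc m - r)"
definition "Hp x \<longleftrightarrow> \<not> fst x \<and> h dvd snd x"

lemma hl: "h > 0" "l > 0" "N = h * l" "h dvd M" "even l" "l = 2 * 2 ^ (m - r)" "h dvd N"
proof -
  have "Suc m - r = Suc (m - r)" using r_le by simp
  then show "l = 2 * 2 ^ (m - r)" "even l" by (simp_all add: l_def)
  show "h > 0" "l > 0" "N = h * l" "h dvd M" "h dvd N"
    using r_le by (simp_all add: h_def l_def N_def M_def power_add[symmetric] le_imp_power_dvd)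
qed

lemma Hp_cases: "Hp x \<Longrightarrow> E (False, M) x \<or> \<not> fst x \<and> N dvd snd x"
  using H_class[of "snd x" "fst x" "snd x"] E_refl by (cases x) (auto simp: Hp_def h_def)

lemma Hp_E: assumes "E x y" "Hp x" shows "Hp y"
proof (cases "E (False, M) x")
  case True
  then have "E (False, M) y" using assms(1) E_trans by blast
  then show ?thesis using H_closed[of "fst y" "snd y"] by (simp add: Hp_def h_def)
next
  case False
  then show ?thesis using Hp_cases[OF assms(2)] E_one'[OF assms(1)] hl(7) dvd_trans by (auto simp: Hp_def)
qed

lemma H_Fun: "ind Hp \<in> Fun"
  using Hp_E by (rule ind_Fun)

lemma Hp_M: "Hp (False, i + M) \<longleftrightarrow> Hp (False, i)" "Hp (False, M)" "Hp (False, 0)"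
  using hl(4) dvd_add_left_iff[of h M i] by (simp_all add: Hp_def)

lemma zinv_H: "zinv M (ind Hp)"
  using dvd_add_left_iff[OF hl(4)] by (simp add: zinv_iff Hp_def ind_def)

lemma conv_H: "conv N f (ind Hp) (p, i) = S l (\<lambda>j. f (p, i + h * j))" if "per N f"
proof -
  have "conv N f (ind Hp) (p, i) = S N (\<lambda>j. (if h dvd j - i then 1 else 0) * f (p, j))"
  proof -
    have "h dvd i - j \<longleftrightarrow> h dvd j - i" for j by (metis dvd_minus_iff minus_diff_eq)
    then show ?thesis
      by (cases p) (simp_all add: conv_False conv_True Hp_def ind_def S_def[of N "\<lambda>i. 0"] mult.commute)
  qed
  then show ?thesis using S_dvd_coset[OF hl(1,2) perD[OF that, unfolded hl(3)], of i p] by (simp add: hl(3))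
qed

lemma tot_H: "tot N (ind Hp) = l"
proof -
  have "S N (\<lambda>j. (if h dvd j - 0 then 1 else 0) * (1 :: int)) = S l (\<lambda>j. 1)"
    unfolding hl(3) by (rule S_dvd_coset[OF hl(1,2)]) (simp add: periodic_def)
  then show ?thesis using hl(2) by (simp add: tot_def ind_def Hp_def S_def)
qed

text \<open>A basic set invariant under the involution is invariant under all of \<open>H\<close>, because all
  nontrivial elements of \<open>H\<close> are in the same basic set.\<close>

lemma unsplit_H_inv:
  assumes "zinv M (ind (E y))" "Hp g"
  shows "E y (pm y g)"
proof -
  let ?W = "ind (E y)"
  have W: "?W \<in> Fun" by (rule class_Fun)
  obtain j where g: "g = (False, j)" "h dvd j" using assms(2) by (cases g) (auto simp: Hp_def)
  have per: "periodic N (\<lambda>i. ?W (p, i))" for p using W by (intro perD Fun_per)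
  show ?thesis
  proof (cases "N dvd j")
    case True
    then show ?thesis using periodic_cong[OF per, of "snd y + j" "snd y" "fst y"] periodic_cong[OF per, of "snd y - j" "snd y" "fst y"] E_refl[of y]
      by (cases y; cases "fst y") (auto simp: g)
  next
    case False
    then have Eg: "E (False, M) g" using Hp_cases[OF assms(2)] by (simp add: g)
    have zW: "?W (pm (pinv u) (False, M)) = ?W u" for u
    proof -
      obtain p b where u: "u = (p, b)" by fastforce
      have "?W (True, b - M) = ?W (True, b)" "?W (False, - b + M) = ?W (False, - b)"
        using zinv_D[OF assms(1), of "b - M" b] zinv_D[OF assms(1), of "- b + M" "- b"] by simp_all
      then have "?W (pm (pinv u) (False, M)) = ?W (pinv u)"
        unfolding u by (cases p) simp_all
      then show ?thesis using Fun_pinv[OF W] by simp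
    qed
    have "conv N ?W ?W (False, M) = tot N ?W"
      unfolding conv_def zW by simp
    then have "tot N (\<lambda>u. ?W u - ?W u * ?W (pm (pinv u) g)) = 0"
      using FunD[OF Fun_conv[OF W W] Eg] by (simp add: tot_diff conv_def)
    moreover have "per N (\<lambda>u. ?W u - ?W u * ?W (pm (pinv u) g))"
      using Fun_per[OF W] per_mult[OF Fun_per[OF W] per_pm(3)[OF per_pm(1)[OF Fun_per[OF W]], of g]]
      by (simp add: per_def periodic_def)
    moreover have "0 \<le> ?W u - ?W u * ?W (pm (pinv u) g)" for u by (simp add: ind_def)
    ultimately have "?W u - ?W u * ?W (pm (pinv u) g) = 0" for u
      using tot_zero_iff[OF N_pos, of "\<lambda>u. ?W u - ?W u * ?W (pm (pinv u) g)"] by blast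
    from this[of "pinv y"] have "?W (pm y g) = 1"
      using E_pinv[of y] E_refl[of y] Fun_pinv[OF W, of y] by simp
    then show ?thesis by simp
  qed
qed

text \<open>The analogue of the order \<open>k - \<lambda>\<close> of a difference set.\<close>

definition "order_of y = conv N (ind (E y)) (ind (E y)) (False, 0) - conv N (ind (E y)) (ind (E y)) (False, M)"

text \<open>Pairs in the class of \<open>y\<close> with quotient in \<open>H\<close> are counted in
  two ways. The factor \<open>l - 1\<close> is the number of nontrivial elements of
  \<open>H\<close>, which share one coefficient because they form one basic set.\<close>

lemma order_count:
  assumes "\<And>x. E y x \<Longrightarrow> conv N (ind (E y)) (ind Hp) x = rho"
  shows "order_of y * (l - 1) = tot N (ind (E y)) * (l - rho)"
proof -
  let ?Y = "ind (E y)" and ?k = "tot N (ind (E y))"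
  have Y: "?Y \<in> Fun" by (rule class_Fun)
  have "tot N (\<lambda>x. ind Hp x * conv N ?Y ?Y x) = tot N (\<lambda>u. ?Y u * conv N ?Y (ind Hp) (pinv u))"
    by (rule tot_conv_sub[OF Y H_Fun])
  also have "\<dots> = tot N (\<lambda>u. rho * ?Y u)"
  proof (rule tot_cong)
    fix u show "?Y u * conv N ?Y (ind Hp) (pinv u) = rho * ?Y u"
      using assms[of "pinv u"] Fun_pinv[OF Y, of u] by (cases "E y u") (auto simp: ind_def split: if_splits)
  qed
  also have "\<dots> = rho * ?k" by (simp add: tot_cmult)
  finally have 1: "tot N (\<lambda>x. ind Hp x * conv N ?Y ?Y x) = rho * ?k" .
  have C0: "conv N ?Y ?Y (False, 0) = ?k" using conv_at_one[OF Y] by simp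
  have "ind Hp x * conv N ?Y ?Y x = order_of y * one x + (?k - order_of y) * ind Hp x" for x
  proof (cases "Hp x")
    case True
    from Hp_cases[OF True] show ?thesis
    proof
      assume z: "E (False, M) x"
      have "\<not> (\<not> fst x \<and> N dvd snd x)"
        using E_one'[OF E_sym[OF z]] N_M M_pos zdvd_imp_le[of N M] by auto
      then have "one x = 0" unfolding one_def by simp
      then show ?thesis using True FunD[OF Fun_conv[OF Y Y] z] C0 by (simp add: order_of_def)
    next
      assume e: "\<not> fst x \<and> N dvd snd x"
      then have "one x = 1" "E (False, 0) x" using E_one by (cases x; simp add: one_def)+
      then show ?thesis using True FunD[OF Fun_conv[OF Y Y], of "(False, 0)" x] C0 by (simp add: order_of_def)
    qed
  next
    case False
    then have "one x = 0" using hl(7) dvd_trans by (auto simp: one_def Hp_def)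
    then show ?thesis using False by simp
  qed
  then have "rho * ?k = order_of y + (?k - order_of y) * l"
    using 1 by (simp add: tot_add tot_cmult tot_one tot_H)
  then show ?thesis by (simp add: algebra_simps)
qed

lemma tot_even:
  assumes "f \<in> Fun" "\<And>x. even (conv N f (ind Hp) x)"
  shows "even (tot N f)"
proof -
  have "even (S N (\<lambda>i. f (p, i)))" for p
    unfolding hl(3) S_divide[OF hl(1,2)]
    by (rule even_S, rule assms(2)[of "(p, _)", unfolded conv_H[OF Fun_per[OF assms(1)]]])
  then show ?thesis by (simp add: tot_def)
qed

text \<open>In \<open>order_count\<close> the size of the class and \<open>l - rho\<close>
  contribute a factor 2 each, while \<open>l - 1\<close> is odd.\<close>

lemma four_dvd_order:
  assumes "even rho" "\<And>x. E y x \<Longrightarrow> conv N (ind (E y)) (ind Hp) x = rho" "\<And>x. even (conv N (ind (E y)) (ind Hp) x)"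
  shows "4 dvd order_of y"
proof -
  have "even (tot N (ind (E y)))" by (rule tot_even[OF class_Fun assms(3)])
  moreover have "even (l - rho)" using assms(1) hl(5) by simp
  ultimately have "2 * 2 dvd tot N (ind (E y)) * (l - rho)" by (rule mult_dvd_mono)
  then have "4 dvd order_of y * (l - 1)" using order_count[OF assms(2)] by simp
  moreover have "coprime 4 (l - 1)"
  proof -
    have "odd (l - 1)" using hl(5) by simp
    then have "coprime (2 ^ 2) (l - 1)" unfolding coprime_power_left_iff by simp
    then show ?thesis by simp
  qed
  ultimately show ?thesis by (simp add: coprime_dvd_mult_left_iff)
qed

text \<open>The central involution lies in \<open>H\<close> and acts on each coset without fixed
  points.\<close>

lemma coset_sum_even:
  assumes "\<And>i. f (p, i + M) = f (p, i)" "f \<in> Fun"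
  shows "even (conv N f (ind Hp) (p, i))"
proof -
  have "f (p, i + h * (j + 2 ^ (m - r))) = f (p, i + h * j)" for j
  proof -
    have "h * 2 ^ (m - r) = M" using r_le by (simp add: h_def M_def power_add[symmetric])
    then show ?thesis using assms(1) unfolding ring_distribs add.assoc[symmetric] by simp
  qed
  then show ?thesis
    unfolding conv_H[OF Fun_per[OF assms(2)]] hl(6) S_double[OF zero_less_power[OF zero_less_numeral]]
    by (intro even_S) simp
qed

lemma class_z: "\<not> Hp y \<Longrightarrow> ind (E y) (False, 0) = 0" "\<not> Hp y \<Longrightarrow> ind (E y) (False, M) = 0"
  using Hp_M(2,3) Hp_E[OF E_sym] by (metis ind_simps(2))+

end

section \<open>Two basic sets split by the central involution\<close>

locale two_split_classes = central_subgroup_sring +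
  fixes y1 y2 :: pt and p0 :: bool and i0 j0 :: int
  assumes y12: "\<not> E y1 y2" and y1_H: "\<not> Hp y1" and y2_H: "\<not> Hp y2"
    and split1: "E y1 (p0, i0)" and split2: "E y2 (p0, i0 + M)"
    and others: "\<not> E y1 (p, i) \<Longrightarrow> \<not> E y2 (p, i) \<Longrightarrow> p \<or> \<not> M dvd i \<Longrightarrow> E (p, i) (p, i + M)"
    and refl1: "E y1 (True, j0)"
begin

definition "Y1 = ind (E y1)"
definition "Y2 = ind (E y2)"
definition "d = order_of y1"
text \<open>Modulo invariant elements, the square of \<open>Y1\<close> is \<open>d\<close> times the
  identity plus \<open>lin\<close> times \<open>Y1\<close>.\<close>

definition "lin = conv N Y1 Y1 y1 - conv N Y1 Y1 y2"

lemma Y_Fun: "Y1 \<in> Fun" "Y2 \<in> Fun"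
  by (simp_all add: Y1_def Y2_def class_Fun)

lemma not_both: "\<not> (E y1 x \<and> E y2 x)"
  using y12 E_sym E_trans by blast

lemma Hp_out: "E y1 x \<or> E y2 x \<Longrightarrow> \<not> Hp x"
  using Hp_E E_sym y1_H y2_H by blast

lemma pair_cases:
  assumes "p \<or> \<not> M dvd i"
  obtains "E (p, i) (p, i + M)" | "E y1 (p, i)" "E y2 (p, i + M)" | "E y2 (p, i)" "E y1 (p, i + M)"
proof (cases "E y1 (p, i) \<or> E y2 (p, i)")
  case False
  then show ?thesis using that(1) others assms by blast
next
  case True
  have "E y1 (p, i + M) \<or> E y2 (p, i + M)"
  proof (rule ccontr)
    assume *: "\<not> ?thesis"
    have "p \<or> \<not> M dvd i + M" using assms by simp
    then have "E (p, i + M) (p, i + M + M)" using others * by blast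
    moreover have "E (p, i) (p, i + M + M)" using E_per[of p i] by (simp add: N_M add.assoc)
    ultimately have "E (p, i) (p, i + M)" using E_sym E_trans by blast
    then show False using True * E_trans by blast
  qed
  then show ?thesis using True that E_sym E_trans by blast
qed

definition "rho = conv N Y1 (ind Hp) y1"

lemma rho: "E y1 x \<or> E y2 x \<Longrightarrow> conv N Y1 (ind Hp) x = rho"
proof -
  let ?f = "conv N Y1 (ind Hp)"
  have F: "?f \<in> Fun" by (intro Fun_conv Y_Fun H_Fun)
  have z: "zinv M ?f" using zinv_H by (rule zinv_conv)
  have "?f y2 = ?f y1"
    using FunD[OF F split1] FunD[OF F split2] z by (simp add: zinv_iff)
  then show "E y1 x \<or> E y2 x \<Longrightarrow> ?f x = rho"
    using FunD[OF F, of y1 x] FunD[OF F, of y2 x] by (auto simp: rho_def)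
qed

text \<open>The class of a point outside both sets is not split, so by \<open>unsplit_H_inv\<close>
  it is a union of cosets of \<open>H\<close>, and none of these can meet \<open>Y1\<close>.\<close>

lemma coset_union:
  assumes "\<not> E y1 (p, i)" "\<not> E y2 (p, i)" shows "conv N Y1 (ind Hp) (p, i) = 0"
proof -
  have "Y1 (p, i + h * j) = 0" for j
  proof (rule ccontr)
    assume "\<not> ?thesis"
    then have 1: "E y1 (p, i + h * j)" by (simp add: Y1_def)
    let ?W = "ind (E (p, i))"
    have out: "\<not> Hp (p, i)"
    proof
      assume "Hp (p, i)"
      then have "Hp (p, i + h * j)" by (auto simp: Hp_def)
      then show False using Hp_out 1 by blast
    qed
    have W0: "?W x = 0" if "E y1 x \<or> E y2 x" for x
      using that assms E_sym E_trans by (metis ind_simps(2))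
    have "zinv M ?W"
    proof (rule off_zinv[OF Fun_per[OF class_Fun]])
      show "?W (False, 0) = ?W (False, M)" using class_z[OF out] by simp
      fix q k assume "q \<or> \<not> M dvd k"
      then show "?W (q, k + M) = ?W (q, k)"
      proof (cases rule: pair_cases)
        case 1
        then show ?thesis using FunD[OF class_Fun 1] by simp
      next
        case 2
        then show ?thesis using W0 by simp
      next
        case 3
        then show ?thesis using W0 by simp
      qed
    qed
    then have "E (p, i) (pm (p, i) (False, if p then - (h * j) else h * j))"
      by (rule unsplit_H_inv) (simp add: Hp_def)
    then have "E (p, i) (p, i + h * j)" by (cases p) simp_all
    then show False using 1 assms E_sym E_trans by blast
  qed
  then show ?thesis unfolding conv_H[OF Fun_per[OF Y_Fun(1)]] by (simp add: S_def)
qed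

lemma four_dvd_d: assumes "even rho" shows "4 dvd d"
  unfolding d_def
proof (rule four_dvd_order[OF assms])
  show "E y1 x \<Longrightarrow> conv N (ind (E y1)) (ind Hp) x = rho" for x
    using rho[of x] unfolding Y1_def by blast
  show "even (conv N (ind (E y1)) (ind Hp) x)" for x
  proof (cases "E y1 x \<or> E y2 x")
    case True
    then show ?thesis using assms rho[of x] unfolding Y1_def by simp
  next
    case False
    then show ?thesis using coset_union[of "fst x" "snd x"] unfolding Y1_def by simp
  qed
qed

text \<open>The image of a split point of \<open>Y1\<close> lies in \<open>Y2\<close> and
  conversely, and all other classes are invariant off 1 and the involution; so subtracting the
  identity and \<open>Y1\<close> with the right coefficients leaves an element of the
  kernel.\<close>

lemma square: "Al Y1 ^ 2 + Be Y1 * cnj (Be Y1) = of_int d + of_int lin * Al Y1"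
  "2 * Al Y1 * Be Y1 = of_int lin * Be Y1"
proof -
  let ?G = "\<lambda>x. conv N Y1 Y1 x - d * one x - lin * Y1 x"
  have C: "conv N Y1 Y1 \<in> Fun" by (intro Fun_conv Y_Fun)
  have G: "?G \<in> Fun" by (intro Fun_diff Fun_cmult C Y_Fun one_Fun)
  have one0: "one (q, i) = 0" if "q \<or> \<not> M dvd i" for q i
    using that N_dvd by (cases q) (auto simp: one_simps)
  have "zinv M ?G"
  proof (rule off_zinv[OF Fun_per[OF G]])
    have "\<not> N dvd M" using N_M M_pos zdvd_imp_le[of N M] by auto
    then show "?G (False, 0) = ?G (False, M)"
      using class_z[OF y1_H] by (simp add: one_simps d_def order_of_def Y1_def)
    fix q i assume *: "q \<or> \<not> M dvd i"
    then have **: "q \<or> \<not> M dvd i + M" by simp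
    from * show "?G (q, i + M) = ?G (q, i)"
    proof (cases rule: pair_cases)
      case 1
      show ?thesis using FunD[OF C 1] FunD[OF Y_Fun(1) 1] one0[OF *] one0[OF **] by simp
    next
      case 2
      then show ?thesis using FunD[OF C 2(1)] FunD[OF C 2(2)] one0[OF *] one0[OF **] not_both
        by (auto simp: Y1_def lin_def ind_def)
    next
      case 3
      then show ?thesis using FunD[OF C 3(1)] FunD[OF C 3(2)] one0[OF *] one0[OF **] not_both
        by (auto simp: Y1_def lin_def ind_def)
    qed
  qed
  then have "Al ?G = 0" "Be ?G = 0" using zinv_Al_Be[OF Fun_per[OF G]] by blast+
  moreover have "Al ?G = Al Y1 * Al Y1 + Be Y1 * cnj (Be Y1) - of_int d - of_int lin * Al Y1"
    "Be ?G = Al Y1 * Be Y1 + Be Y1 * Al Y1 - of_int lin * Be Y1"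
    by (simp_all add: al_linear al_one be_one Al_conv Be_conv Y_Fun)
  ultimately have 1: "Al Y1 * Al Y1 + Be Y1 * cnj (Be Y1) - of_int d - of_int lin * Al Y1 = 0"
    and 2: "Al Y1 * Be Y1 + Be Y1 * Al Y1 - of_int lin * Be Y1 = 0"
    by simp_all
  show "Al Y1 ^ 2 + Be Y1 * cnj (Be Y1) = of_int d + of_int lin * Al Y1"
    using 1 by (simp add: power2_eq_square algebra_simps)
  have "Al Y1 * Be Y1 + Be Y1 * Al Y1 = 2 * Al Y1 * Be Y1" by simp
  then show "2 * Al Y1 * Be Y1 = of_int lin * Be Y1" using 2 by simp
qed

lemma Y1_split: "\<not> zinv M Y1"
proof
  assume "zinv M Y1"
  then have "Y1 (p0, i0 + M) = Y1 (p0, i0)" by (simp add: zinv_iff)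
  then show False using split1 split2 not_both by (auto simp: Y1_def ind_def split: if_splits)
qed

lemma Y1_01: "Y1 (q, i) = 0 \<or> Y1 (q, i) = 1"
  by (simp add: Y1_def ind_def)

lemma even_diff_eq: "even (Y1 (q, i) - Y1 (q, j)) \<Longrightarrow> Y1 (q, j) = Y1 (q, i)"
  using Y1_01[of q i] Y1_01[of q j] by auto

text \<open>Otherwise \<open>Y1\<close> is invariant on reflections, the coset through
  \<open>j0\<close> makes \<open>rho\<close> even, and \<open>d\<close> is divisible by 4. Then
  \<open>quadratic_no_split\<close> makes \<open>Y1\<close> invariant on rotations too.\<close>

lemma Be_ne: "Be Y1 \<noteq> 0"
proof
  assume B: "Be Y1 = 0"
  then have "Y1 (True, i + M) = Y1 (True, i)" for i using Al_Be_zero(2)[OF Fun_per[OF Y_Fun(1)]] by blast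
  from coset_sum_even[of Y1 True, OF this Y_Fun(1), of j0] have "even rho"
    using rho refl1 by simp
  then obtain c where c: "d = 4 * c" using four_dvd_d by blast
  have "Al Y1 * (Al Y1 - of_int lin) = 4 * of_int c"
    using square(1) B c by (simp add: power2_eq_square algebra_simps)
  from quadratic_no_split[OF Y_Fun(1) _ _ this] class_z[OF y1_H]
  have "even (Y1 (False, i) - Y1 (False, i + M))" for i by (simp add: Y1_def)
  then have "Y1 (False, i + M) = Y1 (False, i)" for i by (rule even_diff_eq)
  then have "Al Y1 = 0" using Al_Be_zero(1)[OF Fun_per[OF Y_Fun(1)]] by blast
  then show False using B zinv_Al_Be[OF Fun_per[OF Y_Fun(1)]] Y1_split by blast
qed

lemma Al_zero: "Al Y1 = 0"
proof (rule ccontr)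
  assume ne: "Al Y1 \<noteq> 0"
  have "Al (\<lambda>x. 2 * Y1 x) = of_int lin" using square(2) Be_ne by (simp add: al_linear)
  from Al_int_zero[OF Fun_cmult[OF Y_Fun(1)] _ this] class_z[OF y1_H] ne show False
    by (simp add: Y1_def al_linear)
qed

lemma Be_d: "Be Y1 * cnj (Be Y1) = of_int d"
  using square(1) Al_zero by simp

lemma not_four_dvd_d: "\<not> 4 dvd d"
proof
  assume "4 dvd d"
  then obtain c where "d = 4 * c" by blast
  then have "Be Y1 * cnj (Be Y1) = 4 * of_int c" using Be_d by simp
  from Be_no_4[OF Y_Fun(1) this] have "Y1 (True, i + M) = Y1 (True, i)" for i by (rule even_diff_eq)
  then show False using Be_ne Al_Be_zero(2)[OF Fun_per[OF Y_Fun(1)]] by blast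
qed

text \<open>As \<open>Al\<close> vanishes, \<open>Y1\<close> is invariant on rotations, so a coset
  of rotations meeting either class would make \<open>rho\<close> even and \<open>d\<close>
  divisible by 4.\<close>

lemma no_rotation: "\<not> E y1 (False, i)" "\<not> E y2 (False, i)"
proof -
  have "Y1 (False, i + M) = Y1 (False, i)" for i
    using Al_zero Al_Be_zero(1)[OF Fun_per[OF Y_Fun(1)]] by blast
  from coset_sum_even[of Y1 False, OF this Y_Fun(1), of i]
  have "E y1 (False, i) \<or> E y2 (False, i) \<Longrightarrow> even rho" using rho by simp
  then show "\<not> E y1 (False, i)" "\<not> E y2 (False, i)" using four_dvd_d not_four_dvd_d by blast+
qed

lemma p0_True: "p0" using no_rotation split1 by (cases p0) auto

lemma singleton:
  assumes one_coset: "\<And>i j. E y1 (True, i) \<Longrightarrow> E y1 (True, j) \<Longrightarrow> h dvd i - j"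
  shows "\<exists>i1. \<forall>x. E (True, i1) x \<longrightarrow> fst x \<and> N dvd snd x - i1"
proof -
  let ?k = "tot N Y1"
  have Y1F: "Y1 (False, i) = 0" for i using no_rotation by (simp add: Y1_def)
  have coset: "h dvd i - j0" if "E y1 (True, i) \<or> E y2 (True, i)" for i
  proof (rule ccontr)
    assume no: "\<not> h dvd i - j0"
    have "Y1 (True, i + h * j) = 0" for j
    proof (rule ccontr)
      assume "Y1 (True, i + h * j) \<noteq> 0"
      then have "h dvd (i + h * j) - j0" using one_coset refl1 by (simp add: Y1_def)
      then have "h dvd (i - j0) + h * j" by (simp add: algebra_simps)
      then show False using no dvd_add_left_iff[of h "h * j" "i - j0"] by simp
    qed
    then have "conv N Y1 (ind Hp) (True, i) = 0"
      unfolding conv_H[OF Fun_per[OF Y_Fun(1)]] by (simp add: S_def)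
    then have "rho = 0" using rho[OF that] by simp
    then show False using four_dvd_d not_four_dvd_d by simp
  qed
  have tot_coset: "tot N f = S l (\<lambda>j. f (True, j0 + h * j))"
    if "f \<in> Fun" "\<And>i. f (False, i) = 0" "\<And>i. f (True, i) \<noteq> 0 \<Longrightarrow> h dvd i - j0" for f
  proof -
    have "tot N f = S N (\<lambda>j. (if h dvd j - j0 then 1 else 0) * f (True, j))"
      unfolding tot_def that(2) using that(3) by (simp add: S_def) (rule sum.cong, auto)
    then show ?thesis using S_dvd_coset[OF hl(1,2) perD[OF Fun_per[OF that(1)], of True, unfolded hl(3)]]
      by (simp add: hl(3))
  qed
  have "?k = S l (\<lambda>j. Y1 (True, j0 + h * j))"
    by (rule tot_coset[OF Y_Fun(1) Y1F]) (use coset in \<open>auto simp: Y1_def\<close>)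
  also have "\<dots> = conv N Y1 (ind Hp) (True, j0)" by (simp only: conv_H[OF Fun_per[OF Y_Fun(1)]])
  also have "\<dots> = rho" by (rule rho) (simp add: refl1)
  finally have k_rho: "?k = rho" .
  have dk: "d * (l - 1) = ?k * (l - ?k)"
    using order_count[of y1 rho] rho unfolding Y1_def[symmetric] d_def[symmetric] by (simp add: k_rho)
  define b where "b j = Y1 (True, j0 + h * j)" for j
  \<comment> \<open>The character of order two on the positions in the coset. The autocorrelation of
    \<open>b\<close> is constant away from 0, so the square of the character sum \<open>t\<close> is
    exactly \<open>d\<close>; this shows that the order is a square.\<close>
  define s :: "int \<Rightarrow> int" where "s j = (if even j then 1 else - 1)" for j
  define t where "t = S l (\<lambda>j. b j * s j)"
  have per_b: "periodic l b"
    using perD[OF Fun_per[OF Y_Fun(1)], of True]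
    by (simp add: periodic_def b_def hl(3) ring_distribs add.assoc[symmetric])
  have per_s: "periodic l s" using hl(5) by (simp add: periodic_def s_def)
  have s_diff: "s j * s (j - q) = s q" for j q by (auto simp: s_def)
  have conv_b: "conv N Y1 Y1 (False, h * q) = S l (\<lambda>j. b j * b (j - q))" for q
  proof -
    have "conv N Y1 Y1 (False, h * q) = S N (\<lambda>i. Y1 (True, i) * Y1 (True, i - h * q))"
      by (simp add: conv_False Y1F S_def)
    also have "\<dots> = S N (\<lambda>i. (if h dvd i - j0 then 1 else 0) * (Y1 (True, i) * Y1 (True, i - h * q)))"
      by (rule S_cong) (use coset in \<open>auto simp: Y1_def ind_def\<close>)
    also have "\<dots> = S l (\<lambda>j. Y1 (True, j0 + h * j) * Y1 (True, j0 + h * j - h * q))"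
      unfolding hl(3)
    proof (rule S_dvd_coset[OF hl(1,2)])
      show "periodic (h * l) (\<lambda>i. Y1 (True, i) * Y1 (True, i - h * q))"
        using perD[OF Fun_per[OF Y_Fun(1)], of True] per_shift(3)[OF perD[OF Fun_per[OF Y_Fun(1)], of True], of "h * q"]
        unfolding hl(3) by (simp add: periodic_def)
    qed
    finally show ?thesis by (simp add: b_def algebra_simps)
  qed
  have conv_val: "conv N Y1 Y1 (False, h * q) = conv N Y1 Y1 (False, M) + (if l dvd q - 0 then 1 else 0) * d" for q
  proof -
    have C: "conv N Y1 Y1 \<in> Fun" by (intro Fun_conv Y_Fun)
    have dv: "N dvd h * q \<longleftrightarrow> l dvd q" using hl(1) by (simp add: hl(3))
    show ?thesis
    proof (cases "l dvd q")
      case True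
      then have "E (False, 0) (False, h * q)" using E_one dv by simp
      from FunD[OF C this] show ?thesis using True by (simp add: d_def order_of_def Y1_def)
    next
      case False
      then have "\<not> N dvd h * q" using dv by simp
      then have "E (False, M) (False, h * q)" using H_class[of "h * q" False "h * q"] E_refl by (simp add: h_def)
      from FunD[OF C this] show ?thesis using False by simp
    qed
  qed
  have "s (j + 1) = - s j" for j by (simp add: s_def)
  then have "S l s = S l (\<lambda>j. - s j)"
    using S_shift[OF hl(2) per_s, of 1] by simp
  then have s0: "S l s = 0" by (simp add: S_def sum_negf)
  have "t * t = S l (\<lambda>j. S l (\<lambda>i. b j * s j * (b i * s i)))"
    by (simp add: t_def S_def sum_product)
  also have "\<dots> = S l (\<lambda>j. S l (\<lambda>q. b j * s j * (b (j - q) * s (j - q))))"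
  proof (rule S_cong)
    fix j
    have "periodic l (\<lambda>i. b j * s j * (b i * s i))" using per_b per_s by (simp add: periodic_def)
    from S_reflect[OF hl(2) this, of j]
    show "S l (\<lambda>i. b j * s j * (b i * s i)) = S l (\<lambda>q. b j * s j * (b (j - q) * s (j - q)))" by simp
  qed
  also have "\<dots> = S l (\<lambda>j. S l (\<lambda>q. s q * (b j * b (j - q))))"
  proof (intro S_cong)
    fix j q
    have "b j * s j * (b (j - q) * s (j - q)) = (s j * s (j - q)) * (b j * b (j - q))" by (simp only: mult_ac)
    then show "b j * s j * (b (j - q) * s (j - q)) = s q * (b j * b (j - q))" by (simp only: s_diff)
  qed
  also have "\<dots> = S l (\<lambda>q. s q * conv N Y1 Y1 (False, h * q))"
    by (subst S_swap) (simp add: S_cmult conv_b)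
  also have "\<dots> = S l (\<lambda>q. conv N Y1 Y1 (False, M) * s q + (if l dvd q - 0 then 1 else 0) * (d * s q))"
    unfolding conv_val by (rule S_cong) (simp add: algebra_simps)
  also have "\<dots> = d"
  proof -
    have "periodic l (\<lambda>q. d * s q)" using per_s by (simp add: periodic_def)
    from S_delta[OF hl(2) this, of 0] show ?thesis by (simp add: S_add S_cmult s0) (simp add: s_def)
  qed
  finally have t: "d = t * t" by simp
  have "odd t"
  proof
    assume "even t"
    then have "2 * 2 dvd t * t" by (intro mult_dvd_mono) simp_all
    then show False using t not_four_dvd_d by simp
  qed
  have le: "?k + tot N Y2 \<le> l"
  proof -
    have "?k + tot N Y2 = tot N (\<lambda>x. Y1 x + Y2 x)" by (simp add: tot_add)
    also have "\<dots> = S l (\<lambda>j. Y1 (True, j0 + h * j) + Y2 (True, j0 + h * j))"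
      by (rule tot_coset[OF Fun_add[OF Y_Fun]])
        (use coset no_rotation in \<open>auto simp: Y1_def Y2_def ind_def split: if_splits\<close>)
    also have "\<dots> \<le> S l (\<lambda>j. 1)"
      unfolding S_def by (rule sum_mono) (use not_both in \<open>auto simp: Y1_def Y2_def ind_def\<close>)
    finally show ?thesis using hl(2) by (simp add: S_def)
  qed
  have pos: "0 < ?k" "0 < tot N Y2"
  proof -
    have "tot N Y1 \<noteq> 0" "tot N Y2 \<noteq> 0"
      using tot_zero_iff[OF N_pos Fun_per[OF Y_Fun(1)]] tot_zero_iff[OF N_pos Fun_per[OF Y_Fun(2)]] refl1 split2
      unfolding Y1_def Y2_def by (metis ind_simps(4) ind_simps(6))+
    then show "0 < ?k" "0 < tot N Y2"
      using tot_ind_nonneg[of "E y1"] tot_ind_nonneg[of "E y2"] by (simp_all add: Y1_def Y2_def)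
  qed
  have "?k = 1 \<or> ?k = l - 1"
    unfolding l_def by (rule odd_order_trivial[OF _ \<open>odd t\<close>])
      (use dk t le pos in \<open>auto simp: l_def power2_eq_square\<close>)
  then have "tot N Y1 = 1 \<or> tot N Y2 = 1" using le pos by auto
  then show ?thesis
  proof
    assume "tot N Y1 = 1"
    from tot_ind_one[OF Fun_per[OF Y_Fun(1), unfolded Y1_def] this[unfolded Y1_def] refl1] show ?thesis
      using refl1 E_trans by blast
  next
    assume "tot N Y2 = 1"
    moreover have 2: "E y2 (True, i0 + M)" using split2 p0_True by simp
    ultimately show ?thesis
      using tot_ind_one[OF Fun_per[OF Y_Fun(2), unfolded Y2_def] _ 2] E_trans unfolding Y2_def by blast
  qed
qed

end

section \<open>Three basic sets split by the central involution\<close>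

locale three_split_classes = central_subgroup_sring +
  fixes y1 y2 y3 :: pt
  assumes r_pos: "r > 0"
    and out: "\<not> Hp y1" "\<not> Hp y2" "\<not> Hp y3"
    and distinct: "\<not> E y1 y2" "\<not> E y1 y3" "\<not> E y2 y3"
    and cover: "\<not> Hp x \<Longrightarrow> E y1 x \<or> E y2 x \<or> E y3 x"
    and connected: "f \<in> Fun \<Longrightarrow> zinv M f \<Longrightarrow> f y1 = f y2 \<and> f y1 = f y3"
begin

abbreviation "W y \<equiv> ind (E y)"

lemma W_Fun: "W y \<in> Fun" by (rule class_Fun)

lemma const_out: assumes "f \<in> Fun" "zinv M f" "\<not> Hp x" shows "f x = f y1"
  using cover[OF assms(3)] FunD[OF assms(1)] connected[OF assms(1,2)] by metis

lemma not_zinv: assumes "\<not> Hp y" shows "\<not> zinv M (W y)"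
proof
  assume z: "zinv M (W y)"
  have "W y x = W y y" if "\<not> Hp x" for x
    using const_out[OF W_Fun z that] const_out[OF W_Fun z assms] by simp
  then have "E y x" if "\<not> Hp x" for x using that E_refl[of y] by simp
  then have "E y y1" "E y y2" using out by blast+
  then show False using distinct(1) E_sym E_trans by meson
qed

definition "rho y = conv N (W y) (ind Hp) y1"

lemma rho: assumes "\<not> Hp x" shows "conv N (W y) (ind Hp) x = rho y"
  unfolding rho_def
  by (rule const_out[OF Fun_conv[OF W_Fun H_Fun] zinv_conv[OF zinv_H] assms])

lemma rho_in: assumes "\<not> Hp y" "Hp x" shows "conv N (W y) (ind Hp) x = 0"
proof -
  obtain i where x: "x = (False, i)" "h dvd i" using assms(2) by (cases x) (auto simp: Hp_def)
  have "W y (False, i + h * j) = 0" for j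
  proof -
    have "Hp (False, i + h * j)" using x by (simp add: Hp_def)
    then show ?thesis using Hp_E E_sym assms(1) by (metis ind_simps(2))
  qed
  then show ?thesis unfolding x conv_H[OF Fun_per[OF W_Fun]] by (simp add: S_def)
qed

text \<open>\<open>rho\<close> is the same for all cosets outside \<open>H\<close>, so it can be
  read off at the coset of the exponent \<open>h / 2\<close>. Inversion maps this coset to itself
  without fixed points.\<close>

lemma rho_even: "even (rho y)"
proof -
  define g :: int where "g = 2 ^ (r - 1)"
  have h: "h = 2 * g" "g > 0" using r_pos by (simp_all add: h_def g_def power_Suc[symmetric] del: power_Suc)
  have "\<not> Hp (False, g)" using h zdvd_imp_le[of h g] by (auto simp: Hp_def)
  then have "rho y = S l (\<lambda>j. W y (False, g + h * j))"
    using rho conv_H[OF Fun_per[OF W_Fun]] by metis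
  also have "even \<dots>"
    unfolding hl(6)
  proof (rule even_S_reflect)
    show "periodic (2 * 2 ^ (m - r)) (\<lambda>j. W y (False, g + h * j))"
      using perD[OF Fun_per[OF W_Fun[of y]], of False]
      by (simp add: periodic_def hl(3) ring_distribs add.assoc[symmetric] hl(6)[symmetric])
    fix j
    have "g + h * (- 1 - j) = - (g + h * j)" by (simp add: h algebra_simps)
    moreover have "W y (False, - (g + h * j)) = W y (False, g + h * j)"
      using Fun_pinv[OF W_Fun, of y "(False, g + h * j)"] by simp
    ultimately show "W y (False, g + h * (- 1 - j)) = W y (False, g + h * j)" by (simp only:)
  qed simp
  finally show ?thesis .
qed

lemma four_dvd: assumes "\<not> Hp y" shows "4 dvd order_of y"
proof (rule four_dvd_order[OF rho_even[of y]])
  show "E y x \<Longrightarrow> conv N (W y) (ind Hp) x = rho y" for x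
    using rho Hp_E E_sym assms by blast
  show "even (conv N (W y) (ind Hp) x)" for x
    using rho rho_in[OF assms] rho_even by (cases "Hp x") simp_all
qed

lemma diff_01: "even (W y x - W y x') \<Longrightarrow> W y x' = W y x"
  by (auto simp: ind_def split: if_splits)

text \<open>Under these hypotheses the class squares to the integer \<open>order_of y\<close> in the
  faithful representation. This integer is divisible by 4, and \<open>Be_no_4\<close> makes the
  class invariant.\<close>

lemma no_rational:
  assumes "\<not> Hp y" "Al (W y) = 0" "c \<noteq> 0" "of_int (c * c) * (Be (W y) * cnj (Be (W y))) = of_int k"
  shows False
proof -
  have C: "conv N (W y) (W y) \<in> Fun" by (intro Fun_conv W_Fun)
  have "Al (\<lambda>x. (c * c) * conv N (W y) (W y) x) = of_int k"
    using assms(2,4) by (simp add: al_linear Al_conv W_Fun)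
  from Al_int(1)[OF Fun_per[OF Fun_cmult[OF C]] this]
  have "c * c * order_of y = k" by (simp add: order_of_def right_diff_distrib)
  then have "Be (W y) * cnj (Be (W y)) = of_int (order_of y)" using assms(3,4) by auto
  moreover obtain q where "order_of y = 4 * q" using four_dvd[OF assms(1)] by blast
  ultimately have "Be (W y) * cnj (Be (W y)) = 4 * of_int q" by simp
  from Be_no_4[OF W_Fun this] have "W y (True, i + M) = W y (True, i)" for i by (rule diff_01)
  then have "Be (W y) = 0" using Al_Be_zero(2)[OF Fun_per[OF W_Fun]] by blast
  then show False using assms(1,2) not_zinv zinv_Al_Be[OF Fun_per[OF W_Fun]] by blast
qed

text \<open>The three classes add up to the invariant complement of \<open>H\<close>, so modulo
  invariant elements the identity and two of them span the S-ring.\<close>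

lemma expand:
  assumes "g \<in> Fun"
  shows "Al g = of_int (g (False, 0) - g (False, M)) + of_int (g y1 - g y3) * Al (W y1) + of_int (g y2 - g y3) * Al (W y2)"
    and "Be g = of_int (g y1 - g y3) * Be (W y1) + of_int (g y2 - g y3) * Be (W y2)"
proof -
  let ?G = "\<lambda>x. g x - (g (False, 0) - g (False, M)) * one x - (g y1 - g y3) * W y1 x - (g y2 - g y3) * W y2 x"
  have G: "?G \<in> Fun" by (intro Fun_diff Fun_cmult assms W_Fun one_Fun)
  have W_in: "W y1 x = 0" "W y2 x = 0" if "Hp x" for x
    using Hp_E E_sym out that by (metis ind_simps(2))+
  have G_out: "?G x = g y3" if x: "\<not> Hp x" for x
  proof -
    have "one x = 0" using x hl(7) dvd_trans by (auto simp: one_def Hp_def)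
    moreover have "E y1 x \<and> \<not> E y2 x \<or> E y2 x \<and> \<not> E y1 x \<or> E y3 x \<and> \<not> E y1 x \<and> \<not> E y2 x"
      using cover[OF x] distinct E_sym E_trans by metis
    moreover have "E y1 x \<Longrightarrow> g x = g y1" "E y2 x \<Longrightarrow> g x = g y2" "E y3 x \<Longrightarrow> g x = g y3"
      using FunD[OF assms] by metis+
    ultimately show ?thesis by auto
  qed
  have "zinv M ?G"
  proof (rule off_zinv[OF Fun_per[OF G]])
    have "\<not> N dvd M" using N_M M_pos zdvd_imp_le[of N M] by auto
    then show "?G (False, 0) = ?G (False, M)"
      using W_in Hp_M by (simp add: one_simps)
    fix q i assume qi: "q \<or> \<not> M dvd i"
    show "?G (q, i + M) = ?G (q, i)"
    proof (cases "Hp (q, i)")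
      case True
      then have q: "q = False" "h dvd i" by (auto simp: Hp_def)
      then have nM: "\<not> M dvd i" "\<not> M dvd i + M" using qi by auto
      then have nN: "\<not> N dvd i" "\<not> N dvd i + M" using N_dvd by blast+
      have "h dvd i + M" using q hl(4) by simp
      then have "E (False, M) (False, i)" "E (False, M) (False, i + M)"
        using H_class[of i False i] H_class[of "i + M" False "i + M"] q nN E_refl by (simp_all add: h_def)
      from FunD[OF G this(1)] FunD[OF G this(2)] show ?thesis using q by simp
    next
      case False
      then have "\<not> Hp (q, i + M)" using Hp_M by (auto simp: Hp_def)
      then show ?thesis using G_out False by simp
    qed
  qed
  then have "Al ?G = 0" "Be ?G = 0" using zinv_Al_Be[OF Fun_per[OF G]] by blast+
  moreover have "Al ?G = Al g - of_int (g (False, 0) - g (False, M)) - of_int (g y1 - g y3) * Al (W y1) - of_int (g y2 - g y3) * Al (W y2)"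
    "Be ?G = Be g - of_int (g y1 - g y3) * Be (W y1) - of_int (g y2 - g y3) * Be (W y2)"
    unfolding al_linear al_one be_one by simp_all
  ultimately show "Al g = of_int (g (False, 0) - g (False, M)) + of_int (g y1 - g y3) * Al (W y1) + of_int (g y2 - g y3) * Al (W y2)"
    "Be g = of_int (g y1 - g y3) * Be (W y1) + of_int (g y2 - g y3) * Be (W y2)"
    by (simp_all add: diff_diff_eq)
qed

lemma W_z: "\<not> Hp y \<Longrightarrow> W y (False, 0) = W y (False, M)"
  using class_z by simp

lemma Al_not_int:
  assumes "f \<in> Fun" "f (False, 0) = f (False, M)" "of_int c * Al f = of_int k" "c \<noteq> 0"
  shows "Al f = 0"
proof -
  have "Al (\<lambda>x. c * f x) = of_int k" using assms(3) by (simp add: al_linear)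
  from Al_int_zero[OF Fun_cmult[OF assms(1)] _ this] have "of_int c * Al f = 0" using assms(2) by (simp add: al_linear)
  then show ?thesis using assms(4) by simp
qed

text \<open>The matrix of \<open>W y1\<close>, with diagonal \<open>A1\<close> and off-diagonal
  entries \<open>B1\<close> and \<open>cnj B1\<close>, is a root of an integral cubic. An integer
  root \<open>k\<close> leaves a quadratic factor; for \<open>B1\<close> different from 0 its value
  yields an element \<open>F\<close> with zero diagonal and off-diagonal entry of integral norm, to
  which \<open>no_rational\<close> can be applied.\<close>

lemma impossible: False
proof -
  define A1 where "A1 = Al (W y1)"
  define A2 where "A2 = Al (W y2)"
  define B1 where "B1 = Be (W y1)"
  define B2 where "B2 = Be (W y2)"
  define C11 where "C11 = conv N (W y1) (W y1)"
  define C12 where "C12 = conv N (W y1) (W y2)"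
  have CF: "C11 \<in> Fun" "C12 \<in> Fun" unfolding C11_def C12_def by (intro Fun_conv W_Fun)+
  define d1 where "d1 = order_of y1"
  define p1 where "p1 = C11 y1 - C11 y3"
  define p2 where "p2 = C11 y2 - C11 y3"
  define d' where "d' = C12 (False, 0) - C12 (False, M)"
  define q1 where "q1 = C12 y1 - C12 y3"
  define q2 where "q2 = C12 y2 - C12 y3"
  have d1: "C11 (False, 0) - C11 (False, M) = d1" by (simp add: d1_def order_of_def C11_def)
  define bb where "bb = B1 * cnj B1"
  define gg where "gg = B1 * cnj B2"
  have gg': "gg = B2 * cnj B1" unfolding gg_def B1_def B2_def by (rule Be_comm[OF W_Fun W_Fun])
  have e1: "A1 * A1 + bb = of_int d1 + of_int p1 * A1 + of_int p2 * A2"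
    and e2: "A1 * B1 + B1 * A1 = of_int p1 * B1 + of_int p2 * B2"
    using expand[OF CF(1)] unfolding d1 p1_def[symmetric] p2_def[symmetric]
    by (simp_all add: Al_conv Be_conv W_Fun C11_def A1_def A2_def B1_def B2_def bb_def)
  have e3: "A1 * A2 + gg = of_int d' + of_int q1 * A1 + of_int q2 * A2"
    and e4: "A1 * B2 + B1 * A2 = of_int q1 * B1 + of_int q2 * B2"
    using expand[OF CF(2)] unfolding d'_def[symmetric] q1_def[symmetric] q2_def[symmetric]
    by (simp_all add: Al_conv Be_conv W_Fun C12_def A1_def A2_def B1_def B2_def gg_def)
  have zinv1: "\<not> (A1 = 0 \<and> B1 = 0)"
    using not_zinv[OF out(1)] zinv_Al_Be[OF Fun_per[OF W_Fun]] by (simp add: A1_def B1_def)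
  have A1_int: "A1 = 0" if "of_int c * A1 = of_int k" "c \<noteq> 0" for c k
    using Al_not_int[OF W_Fun W_z[OF out(1)]] that by (simp add: A1_def)
  have A1_ne: "A1 \<noteq> 0"
    if "bb = of_int k" for k
    using no_rational[OF out(1), of 1 k] that by (auto simp: A1_def bb_def B1_def)
  \<comment> \<open>Trace, negated sum of the principal minors of size two, and determinant of
    multiplication by \<open>W y1\<close> in the basis consisting of the identity,
    \<open>W y1\<close> and \<open>W y2\<close>.\<close>
  define c2 where "c2 = p1 + q2"
  define c1 where "c1 = d1 + p2 * q1 - q2 * p1"
  define c0 where "c0 = p2 * d' - q2 * d1"
  have e1': "of_int p2 * A2 = A1 * A1 + bb - of_int d1 - of_int p1 * A1"
    and e2': "of_int p2 * B2 = 2 * (A1 * B1) - of_int p1 * B1"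
    using e1 e2 by (simp_all add: algebra_simps)
  \<comment> \<open>Diagonal entry of the cubic equation for the matrix of \<open>W y1\<close>;
    \<open>cub_b\<close> is the off-diagonal entry.\<close>
  have cub_a: "A1 ^ 3 + 3 * A1 * bb = of_int c2 * (A1 ^ 2 + bb) + of_int c1 * A1 + of_int c0"
  proof -
    have "A1 ^ 3 + 3 * A1 * bb = A1 * (A1 * A1 + bb) + cnj B1 * (A1 * B1 + B1 * A1)"
      by (simp add: bb_def power3_eq_cube algebra_simps)
    also have "\<dots> = A1 * (of_int d1 + of_int p1 * A1 + of_int p2 * A2) + cnj B1 * (of_int p1 * B1 + of_int p2 * B2)"
      by (simp only: e1 e2)
    also have "\<dots> = of_int d1 * A1 + of_int p1 * (A1 * A1 + bb) + of_int p2 * (A1 * A2 + gg)"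
      unfolding gg' bb_def by (simp add: algebra_simps)
    also have "\<dots> = of_int d1 * A1 + of_int p1 * (A1 * A1 + bb) + of_int p2 * of_int d' + of_int p2 * of_int q1 * A1 +
        of_int q2 * (of_int p2 * A2)"
      unfolding e3 by (simp add: algebra_simps)
    also have "\<dots> = of_int c2 * (A1 ^ 2 + bb) + of_int c1 * A1 + of_int c0"
      unfolding e1' by (simp add: c2_def c1_def c0_def power2_eq_square algebra_simps)
    finally show ?thesis .
  qed
  have cub_b: "B1 * (3 * A1 ^ 2 + bb) = B1 * (2 * of_int c2 * A1 + of_int c1)"
  proof -
    have "B1 * (3 * A1 ^ 2 + bb) = A1 * (A1 * B1 + B1 * A1) + B1 * (A1 * A1 + bb)"
      by (simp add: power2_eq_square algebra_simps)
    also have "\<dots> = A1 * (of_int p1 * B1 + of_int p2 * B2) + B1 * (of_int d1 + of_int p1 * A1 + of_int p2 * A2)"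
      by (simp only: e1 e2)
    also have "\<dots> = 2 * of_int p1 * A1 * B1 + of_int d1 * B1 + of_int p2 * (A1 * B2 + B1 * A2)"
      by (simp add: algebra_simps)
    also have "\<dots> = 2 * of_int p1 * A1 * B1 + of_int d1 * B1 + of_int p2 * of_int q1 * B1 + of_int q2 * (of_int p2 * B2)"
      unfolding e4 by (simp add: algebra_simps)
    also have "\<dots> = B1 * (2 * of_int c2 * A1 + of_int c1)"
      unfolding e2' by (simp add: c2_def c1_def algebra_simps)
    finally show ?thesis .
  qed
  have "A1 \<in> range (ev (zt m))"
    using hat_range[of m, folded N_def] unfolding A1_def al_def by blast
  then obtain P where P: "A1 = ev (zt m) P" by blast
  \<comment> \<open>For \<open>B1 = 0\<close> the entry \<open>A1\<close> is itself a root.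
    Otherwise two roots are the eigenvalues, which may lie outside the ring, but the third root
    \<open>c2 - 2 * A1\<close> lies in it.\<close>
  have "\<exists>x \<in> range (ev (zt m)). x ^ 3 = of_int c2 * x ^ 2 + of_int c1 * x + of_int c0"
  proof (cases "B1 = 0")
    case True
    then have "bb = 0" by (simp add: bb_def)
    then show ?thesis using cub_a P by auto
  next
    case False
    then have "3 * A1 ^ 2 + bb = 2 * of_int c2 * A1 + of_int c1" using cub_b by simp
    from cubic_third_root[OF cub_a this]
    have "(of_int c2 - 2 * A1) ^ 3 = of_int c2 * (of_int c2 - 2 * A1) ^ 2 + of_int c1 * (of_int c2 - 2 * A1) + of_int c0" .
    moreover have "of_int c2 - 2 * A1 = ev (zt m) ([:c2:] - [:2:] * P)" by (simp add: P)
    ultimately show ?thesis by (metis rangeI)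
  qed
  then obtain x where x: "x \<in> range (ev (zt m))" "x ^ 3 = of_int c2 * x ^ 2 + of_int c1 * x + of_int c0" by blast
  obtain k :: int where k: "k ^ 3 = c2 * k ^ 2 + c1 * k + c0" using cubic_integer_root[OF x] by blast
  \<comment> \<open>The cubic is \<open>(x - k) * (x ^ 2 + p * x + q)\<close>. Below,
    \<open>ha\<close> and \<open>B1 * R\<close> are the entries of the quadratic factor at the
    matrix of \<open>W y1\<close>.\<close>
  define p where "p = k - c2"
  define q where "q = k ^ 2 - c2 * k - c1"
  have c0': "c0 = k * q" using k by (simp add: q_def power2_eq_square power3_eq_cube algebra_simps)
  have c1': "c1 = k * p - q" and c2': "c2 = k - p"
    by (simp_all add: p_def q_def power2_eq_square algebra_simps)
  define K :: complex where "K = of_int k"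
  define R where "R = 2 * A1 + of_int p"
  define ha where "ha = A1 ^ 2 + bb + of_int p * A1 + of_int q"
  have ha_a: "(A1 - K) * ha + bb * R = 0"
    using cub_a unfolding c0' c1' c2' ha_def K_def R_def
    by (simp add: power2_eq_square power3_eq_cube algebra_simps)
  have ha_b: "B1 * ((A1 - K) * R + ha) = 0"
  proof -
    have "B1 * ((A1 - K) * R + ha) = B1 * (3 * A1 ^ 2 + bb) - B1 * (2 * of_int c2 * A1 + of_int c1)"
      unfolding c1' c2' ha_def K_def R_def by (simp add: power2_eq_square algebra_simps)
    then show ?thesis using cub_b by simp
  qed
  have R_ne: "R \<noteq> 0" if "B1 \<noteq> 0"
  proof
    assume "R = 0"
    then have "of_int 2 * A1 = of_int (- p)" by (simp add: R_def add_eq_0_iff)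
    from A1_int[OF this] have A0: "A1 = 0" by simp
    have "ha = 0" using ha_b \<open>R = 0\<close> that by simp
    then have "bb = of_int (- q)" by (simp add: ha_def A0 add_eq_0_iff2)
    then show False using A1_ne A0 by blast
  qed
  show False
  proof (cases "B1 = 0")
    case True
    then have bb0: "bb = 0" by (simp add: bb_def)
    have "A1 \<noteq> K" using A1_int[of 1 k] zinv1 True by (auto simp: K_def)
    then have "ha = 0" using ha_a bb0 by simp
    then have "Al (\<lambda>x. C11 x + p * W y1 x) = of_int (- q)"
      using bb0 True by (simp add: ha_def al_linear C11_def Al_conv W_Fun A1_def[symmetric] B1_def[symmetric] power2_eq_square add_eq_0_iff)
    from Al_int(1)[OF Fun_per[OF Fun_add[OF CF(1) Fun_cmult[OF W_Fun]]] this]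
    have dq: "d1 = - q" using d1 class_z[OF out(1)] by simp
    obtain c where c: "d1 = 4 * c" using four_dvd[OF out(1)] by (auto simp: d1_def)
    have "Al (W y1) * (Al (W y1) - of_int (- p)) = 4 * of_int c"
    proof -
      have "A1 * (A1 + of_int p) = of_int d1"
        using \<open>ha = 0\<close> bb0 by (simp add: ha_def dq power2_eq_square algebra_simps add_eq_0_iff)
      then show ?thesis by (simp add: c A1_def)
    qed
    from quadratic_no_split[OF W_Fun _ _ this] class_z[OF out(1)]
    have "W y1 (False, i + M) = W y1 (False, i)" for i by (intro diff_01) simp
    then have "A1 = 0" using Al_Be_zero(1)[OF Fun_per[OF W_Fun]] by (simp add: A1_def)
    then show False using zinv1 True by simp
  next
    case False
    then have ha: "ha = - ((A1 - K) * R)" using ha_b by (simp add: add_eq_0_iff)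
    \<comment> \<open>So \<open>k\<close> is one of the two eigenvalues of the matrix.\<close>
    have bK: "bb = (A1 - K) ^ 2"
    proof -
      have "(bb - (A1 - K) ^ 2) * R = 0" using ha_a unfolding ha by (simp add: power2_eq_square algebra_simps)
      then show ?thesis using R_ne[OF False] by simp
    qed
    have A_ne: "A1 \<noteq> 0"
    proof
      assume "A1 = 0"
      then have "bb = of_int (k ^ 2)" using bK by (simp add: K_def)
      then show False using A1_ne \<open>A1 = 0\<close> by blast
    qed
    have ha2: "2 * ha = of_int (q + k ^ 2 + k * p)"
    proof -
      have "2 * ha = ha + - ((A1 - K) * R)" by (simp add: ha)
      also have "\<dots> = of_int (q + k ^ 2 + k * p)"
        unfolding ha_def bK R_def K_def by (simp add: power2_eq_square algebra_simps)
      finally show ?thesis .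
    qed
    define k1 where "k1 = p1 + p"
    \<comment> \<open>The quadratic factor at \<open>W y1\<close>, modulo invariant elements and
      without its scalar part \<open>d1 + q\<close>.\<close>
    define F where "F x = k1 * W y1 x + p2 * W y2 x" for x
    have F: "F \<in> Fun" unfolding F_def by (intro Fun_add Fun_cmult W_Fun)
    have AF: "Al F = of_int k1 * A1 + of_int p2 * A2" and BF: "Be F = of_int k1 * B1 + of_int p2 * B2"
      unfolding F_def by (simp_all add: al_linear A1_def A2_def B1_def B2_def)
    have haF: "ha = of_int (d1 + q) + Al F"
      unfolding AF e1' by (simp add: ha_def k1_def power2_eq_square algebra_simps)
    have "of_int 2 * Al F = of_int (q + k ^ 2 + k * p - 2 * (d1 + q))"
      using ha2 haF by (simp add: algebra_simps)
    from Al_not_int[OF F _ this] class_z out have AF0: "Al F = 0" by (simp add: F_def)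
    have BF': "Be F = B1 * R"
      unfolding BF e2' by (simp add: k1_def R_def algebra_simps)
    have BF_ne: "Be F \<noteq> 0" using BF' False R_ne by simp
    have "cnj R = R" using cnj_al[OF W_Fun, of 1 y1] by (simp add: R_def A1_def)
    then have "Be F * cnj (Be F) = bb * R ^ 2" unfolding BF' bb_def by (simp add: power2_eq_square)
    also have "\<dots> = ha ^ 2" unfolding bK ha by (simp add: power_mult_distrib)
    also have "\<dots> = of_int ((d1 + q) ^ 2)" using haF AF0 by simp
    finally have BFF: "Be F * cnj (Be F) = of_int ((d1 + q) ^ 2)" .
    have n3: "\<not> E y3 y1" "\<not> E y3 y2" using distinct E_sym by blast+
    have W3: "Al (W y3) = - (A1 + A2)" "Be (W y3) = - (B1 + B2)"
      using expand[OF W_Fun, of y3] class_z[OF out(3)] n3 E_refl[of y3]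
      by (simp_all add: A1_def A2_def B1_def B2_def)
    \<comment> \<open>\<open>F\<close> has the values \<open>k1\<close>, \<open>p2\<close> and 0 on
      the three classes. If two of them coincide, \<open>F\<close> is modulo invariant elements a
      multiple of a single class; if all differ, the class of \<open>y1\<close> is a level set of
      \<open>F\<close> and inherits its invariance on rotations.\<close>
    consider "k1 = p2" | "k1 = 0" "p2 \<noteq> 0" | "p2 = 0" "k1 \<noteq> 0" | "k1 \<noteq> 0" "p2 \<noteq> 0" "k1 \<noteq> p2" by blast
    then show False
    proof cases
      case 1
      have "k1 \<noteq> 0" using BF_ne BF 1 by auto
      have "of_int k1 * (A1 + A2) = 0" using AF AF0 1 by (simp add: ring_distribs)
      then have "Al (W y3) = 0" using W3(1) \<open>k1 \<noteq> 0\<close> by simp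
      moreover have "Be F = - (of_int k1 * Be (W y3))" using BF W3(2) 1 by (simp add: ring_distribs)
      then have "of_int (k1 * k1) * (Be (W y3) * cnj (Be (W y3))) = of_int ((d1 + q) ^ 2)"
        using BFF by (simp add: mult_ac)
      ultimately show False using no_rational[OF out(3)] \<open>k1 \<noteq> 0\<close> by blast
    next
      case 2
      then have "Al (W y2) = 0" using AF AF0 by (simp add: A2_def)
      moreover have "of_int (p2 * p2) * (Be (W y2) * cnj (Be (W y2))) = of_int ((d1 + q) ^ 2)"
        using BFF BF 2 by (simp add: B2_def mult_ac)
      ultimately show False using no_rational[OF out(2)] 2 by blast
    next
      case 3
      then show False using AF AF0 A_ne by simp
    next
      case 4
      have "W y1 (False, i + M) = W y1 (False, i)" for i
      proof -
        have W1: "E y1 x \<longleftrightarrow> F x = k1" for x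
        proof -
          have "\<not> (E y1 x \<and> E y2 x)" using distinct(1) E_sym E_trans by meson
          then show ?thesis using 4 by (auto simp: F_def ind_def)
        qed
        have "F (False, i + M) = F (False, i)" using AF0 Al_Be_zero(1)[OF Fun_per[OF F]] by blast
        then show ?thesis by (simp add: ind_def W1)
      qed
      then have "A1 = 0" using Al_Be_zero(1)[OF Fun_per[OF W_Fun]] by (simp add: A1_def)
      then show False using A_ne by simp
    qed
  qed
qed

end

section \<open>The largest S-ring subgroup of rotations\<close>

context coordinate_sring
begin

definition "Kp x \<longleftrightarrow> (\<forall>y. E x y \<longrightarrow> \<not> fst y)"

lemma Kp_E: "E x y \<Longrightarrow> Kp x \<Longrightarrow> Kp y"
  using E_trans unfolding Kp_def by blast

lemma Kp_fst: "Kp x \<Longrightarrow> \<not> fst x"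
  using E_refl unfolding Kp_def by blast

lemma not_Kp: "\<not> Kp x \<Longrightarrow> \<exists>i. E x (True, i)"
  unfolding Kp_def by (metis (full_types) prod.exhaust_sel)

lemma conv_rotations:
  assumes "\<And>i. f (True, i) = 0" "\<And>i. g (True, i) = 0"
  shows "conv N f g (True, j) = 0" "conv N f g (False, j) = S N (\<lambda>i. f (False, i) * g (False, j - i))"
  using assms by (simp_all add: conv_True conv_False S_def)

lemma Kp_uminus: "Kp (False, i) \<Longrightarrow> Kp (False, - i)"
proof -
  assume K: "Kp (False, i)"
  have "\<not> fst y" if "E (False, - i) y" for y
  proof -
    have "E (False, i) (pinv y)" using E_inv[OF that] by simp
    then show ?thesis using K unfolding Kp_def by (force simp: pinv_def)
  qed
  then show ?thesis unfolding Kp_def by blast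
qed

text \<open>The square of \<open>K\<close> has no reflections in its support but a positive
  coefficient at the rotation \<open>i - j\<close>, so no reflection can be in the class of that
  rotation.\<close>

lemma Kp_diff: assumes "Kp (False, i)" "Kp (False, j)" shows "Kp (False, i - j)"
proof (rule ccontr)
  assume "\<not> ?thesis"
  then obtain t where t: "E (False, i - j) (True, t)" using not_Kp by blast
  let ?K = "ind Kp"
  have K: "?K \<in> Fun" using Kp_E by (rule ind_Fun)
  have KT: "?K (True, a) = 0" for a using Kp_fst[of "(True, a)"] by force
  have "S N (\<lambda>a. ?K (False, a) * ?K (False, i - j - a)) = 0"
    using FunD[OF Fun_conv[OF K K] t] conv_rotations[of ?K ?K, OF KT KT] by simp
  moreover have "periodic N (\<lambda>a. ?K (False, a) * ?K (False, i - j - a))"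
    using perD[OF Fun_per[OF K], of False] per_shift(4)[OF perD[OF Fun_per[OF K], of False], of "i - j"]
    by (simp add: periodic_def)
  ultimately have "\<forall>a. ?K (False, a) * ?K (False, i - j - a) = 0"
    using S_zero_iff[OF N_pos, of "\<lambda>a. ?K (False, a) * ?K (False, i - j - a)"] by (simp del: mult_eq_0_iff)
  from this[rule_format, of i] show False using assms Kp_uminus[of j] by simp
qed

lemma Kp_N: "N dvd i \<Longrightarrow> Kp (False, i)"
  unfolding Kp_def using E_one'[of "(False, i)"] by auto

lemma rotation_subgroup: obtains k where "k \<le> Suc m" "\<And>i. Kp (False, i) \<longleftrightarrow> 2 ^ k dvd i"
proof (rule int_subgroup_two_power[of "\<lambda>i. Kp (False, i)" "Suc m"])
  show "Kp (False, 2 ^ Suc m)" by (rule Kp_N) (simp only: N_def dvd_refl)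
qed (use Kp_diff that in auto)

lemma rotation_class: "Kp x \<Longrightarrow> E x (p, j) \<Longrightarrow> p = False"
  unfolding Kp_def by force

text \<open>Modulo 2, the square of a set of rotations only sees the square roots.\<close>

lemma conv_parity:
  assumes "f \<in> Fun" "\<And>i. f (True, i) = 0" "\<And>i. f (False, i) = 0 \<or> f (False, i) = 1"
  shows "N dvd 2 * a - x \<Longrightarrow> even (conv N f f (False, x) - (f (False, a) + f (False, a + M)))"
    and "(\<And>i. \<not> N dvd 2 * i - x) \<Longrightarrow> even (conv N f f (False, x))"
proof -
  have per: "periodic N (\<lambda>i. f (False, i))" by (rule perD[OF Fun_per[OF assms(1)]])
  have 1: "even (conv N f f (False, x) - S N (\<lambda>i. if N dvd 2 * i - x then f (False, i) else 0))"
    using S_square_parity[OF N_pos per assms(3)] by (simp add: conv_rotations assms(2))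
  then show "(\<And>i. \<not> N dvd 2 * i - x) \<Longrightarrow> even (conv N f f (False, x))"
    by (simp add: S_def)
  assume a: "N dvd 2 * a - x"
  have "N dvd 2 * i - x \<longleftrightarrow> M dvd i - a" for i
  proof -
    have "2 * i - x = 2 * (i - a) + (2 * a - x)" by simp
    then have "N dvd 2 * i - x \<longleftrightarrow> N dvd 2 * (i - a)" using a by (metis dvd_add_left_iff)
    then show ?thesis by (simp only: N_M dvd_mult_cancel_left) simp
  qed
  then have "S N (\<lambda>i. if N dvd 2 * i - x then f (False, i) else 0) =
      S (M * 2) (\<lambda>i. (if M dvd i - a then 1 else 0) * f (False, i))"
    unfolding N_M by (intro arg_cong2[where f = S]) (auto simp: mult.commute)
  also have "\<dots> = S 2 (\<lambda>j. f (False, a + M * j))"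
    by (rule S_dvd_coset[OF M_pos]) (use per in \<open>simp_all add: N_M mult.commute\<close>)
  also have "\<dots> = f (False, a) + f (False, a + M)"
  proof -
    have "{0..<2::int} = {0, 1}" by auto
    then show ?thesis by (simp add: S_def)
  qed
  finally show "even (conv N f f (False, x) - (f (False, a) + f (False, a + M)))" using 1 by simp
qed

end

section \<open>One further basic set of rotations besides 1 and the class of the central
  involution\<close>

context symmetric_sring
begin

context
  fixes k :: nat and q :: int
  assumes k_le: "k \<le> m"
    and K_classes: "2 ^ k dvd i \<longleftrightarrow> N dvd i \<or> E (False, M) (False, i) \<or> E (False, q) (False, i)"
    and z_rot: "\<not> E (False, M) (True, i)" and q_rot: "\<not> E (False, q) (True, i)"
    and zq: "\<not> E (False, M) (False, q)" and q_ne: "\<not> N dvd q"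
begin

abbreviation (input) "P i \<equiv> E (False, M) (False, i)"
abbreviation (input) "Q i \<equiv> E (False, q) (False, i)"
abbreviation (input) "Wq \<equiv> ind (E (False, q))"

lemma K_M: "2 ^ k dvd (i + M) \<longleftrightarrow> (2 :: int) ^ k dvd i"
proof -
  have "(2 :: int) ^ k dvd M" using k_le by (simp add: M_def le_imp_power_dvd)
  then show ?thesis by (rule dvd_add_left_iff)
qed

lemma not_dvd: "P i \<Longrightarrow> \<not> N dvd i" "Q i \<Longrightarrow> \<not> N dvd i"
proof -
  have "\<not> N dvd M" using N_M M_pos zdvd_imp_le[of N M] by auto
  then show "P i \<Longrightarrow> \<not> N dvd i" using E_one'[OF E_sym, of "(False, M)" "(False, i)"] by auto
  show "Q i \<Longrightarrow> \<not> N dvd i" using E_one'[OF E_sym, of "(False, q)" "(False, i)"] q_ne by auto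
qed

lemma Q_M: "Q i \<Longrightarrow> \<not> M dvd i"
proof
  assume Q: "Q i" and "M dvd i"
  then obtain "N dvd i - M" using M_dvd_cases not_dvd(2) by metis
  then have "Wq (False, i) = Wq (False, M)"
    using periodic_cong[OF perD[OF Fun_per[OF class_Fun]]] by metis
  then show False using Q zq E_sym by (auto simp: ind_def split: if_splits)
qed

text \<open>Parity of the square of \<open>Q\<close>: it is odd at the double of a split element and
  even at a generator of \<open>K\<close>. So \<open>P\<close> and \<open>Q\<close> have different
  parities, and the odd one is closed under taking square roots, which contradicts doubling
  descent.\<close>

lemma Q_z_inv: "Q (i + M) \<longleftrightarrow> Q i"
proof (rule ccontr)
  assume "Q (i + M) \<noteq> Q i"
  then have "\<exists>a. Q a \<and> \<not> Q (a + M)"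
  proof (cases "Q i")
    case False
    have "E (False, i + M + M) (False, i)" using E_sym[OF E_per[of False i]] by (simp add: N_M add.assoc)
    then have "Q (i + M)" "\<not> Q (i + M + M)"
      using \<open>Q (i + M) \<noteq> Q i\<close> False E_trans by blast+
    then show ?thesis by blast
  qed auto
  then obtain a where a: "Q a" "\<not> Q (a + M)" by blast
  let ?D = "\<lambda>x. conv N Wq Wq (False, x)"
  have W_Fun: "Wq \<in> Fun" by (rule class_Fun)
  have D: "even (?D x) = even (?D y)" if "E (False, x) (False, y)" for x y
    using FunD[OF Fun_conv[OF W_Fun W_Fun] that] by simp
  have DP: "P x \<Longrightarrow> P y \<Longrightarrow> even (?D x) = even (?D y)" and DQ: "Q x \<Longrightarrow> Q y \<Longrightarrow> even (?D x) = even (?D y)" for x y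
    using D E_trans E_sym by blast+
  have WT: "Wq (True, i) = 0" for i using q_rot by simp
  have W01: "Wq (False, i) = 0 \<or> Wq (False, i) = 1" for i by (simp add: ind_def)
  note parity = conv_parity[OF W_Fun WT W01]
  have odd_a: "odd (?D (2 * a))" using parity(1)[of a "2 * a"] a by simp
  \<comment> \<open>A generator of \<open>K\<close> has no square root inside
    \<open>K\<close>.\<close>
  have even_k: "even (?D (2 ^ k))"
  proof (cases "\<exists>i. N dvd 2 * i - 2 ^ k")
    case True
    then obtain i where i: "N dvd 2 * i - 2 ^ k" by blast
    have "\<not> 2 ^ k dvd i"
    proof
      assume "2 ^ k dvd i"
      then have "2 ^ Suc k dvd 2 * i" by simp
      moreover have "2 ^ Suc k dvd 2 * i - 2 ^ k"
        using dvd_trans[OF _ i, of "2 ^ Suc k"] k_le by (simp add: N_def le_imp_power_dvd)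
      ultimately have "(2 :: int) ^ Suc k dvd 2 ^ k" by (simp add: dvd_diff_right_iff)
      then show False using zdvd_imp_le[of "2 ^ Suc k" "2 ^ k"] by simp
    qed
    then have "Wq (False, i) = 0" "Wq (False, i + M) = 0" using K_classes K_M by auto
    then show ?thesis using parity(1)[OF i] by simp
  qed (use parity(2) in blast)
  have root: "\<exists>j. P j \<and> N dvd 2 * j - x" "\<exists>j. Q j \<and> N dvd 2 * j - x" if x: "odd (?D x)" "\<not> N dvd x" for x
  proof -
    obtain i where i: "N dvd 2 * i - x" using parity(2) x(1) by blast
    have i': "N dvd 2 * (i + M) - x"
    proof -
      have "2 * (i + M) - x = (2 * i - x) + N" by (simp add: N_M)
      then show ?thesis using i by (metis dvd_add dvd_refl)
    qed
    have "odd (Wq (False, i) + Wq (False, i + M))" using parity(1)[OF i] x(1) by simp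
    then have cases: "Q i \<and> \<not> Q (i + M) \<or> Q (i + M) \<and> \<not> Q i" by (auto simp: ind_def split: if_splits)
    have nd: "\<not> N dvd j" if "N dvd 2 * j - x" for j
    proof
      assume "N dvd j"
      then have "N dvd 2 * j" by simp
      then show False using that x(2) dvd_diff_right_iff by blast
    qed
    have "2 ^ k dvd i" "2 ^ k dvd i + M" using cases K_classes K_M by blast+
    then have "Q i \<and> P (i + M) \<or> Q (i + M) \<and> P i"
      using cases K_classes nd[OF i] nd[OF i'] by blast
    then show "\<exists>j. P j \<and> N dvd 2 * j - x" "\<exists>j. Q j \<and> N dvd 2 * j - x" using i i' by blast+
  qed
  have "\<not> N dvd 2 * a" using Q_M[OF a(1)] by (simp add: N_M)
  moreover have "2 ^ k dvd 2 * a" using K_classes[of a] a(1) by simp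
  ultimately have a2: "P (2 * a) \<or> Q (2 * a)" using K_classes by blast
  have "\<not> N dvd 2 ^ k" using zdvd_imp_le[of N "2 ^ k"] power_strict_increasing[of k "Suc m" "2 :: int"] k_le by (auto simp: N_def)
  then have "P (2 ^ k) \<or> Q (2 ^ k)" using K_classes[of "2 ^ k"] by simp
  then show False
  proof
    assume "P (2 ^ k)"
    then have "\<not> P (2 * a)" using DP even_k odd_a by blast
    then have "Q (2 * a)" using a2 by blast
    then have "odd (?D x)" if "Q x" for x using DQ odd_a that by blast
    then have "\<exists>y. Q y \<and> 2 ^ Suc m dvd 2 * y - x" if "Q x" for x using root(2) not_dvd(2) that unfolding N_def[symmetric] by blast
    then have "2 ^ Suc m dvd a" using a(1) by (rule doubling_descent)
    then show False using not_dvd(2)[OF a(1)] unfolding N_def by blast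
  next
    assume "Q (2 ^ k)"
    then have "\<not> Q (2 * a)" using DQ even_k odd_a by blast
    then have "P (2 * a)" using a2 by blast
    then have "odd (?D x)" if "P x" for x using DP odd_a that by blast
    then have "\<exists>y. P y \<and> 2 ^ Suc m dvd 2 * y - x" if "P x" for x using root(1) not_dvd(1) that unfolding N_def[symmetric] by blast
    then have "2 ^ Suc m dvd M" using E_refl by (rule doubling_descent)
    then show False using not_dvd(1)[OF E_refl] unfolding N_def by blast
  qed
qed

text \<open>An element stabilizes \<open>Q\<close> exactly if the coefficient of the square of
  \<open>Q\<close> there equals the size of \<open>Q\<close>, a condition that is constant on basic
  sets. The central involution satisfies it and \<open>q\<close> does not.\<close>

lemma stabilizer_of_third_class:
  obtains r where "r \<le> m" "\<And>i. 2 ^ r dvd i \<longleftrightarrow> N dvd i \<or> P i" "\<And>i j. 2 ^ r dvd j \<Longrightarrow> Q i \<Longrightarrow> Q (i + j)"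
proof -
  define st where "st i \<longleftrightarrow> (\<forall>j. Q (j + i) \<longleftrightarrow> Q j)" for i
  have st_diff: "st (i - j)" if "st i" "st j" for i j
    unfolding st_def
  proof
    fix t
    have "Q (t + (i - j)) \<longleftrightarrow> Q (t + (i - j) + j)" using that(2) by (simp only: st_def)
    also have "t + (i - j) + j = t + i" by simp
    finally show "Q (t + (i - j)) \<longleftrightarrow> Q t" using that(1) by (simp only: st_def)
  qed
  have "st (2 ^ m)" using Q_z_inv by (simp add: st_def M_def)
  with st_diff obtain r where r: "r \<le> m" "\<And>i. st i \<longleftrightarrow> 2 ^ r dvd i"
    using int_subgroup_two_power[of st m] by metis
  have W_Fun: "Wq \<in> Fun" by (rule class_Fun)
  have Q_minus: "Q (- i) \<longleftrightarrow> Q i" for i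
    using E_pinv[of "(False, i)"] E_sym E_trans unfolding pinv_simps by blast
  have WT: "Wq (True, i) = 0" for i using q_rot by simp
  have conv: "conv N Wq Wq (False, x) = S N (\<lambda>i. Wq (False, i) * Wq (False, i - x))" for x
  proof -
    have "Wq (False, x - i) = Wq (False, i - x)" for i using Q_minus[of "i - x"] by (simp add: ind_def)
    then show ?thesis by (simp add: conv_rotations WT)
  qed
  have conv_st: "conv N Wq Wq (False, x) = S N (\<lambda>i. Wq (False, i)) \<longleftrightarrow> (\<forall>i. Q i \<longrightarrow> Q (i - x))" for x
  proof -
    let ?u = "\<lambda>i. Wq (False, i) - Wq (False, i) * Wq (False, i - x)"
    have per: "periodic N ?u"
      using perD[OF Fun_per[OF W_Fun], of False] per_shift(3)[OF perD[OF Fun_per[OF W_Fun], of False], of x]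
      by (simp add: periodic_def)
    have "S N ?u = 0 \<longleftrightarrow> (\<forall>i. ?u i = 0)" by (rule S_zero_iff[OF N_pos per]) (simp add: ind_def)
    moreover have "S N ?u = S N (\<lambda>i. Wq (False, i)) - conv N Wq Wq (False, x)" by (simp add: S_diff conv)
    moreover have "?u i = 0 \<longleftrightarrow> (Q i \<longrightarrow> Q (i - x))" for i by (simp add: ind_def)
    ultimately show ?thesis by auto
  qed
  have "2 ^ r dvd i \<longleftrightarrow> N dvd i \<or> P i" for i
  proof
    assume i: "2 ^ r dvd i"
    then have si: "st i" by (simp add: r)
    have "Q (q + i)" using si E_refl by (simp add: st_def)
    then have "2 ^ k dvd (q + i)" "2 ^ k dvd q" using K_classes E_refl by blast+
    then have "2 ^ k dvd i" using dvd_add_right_iff by blast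
    moreover have "\<not> Q i"
    proof
      assume Qi: "Q i"
      have "st (- i)" using i by (simp add: r)
      then have "\<forall>j. Q j \<longrightarrow> Q (j - i)" by (simp add: st_def)
      then have "conv N Wq Wq (False, i) = S N (\<lambda>i. Wq (False, i))" by (simp only: conv_st)
      moreover have "conv N Wq Wq (False, q) = conv N Wq Wq (False, i)"
        using FunD[OF Fun_conv[OF W_Fun W_Fun] Qi] .
      ultimately have "\<forall>i. Q i \<longrightarrow> Q (i - q)" by (simp only: conv_st[symmetric])
      then have "Q (q - q)" using E_refl by blast
      then show False using not_dvd(2) by fastforce
    qed
    ultimately show "N dvd i \<or> P i" using K_classes by blast
  next
    assume "N dvd i \<or> P i"
    then show "2 ^ r dvd i"
    proof
      assume "N dvd i"
      moreover have "(2 :: int) ^ r dvd N" unfolding N_def using r(1) by (intro le_imp_power_dvd) simp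
      ultimately show ?thesis by (rule dvd_trans[rotated])
    next
      assume Pi: "P i"
      have "\<forall>i. Q i \<longrightarrow> Q (i - M)" using Q_z_inv by (metis diff_add_cancel)
      then have "conv N Wq Wq (False, M) = S N (\<lambda>i. Wq (False, i))" by (simp only: conv_st)
      moreover have "conv N Wq Wq (False, M) = conv N Wq Wq (False, i)"
        using FunD[OF Fun_conv[OF W_Fun W_Fun] Pi] .
      ultimately have *: "Q j \<Longrightarrow> Q (j - i)" for j using conv_st by metis
      have "Q j \<Longrightarrow> Q (j + i)" for j using *[of "- j"] Q_minus[of j] Q_minus[of "j + i"] by simp
      then have "st i" using * unfolding st_def by (metis add_diff_cancel_right')
      then show ?thesis by (simp add: r)
    qed
  qed
  moreover have "Q (i + j)" if "2 ^ r dvd j" "Q i" for i j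
    using that r(2)[of j] by (simp add: st_def)
  ultimately show ?thesis using that r(1) by blast
qed

end

end

section \<open>The case distinction\<close>

context coordinate_sring
begin

text \<open>In coordinates: invariance under \<open>c\<^sup>i \<mapsto> c\<^sup>-\<^sup>i\<close> and under the reflection of the points \<open>c\<^sup>i s\<close>
  in \<open>c\<^sup>g s\<close>, which yields an S-ring over an abelian group; a wreath product; a divisible
  difference set.\<close>

definition "symm \<longleftrightarrow> (\<forall>i. E (False, i) (False, - i)) \<and> (\<exists>g. \<forall>i. E (True, g + i) (True, g - i))"

definition "wreath \<longleftrightarrow> (\<exists>r\<le>m. (\<forall>i y. 2 ^ r dvd i \<longrightarrow> E (False, i) y \<longrightarrow> \<not> fst y \<and> 2 ^ r dvd snd y) \<and>
  (\<forall>p i j. p \<or> \<not> 2 ^ r dvd i \<longrightarrow> 2 ^ r dvd j \<longrightarrow> E (p, i) (p, i + j)))"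

definition "dds \<longleftrightarrow> (\<exists>r\<le>m. \<exists>t1 t2. (\<forall>p j. E (False, M) (p, j) \<longleftrightarrow> \<not> p \<and> 2 ^ r dvd j \<and> \<not> N dvd j) \<and>
  (\<forall>p j. E (False, 1) (p, j) \<longleftrightarrow> \<not> p \<and> \<not> 2 ^ r dvd j) \<and> r > 0 \<and>
  \<not> E (True, t1) (True, t2) \<and> (\<forall>j. E (True, t1) (True, j) \<or> E (True, t2) (True, j)))"

text \<open>\<open>X\<close> is the sum over a class under a character of order two. For different
  classes the product of two such sums is minus the coefficient at the central involution, hence not
  positive, and three nonzero numbers cannot have pairwise different signs.\<close>

lemma no_three_reflection_classes:
  assumes rot: "\<And>i. \<not> N dvd i \<Longrightarrow> E (False, M) (False, i)" "\<And>i. \<not> E (False, M) (True, i)"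
    and distinct: "\<not> E (True, t1) (True, t2)" "\<not> E (True, t1) (True, t3)" "\<not> E (True, t2) (True, t3)"
    and cover: "\<And>j. E (True, t1) (True, j) \<or> E (True, t2) (True, j) \<or> E (True, t3) (True, j)"
  shows False
proof -
  let ?Y = "\<lambda>t. ind (E (True, t))"
  define s :: "int \<Rightarrow> int" where "s i = (if even i then 1 else - 1)" for i
  define X where "X t = S N (\<lambda>i. ?Y t (True, i) * s i)" for t
  have Y: "?Y t \<in> Fun" for t by (rule class_Fun)
  have per_Y: "periodic N (\<lambda>i. ?Y t (p, i))" for t p by (rule perD[OF Fun_per[OF Y]])
  have YF: "?Y t (False, i) = 0" for t i
  proof (cases "N dvd i")
    case True
    then have "E (False, 0) (False, i)" by (simp add: E_one)
    then show ?thesis using E_one'[of "(False, i)" "(True, t)"] E_sym True by auto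
  next
    case False
    then show ?thesis using rot E_sym E_trans by (metis ind_simps(2))
  qed
  have conv: "conv N (?Y t) (?Y u) (False, x) = S N (\<lambda>i. ?Y t (True, i) * ?Y u (True, i - x))" for t u x
    unfolding conv_False YF by (simp add: S_def)
  have per_s: "periodic N s" by (simp add: periodic_def s_def N_M)
  have s_diff: "s j * s (j - x) = s x" for j x by (auto simp: s_def)
  have "s (j + 1) = - s j" for j by (simp add: s_def)
  then have "S N s = S N (\<lambda>j. - s j)" using S_shift[OF N_pos per_s, of 1] by simp
  then have s0: "S N s = 0" by (simp add: S_def sum_negf)
  have conv_const: "conv N (?Y t) (?Y u) (False, x) = conv N (?Y t) (?Y u) (False, M) +
      (if N dvd x - 0 then 1 else 0) * (conv N (?Y t) (?Y u) (False, 0) - conv N (?Y t) (?Y u) (False, M))" for t u x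
  proof -
    have C: "conv N (?Y t) (?Y u) \<in> Fun" by (intro Fun_conv Y)
    show ?thesis using FunD[OF C, of "(False, 0)" "(False, x)"] FunD[OF C rot(1)[of x]] E_one[of False x] by auto
  qed
  have XX: "X t * X u = conv N (?Y t) (?Y u) (False, 0) - conv N (?Y t) (?Y u) (False, M)" for t u
  proof -
    let ?c = "\<lambda>x. conv N (?Y t) (?Y u) (False, x)"
    have "X t * X u = S N (\<lambda>i. S N (\<lambda>j. ?Y t (True, i) * s i * (?Y u (True, j) * s j)))"
      by (simp add: X_def S_def sum_product)
    also have "\<dots> = S N (\<lambda>i. S N (\<lambda>x. ?Y t (True, i) * s i * (?Y u (True, i - x) * s (i - x))))"
    proof (rule S_cong)
      fix i
      have "periodic N (\<lambda>j. ?Y t (True, i) * s i * (?Y u (True, j) * s j))"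
        using per_Y[of u True] per_s by (simp add: periodic_def)
      from S_reflect[OF N_pos this, of i]
      show "S N (\<lambda>j. ?Y t (True, i) * s i * (?Y u (True, j) * s j)) =
          S N (\<lambda>x. ?Y t (True, i) * s i * (?Y u (True, i - x) * s (i - x)))" by simp
    qed
    also have "\<dots> = S N (\<lambda>i. S N (\<lambda>x. s x * (?Y t (True, i) * ?Y u (True, i - x))))"
    proof (intro S_cong)
      fix i x
      have "?Y t (True, i) * s i * (?Y u (True, i - x) * s (i - x)) =
          (s i * s (i - x)) * (?Y t (True, i) * ?Y u (True, i - x))" by (simp only: mult_ac)
      then show "?Y t (True, i) * s i * (?Y u (True, i - x) * s (i - x)) = s x * (?Y t (True, i) * ?Y u (True, i - x))"
        by (simp only: s_diff)
    qed
    also have "\<dots> = S N (\<lambda>x. s x * ?c x)" by (subst S_swap) (simp add: S_cmult conv)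
    also have "\<dots> = S N (\<lambda>x. ?c M * s x + (if N dvd x - 0 then 1 else 0) * ((?c 0 - ?c M) * s x))"
      by (subst conv_const, rule S_cong) (simp add: algebra_simps)
    also have "\<dots> = ?c 0 - ?c M"
    proof -
      have "periodic N (\<lambda>x. (?c 0 - ?c M) * s x)" using per_s by (simp add: periodic_def)
      from S_delta[OF N_pos this, of 0] show ?thesis by (simp only: S_add S_cmult s0) (simp add: s_def)
    qed
    finally show ?thesis .
  qed
  have neg: "X t * X u \<le> 0" if "\<not> E (True, t) (True, u)" for t u
  proof -
    have "?Y t (True, i) * ?Y u (True, i) = 0" for i
    proof -
      have "\<not> (E (True, t) (True, i) \<and> E (True, u) (True, i))" using that E_sym E_trans by meson
      then show ?thesis by (simp add: ind_def)
    qed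
    then have "conv N (?Y t) (?Y u) (False, 0) = 0" by (simp add: conv S_def del: mult_eq_0_iff)
    moreover have "0 \<le> conv N (?Y t) (?Y u) (False, M)" unfolding conv by (rule S_nonneg) simp
    ultimately show ?thesis by (simp add: XX)
  qed
  \<comment> \<open>If the sum vanished, all coefficients of the square at rotations would be
    maximal, and the class would contain all reflections.\<close>
  have nz: "X t \<noteq> 0" if "\<exists>j. \<not> E (True, t) (True, j)" for t
  proof
    assume "X t = 0"
    then have "conv N (?Y t) (?Y t) (False, 0) = conv N (?Y t) (?Y t) (False, M)" using XX[of t t] by simp
    then have c: "conv N (?Y t) (?Y t) (False, x) = conv N (?Y t) (?Y t) (False, 0)" for x
      using conv_const[of t t x] by simp
    have "E (True, t) (True, t - x)" for x
    proof -
      let ?u = "\<lambda>i. ?Y t (True, i) - ?Y t (True, i) * ?Y t (True, i - x)"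
      have "S N ?u = 0" using c[of x] by (simp add: conv S_diff)
      moreover have "periodic N ?u"
        using per_Y[of t True] per_shift(3)[OF per_Y[of t True], of x] by (simp add: periodic_def)
      ultimately have "\<forall>i. ?u i = 0" using S_zero_iff[OF N_pos, of ?u] by (simp add: ind_def)
      from this[rule_format, of t] show ?thesis using E_refl[of "(True, t)"] by simp
    qed
    from this[of "t - j" for j] show False using that by simp
  qed
  have "X t1 + X t2 + X t3 = S N (\<lambda>i. s i * (?Y t1 (True, i) + ?Y t2 (True, i) + ?Y t3 (True, i)))"
    by (simp add: X_def S_add ring_distribs mult.commute)
  also have "\<dots> = S N s"
  proof (rule S_cong)
    fix i
    have "\<not> (E (True, t1) (True, i) \<and> E (True, t2) (True, i))" "\<not> (E (True, t1) (True, i) \<and> E (True, t3) (True, i))"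
      "\<not> (E (True, t2) (True, i) \<and> E (True, t3) (True, i))"
      using distinct E_sym E_trans by meson+
    then show "s i * (?Y t1 (True, i) + ?Y t2 (True, i) + ?Y t3 (True, i)) = s i"
      using cover[of i] by (auto simp: ind_def)
  qed
  finally have sum: "X t1 + X t2 + X t3 = 0" using s0 by simp
  have "X t1 \<noteq> 0" "X t2 \<noteq> 0" "X t3 \<noteq> 0"
    using nz distinct E_sym by blast+
  then show False using sum neg[OF distinct(1)] neg[OF distinct(2)] neg[OF distinct(3)]
    by (auto simp: mult_le_0_iff)
qed

lemma split_pair: "\<not> zinv M (ind (E y)) \<Longrightarrow> \<exists>p i. E y (p, i) \<and> \<not> E y (p, i + M)"
proof -
  assume "\<not> zinv M (ind (E y))"
  then obtain p i where pi: "ind (E y) (p, i + M) \<noteq> ind (E y) (p, i)" by (auto simp: zinv_iff)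
  show ?thesis
  proof (cases "E y (p, i)")
    case True
    then have "\<not> E y (p, i + M)" using pi by (auto simp: ind_def)
    then show ?thesis using True by blast
  next
    case False
    then have "E y (p, i + M)" using pi by (auto simp: ind_def split: if_splits)
    moreover have "E (p, i + M + M) (p, i)" using E_sym[OF E_per[of p i]] by (simp add: N_M add.assoc)
    then have "\<not> E y (p, i + M + M)" using False E_trans by blast
    ultimately show ?thesis by blast
  qed
qed

lemma not_Kp_M: "Kp (False, M) \<Longrightarrow> \<not> Kp (p, i) \<Longrightarrow> \<not> Kp (p, i + M)"
  using Kp_diff[of "i + M" M] Kp_fst[of "(p, i + M)"] by (cases p) auto

lemma Kp_not_E: "Kp x \<Longrightarrow> \<not> Kp y \<Longrightarrow> \<not> E x y" "Kp x \<Longrightarrow> \<not> Kp y \<Longrightarrow> \<not> E y x"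
  using Kp_E E_sym by blast+

lemma not_Kp_pinv: "\<not> Kp x \<Longrightarrow> E x (pinv x)"
proof -
  assume "\<not> Kp x"
  then obtain t where t: "E x (True, t)" using not_Kp by blast
  have "E (pinv x) (True, t)" using E_inv[OF t] by simp
  then show ?thesis by (rule E_trans[OF t E_sym])
qed

lemma one_pinv: "N dvd i \<Longrightarrow> E (False, i) (False, - i)"
  by (rule E_trans[OF E_sym, of "(False, 0)"]) (simp_all add: E_one)

end

context central_subgroup_sring
begin

lemma Hp_Kp: "Hp x \<Longrightarrow> Kp x"
  unfolding Kp_def using Hp_E by (auto simp: Hp_def)

lemma unsplit_wreath:
  assumes "\<And>y. \<not> Kp y \<Longrightarrow> zinv M (ind (E y))"
    and "\<And>i j. Kp (False, i) \<Longrightarrow> \<not> h dvd i \<Longrightarrow> h dvd j \<Longrightarrow> E (False, i) (False, i + j)"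
  shows wreath
proof -
  have "E (p, i) (p, i + j)" if "p \<or> \<not> h dvd i" "h dvd j" for p i j
  proof (cases "Kp (p, i)")
    case True
    then have "\<not> p" using Kp_fst by fastforce
    then show ?thesis using assms(2) True that by simp
  next
    case False
    have "Hp (False, j)" "Hp (False, - j)" using that(2) by (simp_all add: Hp_def)
    from this[THEN unsplit_H_inv[OF assms(1)[OF False]]] show ?thesis by (cases p) simp_all
  qed
  moreover have "\<not> fst y \<and> h dvd snd y" if "h dvd i" "E (False, i) y" for i y
    using Hp_E[OF that(2)] that(1) by (simp add: Hp_def)
  ultimately show ?thesis using r_le unfolding wreath_def h_def by blast
qed

end

locale rank5_sring = coordinate_sring +
  assumes few: "distinct (map (\<lambda>x. Collect (E x)) xs) \<Longrightarrow> length xs \<le> 5"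
begin

lemma cls_eq: "Collect (E x) = Collect (E y) \<longleftrightarrow> E x y"
  using E_refl E_sym E_trans by blast

context
  fixes y1 y2
  assumes z: "Kp (False, M)" and y: "\<not> Kp y1" "\<not> Kp y2" "\<not> E y1 y2"
begin

lemma nN_M: "\<not> N dvd M"
  using N_M M_pos zdvd_imp_le[of N M] by auto

lemma Kp_0: "Kp (False, 0)"
  by (rule Kp_N) simp

text \<open>Beside 1, the class of the central involution and the classes of \<open>y1\<close> and
  \<open>y2\<close>, the rank bound leaves one basic set. Here it is spent inside \<open>K\<close>,
  in \<open>three_Y\<close> outside.\<close>

lemma one_K:
  assumes q: "Kp (False, q)" "Kp (False, q')" "\<not> N dvd q" "\<not> N dvd q'"
    "\<not> E (False, M) (False, q)" "\<not> E (False, M) (False, q')"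
  shows "E (False, q) (False, q')"
proof (rule ccontr)
  assume "\<not> ?thesis"
  then show False
    using few[of "[(False, 0), (False, M), (False, q), (False, q'), y1, y2]"] q(3-6) y(3)
      Kp_not_E(1)[OF z y(1)] Kp_not_E(1)[OF z y(2)] Kp_not_E(1)[OF Kp_0 y(1)] Kp_not_E(1)[OF Kp_0 y(2)]
      Kp_not_E(1)[OF q(1) y(1)] Kp_not_E(1)[OF q(1) y(2)] Kp_not_E(1)[OF q(2) y(1)] Kp_not_E(1)[OF q(2) y(2)]
    by (simp add: cls_eq E_one nN_M)
qed

lemma two_Y:
  assumes q: "Kp (False, q)" "\<not> N dvd q" "\<not> E (False, M) (False, q)" and y3: "\<not> Kp y3"
  shows "E y1 y3 \<or> E y2 y3"
proof (rule ccontr)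
  assume "\<not> ?thesis"
  then show False
    using few[of "[(False, 0), (False, M), (False, q), y1, y2, y3]"] q(2,3) y(3)
      Kp_not_E(1)[OF z y(1)] Kp_not_E(1)[OF z y(2)] Kp_not_E(1)[OF z y3]
      Kp_not_E(1)[OF Kp_0 y(1)] Kp_not_E(1)[OF Kp_0 y(2)] Kp_not_E(1)[OF Kp_0 y3]
      Kp_not_E(1)[OF q(1) y(1)] Kp_not_E(1)[OF q(1) y(2)] Kp_not_E(1)[OF q(1) y3]
    by (simp add: cls_eq E_one nN_M)
qed

lemma three_Y:
  assumes y3: "\<not> Kp y3" and y4: "\<not> Kp y4" and "\<not> E y1 y3" "\<not> E y2 y3"
  shows "E y1 y4 \<or> E y2 y4 \<or> E y3 y4"
proof (rule ccontr)
  assume "\<not> ?thesis"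
  then show False
    using few[of "[(False, 0), (False, M), y1, y2, y3, y4]"] assms(3,4) y(3)
      Kp_not_E(1)[OF z y(1)] Kp_not_E(1)[OF z y(2)] Kp_not_E(1)[OF z y3] Kp_not_E(1)[OF z y4]
      Kp_not_E(1)[OF Kp_0 y(1)] Kp_not_E(1)[OF Kp_0 y(2)] Kp_not_E(1)[OF Kp_0 y3] Kp_not_E(1)[OF Kp_0 y4]
    by (simp add: cls_eq E_one nN_M)
qed

text \<open>A class containing a reflection contains its own inverse. Inside \<open>K\<close> there
  is at most one class other than 1 and that of the central involution, so inversion must fix
  it.\<close>

lemma classes_symmetric: "E x (pinv x)"
proof (cases "Kp x")
  case True
  then obtain q where x: "x = (False, q)" using Kp_fst by (cases x) fastforce
  then have K: "Kp (False, q)" "Kp (False, - q)" using True Kp_uminus by blast+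
  have zz: "E (False, M) (False, - M)" using E_per[of False "- M"] E_sym by (simp add: N_M)
  have inv: "E (False, M) (False, - q) \<Longrightarrow> E (False, M) (False, q)" for q
    using E_inv[of "(False, M)" "(False, - q)"] zz E_trans by fastforce
  consider "N dvd q" | "E (False, M) (False, q)" | "\<not> N dvd q" "\<not> E (False, M) (False, q)" by blast
  then show ?thesis
  proof cases
    case 1
    then show ?thesis using one_pinv x by simp
  next
    case 2
    then have "E (False, M) (False, - q)" using inv[of "- q"] by simp
    then show ?thesis using 2 E_trans[OF E_sym] unfolding x pinv_simps by blast
  next
    case 3
    have "\<not> N dvd - q" using 3 by simp
    moreover have "\<not> E (False, M) (False, - q)" using 3 inv by blast
    ultimately show ?thesis using one_K[OF K] 3 unfolding x pinv_simps by blast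
  qed
qed (rule not_Kp_pinv)

end

lemma third_class_case:
  assumes z: "Kp (False, M)" and y: "\<not> Kp y1" "\<not> Kp y2" "\<not> E y1 y2"
    and k: "k \<le> m" "\<And>i. Kp (False, i) \<longleftrightarrow> 2 ^ k dvd i"
    and q: "Kp (False, q)" "\<not> N dvd q" "\<not> E (False, M) (False, q)"
  shows "wreath \<or> dds"
proof -
  interpret symmetric_sring m N M E by unfold_locales (rule classes_symmetric[OF z y])
  have q_class: "E (False, q) (False, i)" if "Kp (False, i)" "\<not> N dvd i" "\<not> E (False, M) (False, i)" for i
    using one_K[OF z y q(1) that(1) q(2) that(2) q(3) that(3)] .
  have K: "2 ^ k dvd i \<longleftrightarrow> N dvd i \<or> E (False, M) (False, i) \<or> E (False, q) (False, i)" for i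
  proof
    assume "2 ^ k dvd i"
    then have "Kp (False, i)" by (simp only: k(2))
    then show "N dvd i \<or> E (False, M) (False, i) \<or> E (False, q) (False, i)" using q_class by blast
  next
    assume "N dvd i \<or> E (False, M) (False, i) \<or> E (False, q) (False, i)"
    then have "Kp (False, i)" using Kp_N Kp_E[OF _ z] Kp_E[OF _ q(1)] by blast
    then show "2 ^ k dvd i" by (simp only: k(2))
  qed
  have zT: "\<not> E (False, M) (True, i)" and qT: "\<not> E (False, q) (True, i)" for i
    using rotation_class[OF z] rotation_class[OF q(1)] by blast+
  from stabilizer_of_third_class[OF k(1) K zT qT q(3,2)] obtain r where r: "r \<le> m"
    "\<And>i. 2 ^ r dvd i \<longleftrightarrow> N dvd i \<or> E (False, M) (False, i)"
    "\<And>i j. 2 ^ r dvd j \<Longrightarrow> E (False, q) (False, i) \<Longrightarrow> E (False, q) (False, i + j)" by blast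
  interpret central_subgroup_sring m N M E r
  proof
    show "E (False, M) (p, j) \<longleftrightarrow> E (False, i) (p, j)" if "2 ^ r dvd i" "\<not> N dvd i" for i p j
      using r(2)[of i] that E_sym E_trans by blast
    show "\<not> p \<and> 2 ^ r dvd j" if "E (False, M) (p, j)" for p j
      using rotation_class[OF z that] r(2)[of j] that by auto
  qed (rule r(1))
  have h_iff: "h dvd i \<longleftrightarrow> N dvd i \<or> E (False, M) (False, i)" for i unfolding h_def by (rule r(2))
  have Q_inv: "E (False, i) (False, i + j)" if "Kp (False, i)" "\<not> h dvd i" "h dvd j" for i j
  proof -
    have "E (False, q) (False, i)" using q_class that h_iff by blast
    with r(3)[of j i] that(3) show ?thesis unfolding h_def using E_sym E_trans by blast
  qed
  show ?thesis
  proof (cases "\<forall>y. \<not> Kp y \<longrightarrow> zinv M (ind (E y))")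
    case True
    then show ?thesis using unsplit_wreath Q_inv by blast
  next
    case False
    then obtain y1 p0 i0 where 1: "\<not> Kp y1" "E y1 (p0, i0)" "\<not> E y1 (p0, i0 + M)"
      using split_pair by blast
    define y2 where "y2 = (p0, i0 + M)"
    have y2: "\<not> Kp y2" "\<not> E y1 y2" unfolding y2_def using not_Kp_M[OF z] Kp_E[OF E_sym[OF 1(2)]] 1 by blast+
    note cover = two_Y[OF z 1(1) y2 q]
    obtain j0 where j0: "E y1 (True, j0)" using not_Kp[OF 1(1)] by blast
    interpret two_split_classes m N M E r y1 y2 p0 i0 j0
    proof
      show "\<not> Hp y1" "\<not> Hp y2" using Hp_Kp 1(1) y2(1) by blast+
      show "E (p, i) (p, i + M)" if no: "\<not> E y1 (p, i)" "\<not> E y2 (p, i)" "p \<or> \<not> M dvd i" for p i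
      proof -
        have K: "Kp (p, i)" using cover no by blast
        then have p: "p = False" using Kp_fst by fastforce
        show ?thesis
        proof (cases "h dvd i")
          case True
          then have "h dvd i + M" using hl(4) by simp
          moreover have "\<not> N dvd i" "\<not> N dvd i + M" using N_dvd[of i] p no(3) by auto
          ultimately have "E (False, M) (False, i)" "E (False, M) (False, i + M)" using True h_iff by blast+
          then show ?thesis using p E_sym E_trans by blast
        next
          case False
          then show ?thesis using Q_inv[of i M] K p hl(4) by simp
        qed
      qed
    qed (use 1 y2 j0 E_refl in \<open>auto simp: y2_def\<close>)
    have all_K: "Kp (False, i)" for i using cover no_rotation by blast
    then have "2 ^ k dvd (1 :: int)" by (simp only: k(2)[symmetric])
    have E1: "E (False, q) (False, i) \<longleftrightarrow> \<not> h dvd i" for i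
    proof
      assume "\<not> h dvd i"
      then show "E (False, q) (False, i)" using q_class[OF all_K] h_iff by blast
    next
      assume Q: "E (False, q) (False, i)"
      show "\<not> h dvd i"
      proof
        assume "h dvd i"
        then consider "N dvd i" | "E (False, M) (False, i)" using h_iff by blast
        then show False
        proof cases
          case 1
          then show ?thesis using E_one'[OF E_sym[OF Q]] q(2) by simp
        next
          case 2
          then show ?thesis using Q q(3) E_sym E_trans by blast
        qed
      qed
    qed
    have "\<not> h dvd 1"
    proof
      assume "h dvd 1"
      then have "h dvd q" using dvd_trans one_dvd by blast
      then show False using E1[of q] E_refl by blast
    qed
    then have E11: "E (False, q) (False, 1)" using E1 by blast
    obtain t1 t2 where t: "E y1 (True, t1)" "E y2 (True, t2)" using not_Kp 1(1) y2(1) by blast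
    have "E (False, M) (p, j) \<longleftrightarrow> \<not> p \<and> 2 ^ r dvd j \<and> \<not> N dvd j" for p j
      using zT r(2)[of j] E_one'[of "(False, j)" "(False, M)"] E_sym nN_M[OF z y] by (cases p) auto
    moreover have "E (False, 1) x \<longleftrightarrow> E (False, q) x" for x using E11 E_sym E_trans by blast
    then have "E (False, 1) (p, j) \<longleftrightarrow> \<not> p \<and> \<not> 2 ^ r dvd j" for p j
      using qT E1[of j] by (cases p) (simp_all add: h_def)
    moreover have "r > 0" using \<open>\<not> h dvd 1\<close> h_def by (cases "r = 0") simp_all
    moreover have "\<not> E (True, t1) (True, t2)" using t y2(2) E_sym E_trans by blast
    moreover have "E (True, t1) (True, j) \<or> E (True, t2) (True, j)" for j
    proof -
      have "\<not> Kp (True, j)" using Kp_fst by fastforce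
      then have "E y1 (True, j) \<or> E y2 (True, j)" by (rule cover)
      then show ?thesis using t E_trans[OF E_sym] by blast
    qed
    ultimately have "dds" unfolding dds_def using r(1) by blast
    then show ?thesis ..
  qed
qed

lemma two_class_case:
  assumes z: "Kp (False, M)" and y: "\<not> Kp y1" "\<not> Kp y2" "\<not> E y1 y2"
    and k: "k \<le> m" "\<And>i. Kp (False, i) \<longleftrightarrow> 2 ^ k dvd i"
    and no_q: "\<And>q. Kp (False, q) \<Longrightarrow> \<not> N dvd q \<Longrightarrow> E (False, M) (False, q)"
  shows "symm \<or> wreath"
proof -
  interpret symmetric_sring m N M E by unfold_locales (rule classes_symmetric[OF z y])
  interpret central_subgroup_sring m N M E k
  proof
    show "E (False, M) (p, j) \<longleftrightarrow> E (False, i) (p, j)" if "2 ^ k dvd i" "\<not> N dvd i" for i p j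
      using no_q[of i] k(2)[of i] that E_sym E_trans by blast
    show "\<not> p \<and> 2 ^ k dvd j" if "E (False, M) (p, j)" for p j
      using rotation_class[OF z that] Kp_E[OF that z] k(2)[of j] by auto
  qed (rule k(1))
  have Hp_iff: "Hp x \<longleftrightarrow> Kp x" for x
    using Kp_fst[of x] k(2)[of "snd x"] by (cases x; cases "fst x") (auto simp: Hp_def h_def)
  show ?thesis
  proof (cases "\<forall>y. \<not> Kp y \<longrightarrow> zinv M (ind (E y))")
    case True
    have "wreath" by (rule unsplit_wreath) (use True k(2) in \<open>auto simp: h_def\<close>)
    then show ?thesis ..
  next
    case False
    then obtain y1 p0 i0 where 1: "\<not> Kp y1" "E y1 (p0, i0)" "\<not> E y1 (p0, i0 + M)"
      using split_pair by blast
    define y2 where "y2 = (p0, i0 + M)"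
    have y2: "\<not> Kp y2" "\<not> E y1 y2" unfolding y2_def using not_Kp_M[OF z] Kp_E[OF E_sym[OF 1(2)]] 1 by blast+
    show ?thesis
    proof (cases "\<exists>y3. \<not> Kp y3 \<and> \<not> E y1 y3 \<and> \<not> E y2 y3 \<and> \<not> zinv M (ind (E y3))")
      case True
      then obtain y3 where y3: "\<not> Kp y3" "\<not> E y1 y3" "\<not> E y2 y3" "\<not> zinv M (ind (E y3))" by blast
      have cover: "E y1 x \<or> E y2 x \<or> E y3 x" if "\<not> Kp x" for x
        using three_Y[OF z 1(1) y2 y3(1) that y3(2,3)] .
      have False
      proof (cases "k = 0")
        case False
        \<comment> \<open>The image of a split point of the third class lies in one of the other
          two, so invariant functions agree on all three classes.\<close>
        obtain p3 i3 where p3: "E y3 (p3, i3)" "\<not> E y3 (p3, i3 + M)" using split_pair[OF y3(4)] by blast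
        have "\<not> Kp (p3, i3 + M)" using not_Kp_M[OF z] Kp_E[OF E_sym[OF p3(1)]] y3(1) by blast
        then have p3': "E y1 (p3, i3 + M) \<or> E y2 (p3, i3 + M)" using cover p3(2) by blast
        interpret three_split_classes m N M E k y1 y2 y3
        proof
          show "f y1 = f y2 \<and> f y1 = f y3" if f: "f \<in> Fun" "zinv M f" for f
          proof -
            have "f (p0, i0 + M) = f (p0, i0)" "f (p3, i3 + M) = f (p3, i3)" using f(2) by (simp_all add: zinv_iff)
            moreover have "f y1 = f (p0, i0)" "f y3 = f (p3, i3)" using FunD[OF f(1)] 1(2) p3(1) by blast+
            moreover have "f y1 = f (p3, i3 + M) \<or> f y2 = f (p3, i3 + M)" using FunD[OF f(1)] p3' by blast
            ultimately show ?thesis by (auto simp: y2_def)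
          qed
          show "E y1 x \<or> E y2 x \<or> E y3 x" if "\<not> Hp x" for x using cover[of x] that by (simp add: Hp_iff)
        qed (use False 1 y2 y3 in \<open>simp_all add: Hp_iff\<close>)
        show False by (rule impossible)
      next
        case True
        have "\<not> N dvd i \<Longrightarrow> E (False, M) (False, i)" for i using no_q k(2)[of i] True by simp
        moreover have "\<not> E (False, M) (True, i)" for i using rotation_class[OF z] by blast
        moreover obtain t1 t2 t3 where t: "E y1 (True, t1)" "E y2 (True, t2)" "E y3 (True, t3)"
          using not_Kp[OF 1(1)] not_Kp[OF y2(1)] not_Kp[OF y3(1)] by blast
        moreover have "E (True, t1) (True, j) \<or> E (True, t2) (True, j) \<or> E (True, t3) (True, j)" for j
        proof -
          have "\<not> Kp (True, j)" using Kp_fst by fastforce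
          then have "E y1 (True, j) \<or> E y2 (True, j) \<or> E y3 (True, j)" by (rule cover)
          then show ?thesis using t E_trans[OF E_sym] by blast
        qed
        moreover have "\<not> E (True, t1) (True, t2)" "\<not> E (True, t1) (True, t3)" "\<not> E (True, t2) (True, t3)"
          using t y2(2) y3(2,3) E_sym E_trans by meson+
        ultimately show False using no_three_reflection_classes by blast
      qed
      then show ?thesis ..
    next
      case False
      obtain j0 where j0: "E y1 (True, j0)" using not_Kp[OF 1(1)] by blast
      interpret two_split_classes m N M E k y1 y2 p0 i0 j0
      proof
        show "E (p, i) (p, i + M)" if no: "\<not> E y1 (p, i)" "\<not> E y2 (p, i)" "p \<or> \<not> M dvd i" for p i
        proof (cases "Kp (p, i)")
          case True
          then have p: "p = False" using Kp_fst by fastforce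
          have "\<not> N dvd i" "\<not> N dvd i + M" using N_dvd[of i] p no(3) by auto
          moreover have "Kp (False, i + M)" using True p Hp_M(1)[of i] by (simp add: Hp_iff)
          ultimately have "E (False, M) (False, i)" "E (False, M) (False, i + M)" using True p no_q by blast+
          then show ?thesis using p E_sym E_trans by blast
        next
          case False
          then have "zinv M (ind (E (p, i)))" using \<open>\<not> (\<exists>y3. _ y3)\<close> no by blast
          then have "ind (E (p, i)) (p, i + M) = ind (E (p, i)) (p, i)" by (simp add: zinv_iff)
          then show ?thesis using E_refl by (simp add: ind_def split: if_splits)
        qed
      qed (use 1 y2 j0 E_refl in \<open>auto simp: y2_def Hp_iff\<close>)
      have "\<exists>i1. \<forall>x. E (True, i1) x \<longrightarrow> fst x \<and> N dvd snd x - i1"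
      proof (rule singleton, rule ccontr)
        \<comment> \<open>Here \<open>H\<close> is all of \<open>K\<close>, so for two points in
          different cosets of \<open>H\<close> the class of their quotient contains a reflection.
          But the class of \<open>y1\<close> consists of reflections, and its square is supported on
          rotations.\<close>
        fix i j assume ij: "E y1 (True, i)" "E y1 (True, j)" "\<not> h dvd i - j"
        then have "\<not> Kp (False, i - j)" by (simp add: Hp_iff[symmetric] Hp_def)
        then obtain t where t: "E (False, i - j) (True, t)" using not_Kp by blast
        let ?W = "ind (E y1)"
        have W: "?W \<in> Fun" by (rule class_Fun)
        have WF: "?W (False, a) = 0" for a using no_rotation by simp
        have "conv N ?W ?W (False, i - j) = conv N ?W ?W (True, t)" by (rule FunD[OF Fun_conv[OF W W] t])
        then have "S N (\<lambda>a. ?W (True, a) * ?W (True, a - (i - j))) = 0"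
          unfolding conv_True conv_False WF by (simp add: S_def del: mult_eq_0_iff)
        moreover have "periodic N (\<lambda>a. ?W (True, a) * ?W (True, a - (i - j)))"
          using perD[OF Fun_per[OF W], of True] per_shift(3)[OF perD[OF Fun_per[OF W], of True], of "i - j"]
          by (simp add: periodic_def)
        ultimately have "\<forall>a. ?W (True, a) * ?W (True, a - (i - j)) = 0"
          using S_zero_iff[OF N_pos, of "\<lambda>a. ?W (True, a) * ?W (True, a - (i - j))"] by (simp del: mult_eq_0_iff)
        from this[rule_format, of i] show False using ij by simp
      qed
      then obtain g where "\<And>x. E (True, g) x \<Longrightarrow> fst x \<and> N dvd snd x - g" by blast
      from singleton_sym[OF this] have "\<forall>i. E (True, g + i) (True, g - i)" by blast
      moreover have "E (False, i) (False, - i)" for i using E_pinv[of "(False, i)"] by simp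
      ultimately show ?thesis unfolding symm_def by blast
    qed
  qed
qed

theorem trichotomy: "symm \<or> wreath \<or> dds"
proof -
  obtain k where k: "k \<le> Suc m" "\<And>i. Kp (False, i) \<longleftrightarrow> 2 ^ k dvd i" using rotation_subgroup by blast
  have nN: "\<not> N dvd M" using N_M M_pos zdvd_imp_le[of N M] by auto
  show ?thesis
  proof (cases "k = Suc m")
    case True
    then have K: "Kp (False, i) \<longleftrightarrow> N dvd i" for i using k(2) by (simp only: N_def)
    have pinv: "E x (pinv x)" for x
    proof (cases "Kp x")
      case True
      then obtain i where x: "x = (False, i)" using Kp_fst by (cases x) fastforce
      then show ?thesis using one_pinv True K by simp
    qed (rule not_Kp_pinv)
    interpret symmetric_sring m N M E by unfold_locales (rule pinv)
    obtain g0 where "E (False, M) (True, g0)" using not_Kp[of "(False, M)"] K nN by blast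
    then interpret linked_sring m N M E g0 by unfold_locales (simp add: L_def E_E1)
    have "E (False, i) (False, - i)" for i using pinv[of "(False, i)"] by simp
    then show ?thesis using symmetric unfolding symm_def by blast
  next
    case False
    then have km: "k \<le> m" using k(1) by simp
    then have z: "Kp (False, M)" unfolding k(2) M_def by (rule le_imp_power_dvd)
    show ?thesis
    proof (cases "\<exists>y1 y2. \<not> Kp y1 \<and> \<not> Kp y2 \<and> \<not> E y1 y2")
      case True
      then obtain y1 y2 where y: "\<not> Kp y1" "\<not> Kp y2" "\<not> E y1 y2" by blast
      show ?thesis
      proof (cases "\<exists>q. Kp (False, q) \<and> \<not> N dvd q \<and> \<not> E (False, M) (False, q)")
        case True
        then show ?thesis using third_class_case[OF z y km k(2)] by blast
      next
        case False
        then show ?thesis using two_class_case[OF z y km k(2)] by blast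
      qed
    next
      case False
      have "wreath" unfolding wreath_def
      proof (intro exI[of _ k] conjI allI impI)
        fix i :: int and y assume "2 ^ k dvd i" "E (False, i) y"
        then have "Kp y" using Kp_E k(2) by blast
        then show "\<not> fst y" "2 ^ k dvd snd y"
          using Kp_fst[of y] k(2)[of "snd y"] by (cases y; simp)+
      next
        fix p and i j :: int assume pi: "p \<or> \<not> 2 ^ k dvd i" and j: "2 ^ k dvd j"
        have n: "\<not> Kp (p, i)" if "p \<or> \<not> 2 ^ k dvd i" for i using that Kp_fst[of "(p, i)"] k(2)[of i] by (cases p) auto
        have "\<not> 2 ^ k dvd i \<Longrightarrow> \<not> 2 ^ k dvd i + j" using j by (simp add: dvd_add_left_iff)
        then show "E (p, i) (p, i + j)" using False n pi by blast
      qed (rule km)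
      then show ?thesis by blast
    qed
  qed
qed

end

section \<open>Coordinates\<close>

hide_const (open) Polynomial.order

lemma int_span_iff:
  assumes "finite Q" "partition_on P Q"
  shows "f \<in> int_span (indicator ` Q) \<longleftrightarrow>
    (\<forall>x. x \<notin> P \<longrightarrow> f x = 0) \<and> (\<forall>X\<in>Q. \<forall>x\<in>X. \<forall>y\<in>X. f x = f y)" (is "?l \<longleftrightarrow> ?r")
proof
  assume l: ?l
  have "f x = 0" if "x \<notin> P" for x
  proof -
    have "indicator X x = (0 :: int)" if "X \<in> Q" for X
      using assms(2) that \<open>x \<notin> P\<close> by (auto simp: partition_on_def)
    then show ?thesis using l by (auto simp: int_span_def intro!: sum.neutral)
  qed
  then show ?r using int_span_const[OF assms(2) l] by blast
next
  assume r: ?r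
  \<comment> \<open>The coefficient belonging to the indicator of a class is the value of
    \<open>f\<close> at a chosen point of that class.\<close>
  define c where "c g = f (SOME x. g x = 1)" for g :: "'a \<Rightarrow> int"
  have "f x = (\<Sum>g\<in>indicator ` Q. c g * g x)" for x
  proof (cases "x \<in> P")
    case False
    then have "indicator X x = (0 :: int)" if "X \<in> Q" for X
      using assms(2) that by (auto simp: partition_on_def)
    then have "(\<Sum>g\<in>indicator ` Q. c g * g x) = 0" by (intro sum.neutral) auto
    then show ?thesis using r False by simp
  next
    case True
    then obtain X where X: "X \<in> Q" "x \<in> X" using assms(2) by (auto simp: partition_on_def)
    have "indicator Y x = (0 :: int)" if "Y \<in> Q" "Y \<noteq> X" for Y
      using assms(2) X that by (auto simp: partition_on_def disjoint_def indicator_def)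
    then have "(\<Sum>g\<in>indicator ` Q. c g * g x) = (\<Sum>g\<in>{indicator X}. c g * g x)"
      using assms(1) X by (intro sum.mono_neutral_right) auto
    also have "\<dots> = f (SOME y. y \<in> X)" using X by (simp add: c_def indicator_eq_1_iff)
    also have "\<dots> = f x" using r X someI[of "\<lambda>y. y \<in> X"] by blast
    finally show ?thesis by simp
  qed
  then show ?l unfolding int_span_def by blast
qed

lemma sring_of_partition:
  assumes "group G" "finite (carrier G)" "partition_on (carrier G) Q" "{\<one>\<^bsub>G\<^esub>} \<in> Q"
    and "\<And>X. X \<in> Q \<Longrightarrow> set_inv\<^bsub>G\<^esub> X \<in> Q"
    and "\<And>f g. f \<in> int_span (indicator ` Q) \<Longrightarrow> g \<in> int_span (indicator ` Q) \<Longrightarrow>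
      f \<otimes>\<^bsub>group_ring G\<^esub> g \<in> int_span (indicator ` Q)"
  shows "sring G (int_span (indicator ` Q))" "basic_sets G (int_span (indicator ` Q)) = Q"
proof -
  interpret group G by fact
  interpret R: ring "group_ring G" by (rule ring_group_ring[OF assms(1,2)])
  let ?A = "int_span (indicator ` Q) :: ('a \<Rightarrow> int) set"
  have fin: "finite Q" using assms(2,3) finite_elements by blast
  note iff = int_span_iff[OF fin assms(3)]
  have p: "sring_partition G ?A Q" using assms(3-5) by (simp add: sring_partition_def)
  have carr: "?A \<subseteq> carrier (group_ring G)" by (auto simp: iff group_ring_def)
  have neg: "\<ominus>\<^bsub>group_ring G\<^esub> f = (\<lambda>x. - f x)" if "f \<in> carrier (group_ring G)" for f
    using that by (intro R.minus_equality) (auto simp: group_ring_def)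
  have "subring ?A (group_ring G)"
  proof (rule R.subringI[OF carr _ _ assms(6)])
    show "\<one>\<^bsub>group_ring G\<^esub> \<in> ?A" using fin assms(4) by (simp add: group_ring_def indicator_in_int_span)
    fix f assume f: "f \<in> ?A"
    then have "\<ominus>\<^bsub>group_ring G\<^esub> f = (\<lambda>x. - f x)" using carr neg by blast
    then show "\<ominus>\<^bsub>group_ring G\<^esub> f \<in> ?A"
      using f unfolding iff by (simp only: neg_equal_iff_equal neg_equal_0_iff_equal)
    fix g assume g: "g \<in> ?A"
    have "f \<oplus>\<^bsub>group_ring G\<^esub> g = (\<lambda>x. f x + g x)" by (simp add: group_ring_def)
    then show "f \<oplus>\<^bsub>group_ring G\<^esub> g \<in> ?A"
      using f g unfolding iff by (intro conjI allI ballI impI) (simp, metis)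
  qed
  then show s: "sring G ?A" using p assms(1,2) by (auto simp: sring_def)
  show "basic_sets G ?A = Q"
    using sring_partition_unique[OF assms(2) sring_partition_basic_sets[OF s] p] .
qed

locale dihedral_coordinates = group D for D :: "('a, 'b) monoid_scheme" (structure) +
  fixes n :: nat and c s
  assumes c_closed [simp]: "c \<in> carrier D" and s_closed [simp]: "s \<in> carrier D"
    and c_one: "c [^] (i :: int) = \<one> \<longleftrightarrow> 2 ^ n dvd i"
    and s_out: "c [^] (i :: int) \<noteq> s"
    and involution: "(c [^] (i :: int) \<otimes> s) \<otimes> (c [^] i \<otimes> s) = \<one>"
    and cover: "carrier D \<subseteq> range (\<lambda>i :: int. c [^] i) \<union> range (\<lambda>i :: int. c [^] i \<otimes> s)"

lemma dihedral_cyclic_part_coordinates: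
  assumes "group D" "dihedral_cyclic_part D C" "order D = 2 ^ (n + 1)"
  obtains c s where "dihedral_coordinates D n c s" "C = range (\<lambda>i :: int. c [^]\<^bsub>D\<^esub> i)"
proof -
  interpret group D by fact
  have C: "subgroup C D" and cyc: "cyclic_group (D\<lparr>carrier := C\<rparr>)" and ix: "card (rcosets\<^bsub>D\<^esub> C) = 2"
    and inv: "\<And>s. s \<in> carrier D - C \<Longrightarrow> s \<otimes>\<^bsub>D\<^esub> s = \<one>\<^bsub>D\<^esub>"
    using assms(2) by (auto simp: dihedral_cyclic_part_def)
  interpret C: subgroup C D by fact
  interpret CG: group "D\<lparr>carrier := C\<rparr>" by (rule C.subgroup_is_group) fact
  obtain c where c: "c \<in> C" "C = range (\<lambda>i :: int. c [^]\<^bsub>D\<lparr>carrier := C\<rparr>\<^esub> i)"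
    using cyc unfolding CG.cyclic_group by auto
  have "c [^]\<^bsub>D\<lparr>carrier := C\<rparr>\<^esub> (i :: int) = c [^]\<^bsub>D\<^esub> i" for i
    using int_pow_consistent[OF C c(1)] by simp
  then have C_range: "C = range (\<lambda>i :: int. c [^]\<^bsub>D\<^esub> i)" using c(2) by simp
  have cc: "c \<in> carrier D" using c(1) by simp
  have card_C: "card C = 2 ^ n" using lagrange[OF C] ix assms(3) by simp
  have "generate D {c} = C" unfolding C_range generate_pow[OF cc] by auto
  then have "ord c = 2 ^ n" using generate_pow_card[OF cc] card_C by simp
  then have ord: "c [^]\<^bsub>D\<^esub> (i :: int) = \<one>\<^bsub>D\<^esub> \<longleftrightarrow> 2 ^ n dvd i" for i
    using int_pow_eq_id[OF cc, of i] by simp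
  have fin: "finite (carrier D)" using assms(3) by (intro card_ge_0_finite) (simp add: Coset.order_def)
  have "C \<noteq> carrier D" using card_C assms(3) by (auto simp: Coset.order_def)
  then obtain s where s: "s \<in> carrier D" "s \<notin> C" using C.subset by blast
  have cs: "c [^]\<^bsub>D\<^esub> (i :: int) \<otimes>\<^bsub>D\<^esub> s \<in> carrier D - C" for i
  proof -
    have i: "c [^]\<^bsub>D\<^esub> i \<in> C" using C_range by blast
    have "s \<in> C" if "c [^]\<^bsub>D\<^esub> i \<otimes>\<^bsub>D\<^esub> s \<in> C"
    proof -
      have "inv\<^bsub>D\<^esub> (c [^]\<^bsub>D\<^esub> i) \<otimes>\<^bsub>D\<^esub> (c [^]\<^bsub>D\<^esub> i \<otimes>\<^bsub>D\<^esub> s) \<in> C" using i that by blast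
      then show ?thesis using i s(1) by (simp add: m_assoc[symmetric])
    qed
    then show ?thesis using s cc by auto
  qed
  let ?U = "range (\<lambda>i :: int. c [^]\<^bsub>D\<^esub> i \<otimes>\<^bsub>D\<^esub> s)"
  have "?U = C #>\<^bsub>D\<^esub> s" unfolding C_range r_coset_def by auto
  moreover have "card (C #>\<^bsub>D\<^esub> s) = card C"
    using card_rcosets_equal[OF rcosetsI[OF C.subset s(1)] C.subset] by simp
  ultimately have "card ?U = 2 ^ n" using card_C by simp
  moreover have "C \<inter> ?U = {}" "?U \<subseteq> carrier D" using cs by auto
  ultimately have "card (C \<union> ?U) = card (carrier D)"
    using card_C assms(3) finite_subset[OF _ fin] C.subset by (subst card_Un_disjoint) (auto simp: Coset.order_def)
  then have "C \<union> ?U = carrier D" using card_subset_eq[OF fin, of "C \<union> ?U"] C.subset cs by auto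
  then have "dihedral_coordinates D n c s"
    using cc s cs inv C_range ord by unfold_locales auto
  then show ?thesis using that C_range by blast
qed

context dihedral_coordinates
begin

definition "N = (2 :: int) ^ n"

definition phi :: "pt \<Rightarrow> 'a" where
  "phi x = (if fst x then c [^] snd x \<otimes> s else c [^] snd x)"

lemma phi_simps: "phi (False, i) = c [^] i" "phi (True, i) = c [^] i \<otimes> s"
  by (simp_all add: phi_def)

lemma phi_closed [simp]: "phi x \<in> carrier D"
  by (simp add: phi_def)

text \<open>The dihedral relation, from the fact that both \<open>s\<close> and the product of a
  power of \<open>c\<close> with \<open>s\<close> are involutions.\<close>

lemma s_c: "s \<otimes> c [^] (i :: int) = c [^] (- i) \<otimes> s"
proof -
  have ss: "s \<otimes> s = \<one>" using involution[of 0] by simp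
  have "(c [^] i \<otimes> s \<otimes> c [^] i) \<otimes> s = \<one>" using involution[of i] by (simp add: m_assoc)
  then have "c [^] i \<otimes> s \<otimes> c [^] i = s" using ss by (metis c_closed int_pow_closed m_closed right_cancel s_closed)
  then have "inv (c [^] i) \<otimes> (c [^] i \<otimes> (s \<otimes> c [^] i)) = inv (c [^] i) \<otimes> s" by (simp add: m_assoc)
  then show ?thesis by (simp add: m_assoc[symmetric] int_pow_neg)
qed

lemma phi_pm: "phi (pm x y) = phi x \<otimes> phi y"
proof -
  have ss: "s \<otimes> s = \<one>" using involution[of 0] by simp
  have *: "c [^] i \<otimes> s \<otimes> c [^] j = c [^] (i - j) \<otimes> s" for i j :: int
    by (simp add: m_assoc s_c) (simp add: m_assoc[symmetric] int_pow_mult[symmetric])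
  obtain p i q j where "x = (p, i)" "y = (q, j)" by (metis prod.exhaust)
  then show ?thesis
    using * ss by (cases p; cases q) (simp_all add: phi_simps int_pow_mult m_assoc[symmetric], simp_all add: m_assoc)
qed

lemma phi_one: "phi (False, 0) = \<one>"
  by (simp add: phi_simps)

lemma phi_pinv: "phi (pinv x) = inv (phi x)"
proof -
  have "phi (pinv x) \<otimes> phi x = phi (False, 0)"
    unfolding phi_pm[symmetric] by (cases x; cases "fst x") simp_all
  then show ?thesis using inv_equality by (simp add: phi_one)
qed

lemma phi_eq: "phi (p, i) = phi (q, j) \<longleftrightarrow> p = q \<and> N dvd i - j"
proof -
  have *: "c [^] i = c [^] j \<longleftrightarrow> N dvd i - j" for i j :: int
  proof -
    have "c [^] i = c [^] j \<longleftrightarrow> c [^] (i - j) = \<one>"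
      by (metis c_closed int_pow_closed int_pow_diff inv_closed inv_equality inv_inv l_inv r_inv)
    then show ?thesis by (simp add: c_one N_def)
  qed
  have out: "c [^] i \<otimes> s \<noteq> c [^] j" for i j :: int
  proof
    assume "c [^] i \<otimes> s = c [^] j"
    then have "c [^] (- i) \<otimes> (c [^] i \<otimes> s) = c [^] (- i + j)" using int_pow_mult[OF c_closed, of "- i" j] by simp
    then show False using s_out[of "- i + j"] by (simp add: m_assoc[symmetric] int_pow_mult[symmetric])
  qed
  show ?thesis
    using * out out[symmetric] by (cases p; cases q) (simp_all add: phi_simps)
qed

lemma phi_surj: "x \<in> carrier D \<Longrightarrow> \<exists>y. x = phi y"
proof -
  assume "x \<in> carrier D"
  then consider i :: int where "x = c [^] i" | i :: int where "x = c [^] i \<otimes> s" using cover by blast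
  then show ?thesis by cases (use phi_simps in metis)+
qed

lemma N_pos: "N > 0"
  by (simp add: N_def)

lemma sum_carrier: "(\<Sum>a\<in>carrier D. F a) = tot N (\<lambda>y. F (phi y) :: int)"
proof -
  have "bij_betw phi (UNIV \<times> {0..<N}) (carrier D)"
    unfolding bij_betw_def
  proof
    show "inj_on phi (UNIV \<times> {0..<N})"
    proof (rule inj_onI)
      fix x y assume xy: "x \<in> UNIV \<times> {0..<N}" "y \<in> UNIV \<times> {0..<N}" "phi x = phi y"
      then have "fst x = fst y" "N dvd snd x - snd y" using phi_eq[of "fst x" "snd x" "fst y" "snd y"] by simp_all
      moreover from this have "snd x mod N = snd y mod N" by (simp add: mod_eq_dvd_iff)
      ultimately show "x = y" using xy(1,2) by (auto simp: prod_eq_iff)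
    qed
    show "phi ` (UNIV \<times> {0..<N}) = carrier D"
    proof (intro equalityI subsetI)
      fix x assume "x \<in> carrier D"
      then obtain p i where "x = phi (p, i)" using phi_surj by (metis prod.exhaust)
      then have "x = phi (p, i mod N)" by (simp add: phi_eq mod_eq_dvd_iff[symmetric])
      then show "x \<in> phi ` (UNIV \<times> {0..<N})" using N_pos by auto
    qed auto
  qed
  then have "(\<Sum>a\<in>carrier D. F a) = (\<Sum>y\<in>UNIV \<times> {0..<N}. F (phi y))"
    by (rule sum.reindex_bij_betw[symmetric])
  also have "\<dots> = tot N (\<lambda>y. F (phi y))"
    by (simp add: sum.cartesian_product' UNIV_bool tot_def S_def)
  finally show ?thesis .
qed

lemma group_ring_mult_phi: "(f \<otimes>\<^bsub>group_ring D\<^esub> g) (phi x) = conv N (\<lambda>y. f (phi y)) (\<lambda>y. g (phi y)) x"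
  unfolding group_ring_mult[OF is_group] conv_def by (simp add: sum_carrier phi_pm phi_pinv)

end

section \<open>S-rings in coordinates\<close>

locale dihedral_sring = dihedral_coordinates D n c s
  for D :: "('a, 'b) monoid_scheme" (structure) and n c s +
  fixes A
  assumes sring: "sring D A"
begin

abbreviation "Q \<equiv> basic_sets D A"

lemma fin: "finite (carrier D)"
  using sring by (simp add: sring_def)

lemma part: "partition_on (carrier D) Q" and one_Q: "{\<one>} \<in> Q"
  and inv_Q: "X \<in> Q \<Longrightarrow> set_inv X \<in> Q" and A_eq: "A = int_span (indicator ` Q)"
  using sring_partition_basic_sets[OF sring] unfolding sring_partition_def by blast+

lemma finite_Q: "finite Q"
  using finite_elements[OF fin part] .

lemma A_iff: "f \<in> A \<longleftrightarrow> (\<forall>x. x \<notin> carrier D \<longrightarrow> f x = 0) \<and> (\<forall>X\<in>Q. \<forall>x\<in>X. \<forall>y\<in>X. f x = f y)"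
proof -
  have "f \<in> A \<longleftrightarrow> f \<in> int_span (indicator ` Q)" by (rule arg_cong[OF A_eq])
  then show ?thesis by (simp only: int_span_iff[OF finite_Q part])
qed

lemma Q_unique: "X \<in> Q \<Longrightarrow> Y \<in> Q \<Longrightarrow> x \<in> X \<Longrightarrow> x \<in> Y \<Longrightarrow> X = Y"
  using part unfolding partition_on_def disjoint_def by blast

definition "E x y \<longleftrightarrow> (\<exists>X\<in>Q. phi x \<in> X \<and> phi y \<in> X)"

lemma phi_Q: "\<exists>X\<in>Q. phi x \<in> X"
  using part phi_closed unfolding partition_on_def by blast

lemma E_refl: "E x x"
  using phi_Q unfolding E_def by blast

lemma E_sym: "E x y \<Longrightarrow> E y x"
  unfolding E_def by blast

lemma E_trans: "E x y \<Longrightarrow> E y z \<Longrightarrow> E x z"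
proof -
  assume "E x y" "E y z"
  then obtain X Y where X: "X \<in> Q" "phi x \<in> X" "phi y \<in> X" and Y: "Y \<in> Q" "phi y \<in> Y" "phi z \<in> Y"
    unfolding E_def by blast
  have "X = Y" using Q_unique[OF X(1) Y(1) X(3) Y(2)] .
  then show ?thesis using X Y unfolding E_def by blast
qed

lemma E_phi: "phi x = phi y \<Longrightarrow> E x y"
  using phi_Q[of y] by (simp add: E_def)

lemma E_one: "E (False, 0) (p, i) \<longleftrightarrow> \<not> p \<and> N dvd i"
proof -
  have "E (False, 0) (p, i) \<longleftrightarrow> phi (p, i) = phi (False, 0)"
    unfolding E_def phi_one using one_Q Q_unique by blast
  then show ?thesis by (simp add: phi_eq)
qed

lemma E_inv: "E x y \<Longrightarrow> E (pinv x) (pinv y)"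
proof -
  assume "E x y"
  then obtain X where X: "X \<in> Q" "phi x \<in> X" "phi y \<in> X" unfolding E_def by blast
  then have "inv (phi x) \<in> set_inv X" "inv (phi y) \<in> set_inv X" unfolding SET_INV_def by blast+
  then show ?thesis using inv_Q[OF X(1)] unfolding E_def phi_pinv by blast
qed

text \<open>The choice of the point does not matter for functions constant on classes, because
  points with the same image are related by \<open>E\<close>.\<close>

definition lift :: "(pt \<Rightarrow> int) \<Rightarrow> 'a \<Rightarrow> int" where
  "lift f x = (if x \<in> carrier D then f (SOME y. phi y = x) else 0)"

lemma lift_phi: "(\<And>x y. E x y \<Longrightarrow> f x = f y) \<Longrightarrow> lift f (phi x) = f x"
proof -
  assume f: "\<And>x y. E x y \<Longrightarrow> f x = f y"
  have "phi (SOME y. phi y = phi x) = phi x" by (rule someI) simp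
  then have "f (SOME y. phi y = phi x) = f x" by (intro f E_phi)
  then show ?thesis by (simp add: lift_def)
qed

lemma lift_A: assumes "\<And>x y. E x y \<Longrightarrow> f x = f y" shows "lift f \<in> A"
  unfolding A_iff
proof (intro conjI allI impI ballI)
  fix X x y assume X: "X \<in> Q" "x \<in> X" "y \<in> X"
  then have "x \<in> carrier D" "y \<in> carrier D" using part by (auto simp: partition_on_def)
  then obtain x' y' where xy: "x = phi x'" "y = phi y'" using phi_surj by metis
  then have "E x' y'" using X unfolding E_def by blast
  then have "f x' = f y'" by (rule assms)
  moreover have "lift f (phi z) = f z" for z using assms by (rule lift_phi)
  ultimately show "lift f x = lift f y" by (simp add: xy)
qed (simp add: lift_def)

lemma E_conv:
  assumes "\<And>x y. E x y \<Longrightarrow> f x = f y" "\<And>x y. E x y \<Longrightarrow> g x = g y" "E x y"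
  shows "conv N f g x = conv N f g y"
proof -
  have "lift f \<in> A" "lift g \<in> A" using assms(1,2) by (blast intro: lift_A)+
  then have "lift f \<otimes>\<^bsub>group_ring D\<^esub> lift g \<in> A"
    using sring subringE(6) by (auto simp: sring_def)
  then have "(lift f \<otimes>\<^bsub>group_ring D\<^esub> lift g) (phi x) = (lift f \<otimes>\<^bsub>group_ring D\<^esub> lift g) (phi y)"
    using assms(3) unfolding A_iff E_def by blast
  moreover have "lift f (phi z) = f z" "lift g (phi z) = g z" for z
    using assms(1,2) by (blast intro: lift_phi)+
  ultimately show ?thesis by (simp add: group_ring_mult_phi)
qed

definition "cls x = phi ` {y. E x y}"

lemma mem_cls: "phi x \<in> cls y \<longleftrightarrow> E y x"
proof
  assume "phi x \<in> cls y"
  then obtain z where "phi x = phi z" "E y z" unfolding cls_def by blast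
  then show "E y x" using E_trans[OF _ E_phi] by metis
qed (simp add: cls_def)

lemma cls_Q: "cls x \<in> Q"
proof -
  obtain X where X: "X \<in> Q" "phi x \<in> X" using phi_Q by blast
  have "cls x = X"
  proof (intro equalityI subsetI)
    fix y assume "y \<in> cls x"
    then show "y \<in> X" using X Q_unique unfolding cls_def E_def by blast
  next
    fix y assume y: "y \<in> X"
    then have "y \<in> carrier D" using X part by (auto simp: partition_on_def)
    then obtain y' where "y = phi y'" using phi_surj by metis
    then show "y \<in> cls x" using X y unfolding cls_def E_def by blast
  qed
  then show ?thesis using X by simp
qed

lemma cls_eq: "cls x = cls y \<longleftrightarrow> E x y"
proof
  assume "cls x = cls y"
  then have "phi y \<in> cls x" by (simp add: mem_cls E_refl)
  then show "E x y" by (simp only: mem_cls)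
next
  assume "E x y"
  then have "E x z \<longleftrightarrow> E y z" for z by (meson E_sym E_trans)
  then show "cls x = cls y" by (simp add: cls_def)
qed

lemma Q_range: "Q = range cls"
proof (intro equalityI subsetI)
  fix X assume X: "X \<in> Q"
  then have "X \<subseteq> carrier D" "X \<noteq> {}" using part by (auto simp: partition_on_def)
  then obtain y where "phi y \<in> X" using phi_surj by blast
  moreover have "phi y \<in> cls y" by (simp add: mem_cls E_refl)
  ultimately show "X \<in> range cls" using X cls_Q Q_unique by blast
qed (use cls_Q in auto)

lemma rank5_sring:
  assumes "n = Suc m" "card Q \<le> 5"
  shows "rank5_sring m N (2 ^ m) E"
proof
  show "N = 2 ^ Suc m" unfolding N_def by (simp only: assms(1))
  show "E (p, i) (p, i + N)" for p i by (rule E_phi) (simp add: phi_eq)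
  fix xs assume d: "distinct (map (\<lambda>x. Collect (E x)) xs)"
  have "Collect (E x) = Collect (E y) \<longleftrightarrow> cls x = cls y" for x y
    unfolding cls_eq using E_refl E_sym E_trans by blast
  then have "distinct (map cls xs)" using d by (simp add: distinct_map inj_on_def)
  from distinct_card[OF this] have "length xs = card (cls ` set xs)" by simp
  also have "\<dots> \<le> card Q" using finite_Q cls_Q by (intro card_mono) auto
  finally show "length xs \<le> 5" using assms(2) by simp
next
  fix f g :: "pt \<Rightarrow> int" and x y
  assume "\<And>x y. E x y \<Longrightarrow> f x = f y" "\<And>x y. E x y \<Longrightarrow> g x = g y" "E x y"
  then show "conv N f g x = conv N f g y" by (rule E_conv)
qed (rule refl | rule E_refl | erule E_sym | erule (1) E_trans | rule E_one | erule E_inv)+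

section \<open>Wreath products\<close>

context
  fixes r :: nat
  assumes r_less: "r < n"
begin

definition "Lr = phi ` {(False, i) | i. 2 ^ r dvd i}"

lemma dvd_N: "2 ^ r dvd N"
  unfolding N_def using r_less by (intro le_imp_power_dvd) simp

lemma mem_Lr: "phi x \<in> Lr \<longleftrightarrow> \<not> fst x \<and> 2 ^ r dvd snd x"
proof
  assume "phi x \<in> Lr"
  then obtain i where i: "phi x = phi (False, i)" "2 ^ r dvd i" unfolding Lr_def by blast
  then have "\<not> fst x" "N dvd snd x - i" using phi_eq[of "fst x" "snd x" False i] by simp_all
  then have "2 ^ r dvd snd x - i" using dvd_N dvd_trans by blast
  then show "\<not> fst x \<and> 2 ^ r dvd snd x" using i(2) \<open>\<not> fst x\<close> dvd_diff_left_iff by blast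
next
  assume "\<not> fst x \<and> 2 ^ r dvd snd x"
  then have "x = (False, snd x)" "2 ^ r dvd snd x" by (simp_all add: prod_eq_iff)
  then show "phi x \<in> Lr" unfolding Lr_def by blast
qed

lemma subgroup_Lr: "subgroup Lr D"
proof (rule subgroupI)
  show "Lr \<subseteq> carrier D" unfolding Lr_def by auto
  have "phi (False, 0) \<in> Lr" by (simp add: mem_Lr)
  then show "Lr \<noteq> {}" by blast
  fix a assume "a \<in> Lr"
  then obtain i where i: "a = phi (False, i)" "2 ^ r dvd i" unfolding Lr_def by blast
  then show "inv a \<in> Lr" using mem_Lr[of "pinv (False, i)"] unfolding phi_pinv by simp
  fix b assume "b \<in> Lr"
  then obtain j where j: "b = phi (False, j)" "2 ^ r dvd j" unfolding Lr_def by blast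
  then show "a \<otimes> b \<in> Lr" using mem_Lr[of "pm (False, i) (False, j)"] i unfolding phi_pm by simp
qed

lemma normal_Lr: "Lr \<lhd> D"
proof (rule normal_invI[OF subgroup_Lr])
  fix x h assume x: "x \<in> carrier D" and "h \<in> Lr"
  then obtain i where i: "h = phi (False, i)" "2 ^ r dvd i" unfolding Lr_def by blast
  obtain y where y: "x = phi y" using phi_surj[OF x] by blast
  have "x \<otimes> h \<otimes> inv x = phi (pm (pm y (False, i)) (pinv y))" by (simp add: y i phi_pm phi_pinv)
  also have "\<dots> \<in> Lr" unfolding mem_Lr using i(2) by (cases y; cases "fst y") simp_all
  finally show "x \<otimes> h \<otimes> inv x \<in> Lr" .
qed

lemma proper_wreath:
  assumes closed: "\<And>i y. 2 ^ r dvd i \<Longrightarrow> E (False, i) y \<Longrightarrow> \<not> fst y \<and> 2 ^ r dvd snd y"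
    and shift: "\<And>p i j. p \<or> \<not> 2 ^ r dvd i \<Longrightarrow> 2 ^ r dvd j \<Longrightarrow> E (p, i) (p, i + j)"
  shows "proper_wreath_product D A"
  unfolding proper_wreath_product_def
proof (intro exI[of _ Lr] conjI ballI impI normal_Lr)
  have L_cls: "cls x \<subseteq> Lr" if "phi x \<in> Lr" for x
  proof
    fix y assume "y \<in> cls x"
    then obtain y' where y': "y = phi y'" "E x y'" unfolding cls_def by blast
    have x: "x = (False, snd x)" "2 ^ r dvd snd x" using that by (simp_all add: mem_Lr prod_eq_iff)
    then have "\<not> fst y' \<and> 2 ^ r dvd snd y'" using closed[of "snd x" y'] y'(2) by metis
    then show "y \<in> Lr" by (simp add: y'(1) mem_Lr)
  qed
  have "Lr = \<Union>{X \<in> Q. X \<subseteq> Lr}"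
  proof (intro equalityI subsetI)
    fix x assume x: "x \<in> Lr"
    then obtain y where y: "x = phi y" unfolding Lr_def by blast
    then have "cls y \<subseteq> Lr" "x \<in> cls y" using L_cls x by (simp_all add: mem_cls E_refl)
    then show "x \<in> \<Union>{X \<in> Q. X \<subseteq> Lr}" using cls_Q by blast
  qed blast
  then show "sring_subgroup D A Lr"
    unfolding sring_subgroup_def by (intro conjI subgroup_Lr exI[of _ "{X \<in> Q. X \<subseteq> Lr}"]) auto
  have "\<not> N dvd 2 ^ r" using r_less zdvd_imp_le[of N "2 ^ r"] by (auto simp: N_def)
  then have "phi (False, 2 ^ r) \<noteq> phi (False, 0)" by (simp add: phi_eq)
  moreover have "phi (False, 2 ^ r) \<in> Lr" by (simp add: mem_Lr)
  ultimately show "Lr \<noteq> {\<one>}" by (auto simp: phi_one)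
  have "phi (True, 0) \<notin> Lr" by (simp add: mem_Lr)
  then show "Lr \<noteq> carrier D" using phi_closed by blast
  fix X assume X: "X \<in> Q" "\<not> X \<subseteq> Lr"
  then obtain x where x: "X = cls x" using Q_range by blast
  have out: "fst y \<or> \<not> 2 ^ r dvd snd y" if "E x y" for y
    using L_cls[of y] that X(2) cls_eq[of x y] by (auto simp: x mem_Lr)
  \<comment> \<open>Multiplication by a rotation from the right lowers the exponent of a reflection,
    hence the use of \<open>shift\<close> with both signs.\<close>
  have right: "E x (pm y (False, j))" if "E x y" "2 ^ r dvd j" for y j
  proof -
    have "E y (pm y (False, j))"
      using shift[of "fst y" "snd y" j] shift[of "fst y" "snd y" "- j"] out[OF that(1)] that(2)
      by (cases y; cases "fst y") simp_all
    then show ?thesis using that(1) E_trans by blast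
  qed
  have left: "E x (pm (False, j) y)" if "E x y" "2 ^ r dvd j" for y j
  proof -
    have "E y (pm (False, j) y)"
      using shift[of "fst y" "snd y" j] out[OF that(1)] that(2) by (cases y) (simp add: add.commute)
    then show ?thesis using that(1) E_trans by blast
  qed
  show "Lr \<subseteq> set_rad D X"
  proof
    fix g assume g: "g \<in> Lr"
    then obtain j where j: "g = phi (False, j)" "2 ^ r dvd j" unfolding Lr_def by blast
    have "g <# X = X"
    proof (intro equalityI subsetI)
      fix y assume "y \<in> g <# X"
      then obtain y' where "E x y'" "y = phi (pm (False, j) y')" unfolding l_coset_def x cls_def by (auto simp: j phi_pm)
      then show "y \<in> X" using left[OF _ j(2)] by (simp add: x mem_cls)
    next
      fix y assume "y \<in> X"
      then obtain y' where y': "E x y'" "y = phi y'" unfolding x cls_def by blast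
      then have "phi (pm (False, - j) y') \<in> X" using left[of y' "- j"] j(2) by (simp add: x mem_cls)
      moreover have "y = g \<otimes> phi (pm (False, - j) y')"
        unfolding j(1) phi_pm[symmetric] pm_assoc[symmetric] y'(2) by (cases y') simp
      ultimately show "y \<in> g <# X" unfolding l_coset_def by blast
    qed
    moreover have "X #> g = X"
    proof (intro equalityI subsetI)
      fix y assume "y \<in> X #> g"
      then obtain y' where "E x y'" "y = phi (pm y' (False, j))" unfolding r_coset_def x cls_def by (auto simp: j phi_pm)
      then show "y \<in> X" using right[OF _ j(2)] by (simp add: x mem_cls)
    next
      fix y assume "y \<in> X"
      then obtain y' where y': "E x y'" "y = phi y'" unfolding x cls_def by blast
      then have "phi (pm y' (False, - j)) \<in> X" using right[of y' "- j"] j(2) by (simp add: x mem_cls)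
      moreover have "y = phi (pm y' (False, - j)) \<otimes> g"
        unfolding j(1) phi_pm[symmetric] pm_assoc y'(2) by (cases y'; cases "fst y'") simp_all
      ultimately show "y \<in> X #> g" unfolding r_coset_def by blast
    qed
    ultimately show "g \<in> set_rad D X" unfolding set_rad_def by (simp add: j)
  qed
qed

end

end

section \<open>Divisible difference sets\<close>

context dihedral_sring
begin

lemma phi_set_eqI:
  assumes "X \<subseteq> carrier D" "Y \<subseteq> carrier D" "\<And>x. phi x \<in> X \<longleftrightarrow> phi x \<in> Y"
  shows "X = Y"
  using assms phi_surj by (metis subsetD subset_antisym subsetI)

lemma E_per: "N dvd i - j \<Longrightarrow> E (p, i) (p, j)"
  by (rule E_phi) (simp add: phi_eq)

lemma card_phi:
  assumes "X \<subseteq> carrier D"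
  shows "int (card X) = tot N (\<lambda>y. ind (\<lambda>y. phi y \<in> X) y)"
proof -
  have "int (card X) = (\<Sum>a\<in>carrier D. if a \<in> X then 1 else 0)"
    using assms by (simp add: fin sum.If_cases Int_absorb1)
  then show ?thesis by (simp add: sum_carrier ind_def)
qed

lemma associated_dds:
  assumes n: "n = Suc m" and r: "r \<le> m" "r > 0"
    and H: "\<And>p j. E (False, 2 ^ m) (p, j) \<longleftrightarrow> \<not> p \<and> 2 ^ r dvd j \<and> \<not> N dvd j"
    and K: "\<And>p j. E (False, 1) (p, j) \<longleftrightarrow> \<not> p \<and> \<not> 2 ^ r dvd j"
    and t: "\<not> E (True, t1) (True, t2)" "\<And>j. E (True, t1) (True, j) \<or> E (True, t2) (True, j)"
    and C: "dihedral_cyclic_part D C" "C = range (\<lambda>i :: int. c [^] i)"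
  shows "sring_rank D A = 5 \<and> associated_with_dds D A"
proof -
  have rn: "r < n" using n r by simp
  note mem_L = mem_Lr[OF rn] and subgroup_L = subgroup_Lr[OF rn]
  have rot: "E (False, 0) (False, i) \<or> E (False, 2 ^ m) (False, i) \<or> E (False, 1) (False, i)" for i
    by (auto simp: E_one H K)
  have refl_cls: "\<not> E (True, t) (False, i)" for t i
  proof
    assume a: "E (True, t) (False, i)"
    consider "E (False, 0) (True, t)" | "E (False, 2 ^ m) (True, t)" | "E (False, 1) (True, t)"
      using rot[of i] E_trans E_sym[OF a] by blast
    then show False by cases (simp_all add: E_one H K)
  qed
  \<comment> \<open>The exponents of one class of reflections, read as rotations.\<close>
  define T where "T = phi ` {(False, j) | j. E (True, t1) (True, j)}"
  have mem_T: "phi x \<in> T \<longleftrightarrow> \<not> fst x \<and> E (True, t1) (True, snd x)" for x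
  proof
    assume "phi x \<in> T"
    then obtain j where j: "phi x = phi (False, j)" "E (True, t1) (True, j)" unfolding T_def by blast
    then have "\<not> fst x" "N dvd snd x - j" using phi_eq[of "fst x" "snd x" False j] by simp_all
    then have "E (True, snd x) (True, j)" by (intro E_per)
    then show "\<not> fst x \<and> E (True, t1) (True, snd x)" using \<open>\<not> fst x\<close> j(2) E_sym E_trans by blast
  next
    assume "\<not> fst x \<and> E (True, t1) (True, snd x)"
    moreover from this have "x = (False, snd x)" by (simp add: prod_eq_iff)
    ultimately show "phi x \<in> T" unfolding T_def by blast
  qed
  have mem_C: "phi x \<in> C \<longleftrightarrow> \<not> fst x" for x
  proof -
    have "phi x \<in> C \<longleftrightarrow> (\<exists>i. phi (fst x, snd x) = phi (False, i))" unfolding C(2) by (auto simp: phi_simps)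
    then show ?thesis unfolding phi_eq by (auto intro: exI[of _ "snd x"])
  qed
  have C_sub: "C \<subseteq> carrier D" unfolding C(2) by auto
  have T_sub: "T \<subseteq> C" unfolding T_def C(2) by (auto simp: phi_simps)
  have L_sub: "Lr r \<subseteq> C" using rn unfolding Lr_def[OF rn] C(2) by (auto simp: phi_simps)
  have mem_s: "phi x \<in> X #> s \<longleftrightarrow> fst x \<and> phi (False, snd x) \<in> X" if "X \<subseteq> C" for x X
  proof
    assume "phi x \<in> X #> s"
    then obtain a where a: "a \<in> X" "phi x = a \<otimes> s" unfolding r_coset_def by blast
    then obtain i :: int where i: "a = c [^] i" using \<open>X \<subseteq> C\<close> C(2) by blast
    then have "phi (fst x, snd x) = phi (True, i)" using a(2) by (simp add: phi_simps(2))
    then have "fst x" "N dvd snd x - i" unfolding phi_eq by simp_all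
    then have "phi (False, snd x) = a" using phi_eq[of False "snd x" False i] by (simp add: i phi_simps(1))
    then show "fst x \<and> phi (False, snd x) \<in> X" using a(1) \<open>fst x\<close> by simp
  next
    assume a: "fst x \<and> phi (False, snd x) \<in> X"
    then have "phi x = phi (False, snd x) \<otimes> s" by (simp add: phi_def)
    then show "phi x \<in> X #> s" using a unfolding r_coset_def by blast
  qed
  have s_sub: "X #> s \<subseteq> carrier D" if "X \<subseteq> C" for X
    using that C_sub by (auto simp: r_coset_def)
  have cls_sub: "cls x \<subseteq> carrier D" for x unfolding cls_def by auto
  have one: "cls (False, 0) = {\<one>}"
  proof (rule phi_set_eqI[OF cls_sub])
    fix x
    have "phi (fst x, snd x) = phi (False, 0) \<longleftrightarrow> E (False, 0) (fst x, snd x)" unfolding phi_eq E_one by simp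
    then show "phi x \<in> cls (False, 0) \<longleftrightarrow> phi x \<in> {\<one>}" by (simp add: mem_cls phi_one)
  qed simp
  have cl_H: "cls (False, 2 ^ m) = Lr r - {\<one>}"
  proof (rule phi_set_eqI[OF cls_sub])
    fix x
    have "phi (fst x, snd x) = phi (False, 0) \<longleftrightarrow> \<not> fst x \<and> N dvd snd x" unfolding phi_eq by simp
    then show "phi x \<in> cls (False, 2 ^ m) \<longleftrightarrow> phi x \<in> Lr r - {\<one>}"
      using H[of "fst x" "snd x"] mem_L[of x] by (auto simp: mem_cls phi_one)
  qed (use L_sub C_sub in auto)
  have cl_C: "cls (False, 1) = C - Lr r"
  proof (rule phi_set_eqI[OF cls_sub])
    fix x show "phi x \<in> cls (False, 1) \<longleftrightarrow> phi x \<in> C - Lr r"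
      using K[of "fst x" "snd x"] mem_L[of x] mem_C[of x] by (auto simp: mem_cls)
  qed (use C_sub in auto)
  have cl_T: "cls (True, t1) = T #> s"
  proof (rule phi_set_eqI[OF cls_sub s_sub[OF T_sub]])
    fix x show "phi x \<in> cls (True, t1) \<longleftrightarrow> phi x \<in> T #> s"
      unfolding mem_s[OF T_sub] mem_cls mem_T using refl_cls by (cases x; cases "fst x") auto
  qed
  have cl_T2: "cls (True, t2) = (C - T) #> s"
  proof (rule phi_set_eqI[OF cls_sub s_sub])
    fix x
    have "E (True, t2) (True, j) \<longleftrightarrow> \<not> E (True, t1) (True, j)" for j
      using t(1) t(2)[of j] E_sym E_trans by blast
    then show "phi x \<in> cls (True, t2) \<longleftrightarrow> phi x \<in> (C - T) #> s"
      unfolding mem_s[OF Diff_subset] mem_cls Diff_iff mem_T mem_C using refl_cls by (cases x; cases "fst x") auto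
  qed auto
  have Q5: "Q = {cls (False, 0), cls (False, 2 ^ m), cls (False, 1), cls (True, t1), cls (True, t2)}"
  proof -
    have "cls x \<in> {cls (False, 0), cls (False, 2 ^ m), cls (False, 1), cls (True, t1), cls (True, t2)}" for x
    proof -
      obtain p i where x: "x = (p, i)" by (rule prod.exhaust)
      have "E (False, 0) x \<or> E (False, 2 ^ m) x \<or> E (False, 1) x \<or> E (True, t1) x \<or> E (True, t2) x"
        unfolding x using rot[of i] t(2)[of i] by (cases p) auto
      then show ?thesis unfolding cls_eq[symmetric] by auto
    qed
    then show ?thesis unfolding Q_range by auto
  qed
  have nr: "\<not> 2 ^ r dvd (1 :: int)" "\<not> N dvd 1" "\<not> N dvd 2 ^ m"
  proof -
    show r1: "\<not> 2 ^ r dvd (1 :: int)" using r(2) by simp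
    have N2: "N = 2 * 2 ^ m" unfolding N_def by (simp only: n power_Suc)
    show "\<not> N dvd 1"
    proof
      assume "N dvd 1"
      then have "2 dvd (1 :: int)" unfolding N2 by (rule dvd_mult_left)
      then show False by simp
    qed
    show "\<not> N dvd 2 ^ m"
    proof
      assume "N dvd 2 ^ m"
      then have "N \<le> 2 ^ m" by (rule zdvd_imp_le) simp
      then show False by (simp add: N2)
    qed
  qed
  have "card Q = 5"
    unfolding Q5 using t(1) nr by (simp add: card_insert_if cls_eq E_one H K)
  moreover have "associated_with_dds D A"
    unfolding associated_with_dds_def
  proof (intro exI conjI)
    show "dihedral_cyclic_part D C" by fact
    have C_subgroup: "subgroup C D" using C(1) by (simp add: dihedral_cyclic_part_def)
    show L_subgroup: "subgroup (Lr r) (D\<lparr>carrier := C\<rparr>)"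
      by (rule subgroup_incl[OF subgroup_L C_subgroup L_sub])
    show "s \<in> carrier D - C" using s_out by (auto simp: C(2))
    show "Q = {{\<one>}, Lr r - {\<one>}, C - Lr r, T #> s, (C - T) #> s}"
      using Q5 unfolding one cl_H cl_C cl_T cl_T2 .
    let ?Y = "ind (E (True, t1))"
    have YF: "?Y (False, i) = 0" for i using refl_cls by simp
    have Y_E: "?Y x = ?Y y" if "E x y" for x y
      using that E_sym E_trans unfolding ind_def by metis
    have Y_T: "ind (\<lambda>y. phi y \<in> T) (False, i) = ?Y (True, i)" "ind (\<lambda>y. phi y \<in> T) (True, i) = 0" for i
      by (simp_all add: ind_def mem_T)
    show "divisible_difference_set (D\<lparr>carrier := C\<rparr>) (Lr r) T"
      unfolding divisible_difference_set_def
    proof (intro conjI L_subgroup exI)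
      show "T \<subseteq> carrier (D\<lparr>carrier := C\<rparr>)" using T_sub by simp
      interpret CG: group "D\<lparr>carrier := C\<rparr>" by (rule subgroup.subgroup_is_group[OF C_subgroup is_group])
      let ?c = "conv N ?Y ?Y"
      have nonneg: "0 \<le> ?c (False, j)" for j
        unfolding conv_False YF by (simp add: S_def sum_nonneg)
      have inv_T: "set_inv\<^bsub>D\<lparr>carrier := C\<rparr>\<^esub> T = set_inv T"
        using m_inv_consistent[OF C_subgroup] T_sub unfolding SET_INV_def by (intro SUP_cong) auto
      have mem_inv: "phi y \<in> set_inv T \<longleftrightarrow> phi (pinv y) \<in> T" for y
      proof -
        have "a = inv b \<longleftrightarrow> b = inv a" if "a \<in> carrier D" "b \<in> carrier D" for a b using that by auto
        then have "phi y = inv b \<longleftrightarrow> b = phi (pinv y)" if "b \<in> T" for b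
          using that T_sub C_sub by (auto simp: phi_pinv)
        then show ?thesis unfolding SET_INV_def by blast
      qed
      let ?P = "indicator T \<otimes>\<^bsub>group_ring (D\<lparr>carrier := C\<rparr>)\<^esub> indicator (set_inv\<^bsub>D\<lparr>carrier := C\<rparr>\<^esub> T)"
      \<comment> \<open>The product of two reflections with exponents \<open>i\<close> and
        \<open>i - j\<close> is the rotation \<open>j\<close>, so the product of \<open>T\<close>
        with its inverse has the same coefficients as the square of the class.\<close>
      have prod: "?P (phi (False, j)) = ?c (False, j)" for j
      proof -
        have "?P (phi (False, j)) =
            (\<Sum>a\<in>C. indicator T a * indicator (set_inv T) (inv\<^bsub>D\<lparr>carrier := C\<rparr>\<^esub> a \<otimes> phi (False, j)))"
          unfolding group_ring_mult[OF CG.is_group] inv_T using mem_C[of "(False, j)"] by simp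
        also have "\<dots> = (\<Sum>a\<in>C. indicator T a * indicator (set_inv T) (inv a \<otimes> phi (False, j)))"
          by (intro sum.cong) (simp_all add: m_inv_consistent[OF C_subgroup])
        also have "\<dots> = (\<Sum>a\<in>carrier D. indicator T a * indicator (set_inv T) (inv a \<otimes> phi (False, j)))"
          using T_sub by (intro sum.mono_neutral_left fin C_sub) (auto simp: indicator_def)
        also have "\<dots> = tot N (\<lambda>y. indicator T (phi y) * indicator (set_inv T) (phi (pm (pinv y) (False, j))))"
          by (simp add: sum_carrier phi_pm phi_pinv)
        also have "\<dots> = S N (\<lambda>i. ?Y (True, i) * ?Y (True, i - j))"
        proof -
          have "indicator T (phi (False, i)) = ?Y (True, i)" "indicator T (phi (True, i)) = (0 :: int)"
            "indicator (set_inv T) (phi (False, i)) = ?Y (True, - i)" for i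
            by (simp_all add: indicator_def mem_inv mem_T ind_def)
          then show ?thesis unfolding tot_def by (simp add: S_def)
        qed
        also have "\<dots> = ?c (False, j)"
          unfolding conv_False YF by (simp add: S_def)
        finally show ?thesis .
      qed
      have c_E: "?c x = ?c y" if "E x y" for x y
        using Y_E Y_E that by (rule E_conv)
      have card_T: "int (card T) = ?c (False, 0)"
        using T_sub C_sub by (simp add: card_phi tot_def Y_T conv_False YF S_def)
      show "?P = (\<lambda>x. int (card T) * indicator {\<one>\<^bsub>D\<lparr>carrier := C\<rparr>\<^esub>} x
          + int (nat (?c (False, 2 ^ m))) * indicator (Lr r - {\<one>\<^bsub>D\<lparr>carrier := C\<rparr>\<^esub>}) x
          + int (nat (?c (False, 1))) * indicator (carrier (D\<lparr>carrier := C\<rparr>) - Lr r) x)" (is "_ = ?R")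
      proof
        fix x
        show "?P x = ?R x"
        proof (cases "x \<in> C")
          case False
          then have "x \<noteq> \<one>" "x \<notin> Lr r" using L_sub subgroup.one_closed[OF C_subgroup] by blast+
          then show ?thesis using False by (simp add: group_ring_mult[OF CG.is_group])
        next
          case True
          then obtain j :: int where x: "x = phi (False, j)" unfolding C(2) by (auto simp: phi_simps)
          have one_iff: "phi (False, j) = \<one> \<longleftrightarrow> N dvd j" using phi_eq[of False j False 0] by (simp add: phi_one)
          have L_iff: "phi (False, j) \<in> Lr r \<longleftrightarrow> 2 ^ r dvd j" using mem_L[of "(False, j)"] by simp
          have NL: "N dvd j \<Longrightarrow> 2 ^ r dvd j" using dvd_N[OF rn] dvd_trans by blast
          have C_in: "phi (False, j) \<in> C" using mem_C[of "(False, j)"] by simp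
          consider "N dvd j" | "\<not> N dvd j" "2 ^ r dvd j" | "\<not> 2 ^ r dvd j" by blast
          then show ?thesis
          proof cases
            case 1
            then have "E (False, 0) (False, j)" by (simp add: E_one)
            from c_E[OF this] show ?thesis
              unfolding x prod using 1 NL by (simp add: one_iff L_iff C_in card_T indicator_def)
          next
            case 2
            then have "E (False, 2 ^ m) (False, j)" by (simp add: H)
            from c_E[OF this] show ?thesis
              unfolding x prod using 2 nonneg by (simp add: one_iff L_iff C_in indicator_def)
          next
            case 3
            then have "E (False, 1) (False, j)" by (simp add: K)
            from c_E[OF this] show ?thesis
              unfolding x prod using 3 NL nonneg by (auto simp: one_iff L_iff C_in indicator_def)
          qed
        qed
      qed
    qed
    let ?G = "ind (\<lambda>x. \<not> fst x \<and> 2 ^ r dvd snd x)"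
    have G_E: "?G x = ?G y" if xy: "E x y" for x y
    proof -
      have G: "\<not> fst x \<and> 2 ^ r dvd snd x \<longleftrightarrow> E (False, 0) x \<or> E (False, 2 ^ m) x" for x
        using E_one[of "fst x" "snd x"] H[of "fst x" "snd x"] dvd_N[OF rn] dvd_trans by auto
      have "E (False, 0) x \<or> E (False, 2 ^ m) x \<longleftrightarrow> E (False, 0) y \<or> E (False, 2 ^ m) y"
        using xy E_sym E_trans by blast
      then show ?thesis unfolding ind_def G by simp
    qed
    \<comment> \<open>The intersection number is the coefficient, at a reflection of the class, of
      the product of the class with \<open>H\<close>; it is constant because this product belongs to
      the S-ring.\<close>
    have card_coset: "int (card (T \<inter> (x <# Lr r))) = conv N ?Y ?G (True, t1)" if x: "x \<in> T" for x
    proof -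
      obtain j where j: "x = phi (False, j)" "E (True, t1) (True, j)" using x unfolding T_def by blast
      have mem: "phi y \<in> x <# Lr r \<longleftrightarrow> \<not> fst y \<and> 2 ^ r dvd snd y - j" for y
      proof
        assume "phi y \<in> x <# Lr r"
        then obtain a where a: "a \<in> Lr r" "phi y = x \<otimes> a" unfolding l_coset_def by blast
        then obtain i where i: "a = phi (False, i)" "2 ^ r dvd i" unfolding Lr_def[OF rn] by blast
        then have "phi (fst y, snd y) = phi (False, j + i)" using a(2) j(1) by (simp add: phi_pm[symmetric])
        then have 1: "\<not> fst y" "N dvd snd y - (j + i)" unfolding phi_eq by simp_all
        then have "2 ^ r dvd (snd y - (j + i)) + i" using dvd_N[OF rn] dvd_trans i(2) dvd_add by blast
        then show "\<not> fst y \<and> 2 ^ r dvd snd y - j" using 1(1) by simp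
      next
        assume y: "\<not> fst y \<and> 2 ^ r dvd snd y - j"
        then have "phi (False, snd y - j) \<in> Lr r" by (simp add: mem_L)
        moreover have "phi y = x \<otimes> phi (False, snd y - j)"
          unfolding j(1) phi_pm[symmetric] using y by (cases y) simp
        ultimately show "phi y \<in> x <# Lr r" unfolding l_coset_def by blast
      qed
      have "int (card (T \<inter> (x <# Lr r))) = S N (\<lambda>i. ?Y (True, i) * ?G (False, i - j))"
      proof -
        have "ind (\<lambda>y. phi y \<in> T \<inter> (x <# Lr r)) (False, i) = ?Y (True, i) * ?G (False, i - j)"
          "ind (\<lambda>y. phi y \<in> T \<inter> (x <# Lr r)) (True, i) = 0" for i
          by (simp_all add: ind_def mem mem_T)
        moreover have "T \<inter> (x <# Lr r) \<subseteq> carrier D" using T_sub C_sub by blast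
        ultimately show ?thesis by (simp only: card_phi tot_def) (simp add: S_def)
      qed
      also have "\<dots> = conv N ?Y ?G (True, j)"
        unfolding conv_True YF by (simp add: S_def)
      also have "\<dots> = conv N ?Y ?G (True, t1)"
        using Y_E G_E E_sym[OF j(2)] by (rule E_conv)
      finally show ?thesis .
    qed
    show "\<forall>x\<in>T. \<forall>y\<in>T. card (T \<inter> (x <# Lr r)) = card (T \<inter> (y <# Lr r))"
      using card_coset by (metis of_nat_eq_iff)
  qed
  ultimately show ?thesis by (simp add: sring_rank_def)
qed

end

section \<open>Transfer to the abelian group\<close>

context dihedral_sring
begin

lemma phi_factor:
  assumes "\<And>x y. F x = F y \<longleftrightarrow> phi x = phi y"
  obtains b where "bij_betw b (carrier D) (range F)" "\<And>x. b (phi x) = F x"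
proof -
  define b where "b a = F (SOME y. phi y = a)" for a
  have b: "b (phi x) = F x" for x
  proof -
    have "phi (SOME y. phi y = phi x) = phi x" by (rule someI) simp
    then show ?thesis unfolding b_def using assms by blast
  qed
  have "bij_betw b (carrier D) (range F)"
    unfolding bij_betw_def
  proof
    show "inj_on b (carrier D)"
    proof (rule inj_onI)
      fix x y assume xy: "x \<in> carrier D" "y \<in> carrier D" "b x = b y"
      then obtain x' y' where "x = phi x'" "y = phi y'" using phi_surj by metis
      then show "x = y" using xy(3) b assms by simp
    qed
    show "b ` carrier D = range F"
    proof (intro equalityI subsetI)
      fix u assume "u \<in> b ` carrier D"
      then obtain y where "u = b (phi y)" using phi_surj by blast
      then show "u \<in> range F" by (simp add: b)
    next
      fix u assume "u \<in> range F"
      then obtain y where "u = b (phi y)" using b by force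
      then show "u \<in> b ` carrier D" by simp
    qed
  qed
  then show ?thesis using that b by blast
qed

context
  fixes g :: int
  assumes sym_F: "E (False, i) (False, - i)" and sym_T: "E (True, g + i) (True, g - i)"
begin

abbreviation (input) "G' \<equiv> integer_mod_group 2 \<times>\<times> integer_mod_group (2 ^ n)"

text \<open>The partition is carried over by \<open>F\<close>, whereas the isomorphism is \<open>F \<circ> tau\<close>: the lemma
  \<open>tau_pm\<close> below says that it turns left multiplication by \<open>u\<close> into addition of a point of the same
  basic set, namely \<open>sig v u\<close>.\<close>

definition F :: "pt \<Rightarrow> int \<times> int" where
  "F x = (if fst x then (1, (snd x - g) mod N) else (0, snd x mod N))"

text \<open>Addition of the abelian group in terms of points; the correction \<open>2 * g\<close>
  arises because \<open>F\<close> measures the exponents of reflections from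
  \<open>g\<close>.\<close>

definition am :: "pt \<Rightarrow> pt \<Rightarrow> pt" where
  "am x y = (fst x \<noteq> fst y, snd x + snd y - (if fst x \<and> fst y then 2 * g else 0))"

definition nu :: "pt \<Rightarrow> pt" where
  "nu x = (fst x, if fst x then 2 * g - snd x else - snd x)"

definition tau :: "pt \<Rightarrow> pt" where
  "tau x = (fst x, if fst x then 2 * g - snd x else snd x)"

definition sig :: "pt \<Rightarrow> pt \<Rightarrow> pt" where
  "sig v u = (fst u, if fst u \<noteq> fst v then (if fst u then 2 * g - snd u else - snd u) else snd u)"

lemma reflect_T: "E (True, i) (True, 2 * g - i)"
  using sym_T[of "i - g"] by simp

lemma carrier_G': "carrier G' = {0..<2} \<times> {0..<N}"
  by (simp add: carrier_integer_mod_group N_def)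

lemma group_G': "group G'"
  by (intro DirProd_group) simp_all

lemma F_eq: "F x = F y \<longleftrightarrow> phi x = phi y"
proof -
  have "F (p, i) = F (q, j) \<longleftrightarrow> p = q \<and> N dvd i - j" for p q i j
    by (cases p; cases q) (simp_all add: F_def mod_eq_dvd_iff)
  then show ?thesis by (cases x; cases y) (simp add: phi_eq)
qed

lemma range_F: "range F = carrier G'"
proof (intro equalityI subsetI)
  fix u assume "u \<in> carrier G'"
  then obtain e i where u: "u = (e, i)" "e = 0 \<or> e = 1" "0 \<le> i" "i < N" unfolding carrier_G' by force
  then have "u = F (e = 1, i + (if e = 1 then g else 0))" by (auto simp: F_def)
  then show "u \<in> range F" by blast
next
  fix u assume "u \<in> range F"
  then show "u \<in> carrier G'" unfolding carrier_G' using N_pos by (auto simp: F_def)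
qed

lemma F_closed: "F x \<in> carrier G'"
  using range_F by blast

lemma F_mult: "F x \<otimes>\<^bsub>G'\<^esub> F y = F (am x y)"
proof -
  have 2: "(2 :: int) ^ n = N" by (simp add: N_def)
  show ?thesis
    by (cases x; cases y; cases "fst x"; cases "fst y"; simp add: F_def am_def mod_add_eq 2; simp add: algebra_simps)
qed

lemma F_one: "F (False, 0) = \<one>\<^bsub>G'\<^esub>"
  by (simp add: F_def)

lemma F_inv: "inv\<^bsub>G'\<^esub> F x = F (nu x)"
proof -
  have "F (nu x) \<otimes>\<^bsub>G'\<^esub> F x = \<one>\<^bsub>G'\<^esub>"
    unfolding F_mult F_one[symmetric] by (cases x; cases "fst x") (simp_all add: am_def nu_def)
  then show ?thesis by (intro group.inv_equality[OF group_G'] F_closed)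
qed

lemma E_nu: "E x (nu x)"
  using reflect_T sym_F by (cases x; cases "fst x") (simp_all add: nu_def)

lemma E_sig: "E u (sig v u)"
  using reflect_T sym_F E_refl by (cases u; cases "fst u") (simp_all add: sig_def)

lemma tau_tau: "tau (tau x) = x" and sig_sig: "sig v (sig v u) = u" and nu_nu: "nu (nu x) = x"
  by (simp_all add: tau_def sig_def nu_def prod_eq_iff)

lemma tau_pm: "tau (pm u v) = am (sig v u) (tau v)"
  by (cases u; cases v; cases "fst u"; cases "fst v") (simp_all add: tau_def am_def sig_def)

definition "cl x = F ` {y. E x y}"

lemma E_F: "F x = F y \<Longrightarrow> E x y"
  unfolding F_eq by (rule E_phi)

lemma mem_cl: "F x \<in> cl y \<longleftrightarrow> E y x"
proof
  assume "F x \<in> cl y"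
  then obtain z where "F x = F z" "E y z" unfolding cl_def by blast
  then show "E y x" using E_trans[OF _ E_F] by metis
qed (simp add: cl_def)

lemma cl_E: "E x y \<Longrightarrow> cl x = cl y"
proof -
  assume "E x y"
  then have "E x z \<longleftrightarrow> E y z" for z by (meson E_sym E_trans)
  then show ?thesis by (simp add: cl_def)
qed

lemma cl_partition: "partition_on (carrier G') (range cl)"
proof (rule partition_onI)
  show "\<Union>(range cl) = carrier G'"
    unfolding range_F[symmetric] using E_refl by (auto simp: cl_def)
  show "{} \<notin> range cl" using E_refl by (auto simp: cl_def)
  fix X Y assume "X \<in> range cl" "Y \<in> range cl" "X \<noteq> Y"
  then obtain x y where xy: "X = cl x" "Y = cl y" by blast
  show "disjnt X Y"
  proof (rule ccontr)
    assume "\<not> disjnt X Y"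
    then obtain u where "u \<in> cl x" "u \<in> cl y" unfolding xy disjnt_def by blast
    then obtain z where "E x z" "E y z" using mem_cl unfolding cl_def by blast
    then have "cl x = cl y" using cl_E by blast
    then show False using \<open>X \<noteq> Y\<close> xy by simp
  qed
qed

lemma finite_G': "finite (carrier G')"
  unfolding carrier_G' by simp

lemma sum_G': "(\<Sum>a\<in>carrier G'. K a) = tot N (\<lambda>y. K (F y) :: int)"
proof -
  obtain b where b: "bij_betw b (carrier D) (range F)" "\<And>x. b (phi x) = F x" using phi_factor F_eq by blast
  have "(\<Sum>a\<in>carrier G'. K a) = (\<Sum>a\<in>carrier D. K (b a))"
    using sum.reindex_bij_betw[OF b(1), of K] by (simp only: range_F)
  then show ?thesis by (simp add: sum_carrier b(2))
qed

abbreviation (input) "A' \<equiv> int_span (indicator ` range cl) :: (int \<times> int \<Rightarrow> int) set"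

lemma A'_iff: "f \<in> A' \<longleftrightarrow> (\<forall>x. x \<notin> carrier G' \<longrightarrow> f x = 0) \<and> (\<forall>x y. E x y \<longrightarrow> f (F x) = f (F y))"
proof -
  have "finite (range cl)" using finite_elements[OF finite_G' cl_partition] .
  note iff = int_span_iff[OF this cl_partition]
  have "(\<forall>X\<in>range cl. \<forall>x\<in>X. \<forall>y\<in>X. f x = f y) \<longleftrightarrow> (\<forall>x y. E x y \<longrightarrow> f (F x) = f (F y))"
  proof (intro iffI allI impI ballI)
    fix x y assume *: "\<forall>X\<in>range cl. \<forall>x\<in>X. \<forall>y\<in>X. f x = f y" and "E x y"
    then have "F x \<in> cl x" "F y \<in> cl x" using mem_cl E_refl by blast+
    then show "f (F x) = f (F y)" using * by blast
  next
    fix X u v assume *: "\<forall>x y. E x y \<longrightarrow> f (F x) = f (F y)" and X: "X \<in> range cl" "u \<in> X" "v \<in> X"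
    then obtain z x y where "u = F x" "v = F y" "E z x" "E z y" unfolding cl_def by blast
    then show "f u = f v" using * E_sym E_trans by metis
  qed
  then show ?thesis unfolding iff by blast
qed

text \<open>The abelian and the dihedral quotient of two points differ at most by inversion of a
  rotation or by the reflection of exponents at \<open>g\<close>. Both preserve the basic sets, so
  the structure constants coincide.\<close>

lemma mult_A':
  assumes "f \<in> A'" "k \<in> A'" shows "f \<otimes>\<^bsub>group_ring G'\<^esub> k \<in> A'"
proof -
  have f: "E x y \<Longrightarrow> f (F x) = f (F y)" and k: "E x y \<Longrightarrow> k (F x) = k (F y)" for x y
    using assms unfolding A'_iff by blast+
  have prod: "(f \<otimes>\<^bsub>group_ring G'\<^esub> k) (F x) = conv N (\<lambda>x. f (F x)) (\<lambda>x. k (F x)) x" for x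
  proof -
    have "k (inv\<^bsub>G'\<^esub> F y \<otimes>\<^bsub>G'\<^esub> F x) = k (F (pm (pinv y) x))" for y
    proof -
      obtain p i q j where xy: "x = (p, i)" "y = (q, j)" by (metis prod.exhaust)
      have "E (am (nu y) x) (pm (pinv y) x)"
      proof (cases q)
        case False
        then have "am (nu y) x = pm (pinv y) x" by (simp add: xy am_def nu_def)
        then show ?thesis by (simp add: E_refl)
      next
        case True
        show ?thesis
        proof (cases p)
          case False
          then show ?thesis using True reflect_T[of "2 * g - j + i"] by (simp add: xy am_def nu_def)
        next
          case p: True
          then show ?thesis using True sym_F[of "i - j"] by (simp add: xy am_def nu_def)
        qed
      qed
      then show ?thesis unfolding F_inv F_mult by (rule k)
    qed
    then show ?thesis
      unfolding group_ring_mult[OF group_G'] conv_def using F_closed[of x] by (simp add: sum_G' del: carrier_DirProd mult_DirProd)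
  qed
  have "(f \<otimes>\<^bsub>group_ring G'\<^esub> k) (F x) = (f \<otimes>\<^bsub>group_ring G'\<^esub> k) (F y)" if "E x y" for x y
    unfolding prod using f k that by (rule E_conv)
  then show ?thesis
    unfolding A'_iff by (auto simp: group_ring_mult[OF group_G'] simp del: carrier_DirProd mult_DirProd)
qed

lemma isomorphic_abelian: "\<exists>A'. sring G' A' \<and> sring_iso D A G' A'"
proof -
  have one: "{\<one>\<^bsub>G'\<^esub>} \<in> range cl"
  proof -
    have "cl (False, 0) = {F (False, 0)}"
    proof (intro equalityI subsetI)
      fix u assume "u \<in> cl (False, 0)"
      then obtain p i where "u = F (p, i)" "E (False, 0) (p, i)" unfolding cl_def by force
      then show "u \<in> {F (False, 0)}" by (simp add: E_one F_eq phi_eq)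
    qed (simp add: mem_cl E_refl)
    then show ?thesis unfolding F_one by (metis rangeI)
  qed
  have inv: "set_inv\<^bsub>G'\<^esub> X \<in> range cl" if "X \<in> range cl" for X
  proof -
    obtain x where x: "X = cl x" using \<open>X \<in> range cl\<close> by blast
    have "set_inv\<^bsub>G'\<^esub> X = cl x"
    proof (intro equalityI subsetI)
      fix u assume "u \<in> set_inv\<^bsub>G'\<^esub> X"
      then obtain y where "u = F (nu y)" "E x y" unfolding x cl_def SET_INV_def using F_inv by auto
      then show "u \<in> cl x" using mem_cl E_nu E_trans by blast
    next
      fix u assume "u \<in> cl x"
      then obtain y where y: "u = F y" "E x y" unfolding cl_def by blast
      then have "F (nu y) \<in> cl x" using mem_cl E_nu E_trans by blast
      moreover have "u = inv\<^bsub>G'\<^esub> F (nu y)" by (simp only: F_inv nu_nu y(1))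
      ultimately show "u \<in> set_inv\<^bsub>G'\<^esub> X" unfolding x SET_INV_def by blast
    qed
    then show ?thesis by blast
  qed
  have A': "sring G' A'" "basic_sets G' A' = range cl"
    by (rule sring_of_partition[OF group_G' finite_G' cl_partition one]; (rule inv | rule mult_A'); assumption)+
  obtain b where b: "bij_betw b (carrier D) (range (\<lambda>x. F (tau x)))" "\<And>x. b (phi x) = F (tau x)"
  proof (rule phi_factor)
    fix x y :: pt
    obtain p i q j where "x = (p, i)" "y = (q, j)" by (metis prod.exhaust)
    then show "F (tau x) = F (tau y) \<longleftrightarrow> phi x = phi y"
      unfolding F_eq using dvd_diff_commute[of N i j] by (cases p; cases q) (simp_all add: tau_def phi_eq)
  qed (rule that)
  have "range (\<lambda>x. F (tau x)) = carrier G'"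
  proof -
    have "F x = F (tau (tau x))" for x by (simp only: tau_tau)
    then show ?thesis unfolding range_F[symmetric] by blast
  qed
  then have bij: "bij_betw b (carrier D) (carrier G')" using b(1) by simp
  have rel: "map_prod b b ` cayley_rel D (cls x) = cayley_rel G' (cl x)" for x
  proof (intro equalityI subsetI)
    fix w assume "w \<in> map_prod b b ` cayley_rel D (cls x)"
    then obtain a d where a: "a \<in> carrier D" "d \<in> cls x" "w = (b a, b (d \<otimes> a))" unfolding cayley_rel_def by auto
    obtain v where v: "a = phi v" using phi_surj[OF a(1)] by blast
    obtain u where u: "d = phi u" "E x u" using a(2) unfolding cls_def by blast
    have "w = (F (tau v), F (sig v u) \<otimes>\<^bsub>G'\<^esub> F (tau v))"
      unfolding a(3) u v phi_pm[symmetric] b(2) tau_pm F_mult ..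
    moreover have "F (sig v u) \<in> cl x" using mem_cl E_sig u(2) E_trans by blast
    ultimately show "w \<in> cayley_rel G' (cl x)" unfolding cayley_rel_def using F_closed by blast
  next
    fix w assume "w \<in> cayley_rel G' (cl x)"
    then obtain a d where a: "a \<in> carrier G'" "d \<in> cl x" "w = (a, d \<otimes>\<^bsub>G'\<^esub> a)" unfolding cayley_rel_def by blast
    obtain v' where v': "a = F v'" using a(1) unfolding range_F[symmetric] by blast
    obtain u' where u': "d = F u'" "E x u'" using a(2) unfolding cl_def by blast
    define v where "v = tau v'"
    define u where "u = sig v u'"
    have "w = (F (tau v), F (sig v u) \<otimes>\<^bsub>G'\<^esub> F (tau v))"
      by (simp only: a(3) v' u' v_def u_def tau_tau sig_sig)
    also have "\<dots> = (b (phi v), b (phi u \<otimes> phi v))"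
      unfolding phi_pm[symmetric] b(2) tau_pm F_mult ..
    also have "\<dots> = map_prod b b (phi v, phi u \<otimes> phi v)" by simp
    finally have w: "w = map_prod b b (phi v, phi u \<otimes> phi v)" .
    have "phi u \<in> cls x" using mem_cls E_sig u'(2) E_trans unfolding u_def by blast
    then have "(phi v, phi u \<otimes> phi v) \<in> cayley_rel D (cls x)" unfolding cayley_rel_def using phi_closed by blast
    then show "w \<in> map_prod b b ` cayley_rel D (cls x)" unfolding w by (rule imageI)
  qed
  have im: "(\<lambda>R. map_prod b b ` R) ` cayley_rel D ` Q = cayley_rel G' ` range cl"
    unfolding Q_range image_image rel ..
  have "sring_iso D A G' A'" unfolding sring_iso_def A'(2) by (intro exI[of _ b] conjI bij im)
  then show ?thesis using A'(1) by blast
qed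

end

end

theorem theorem1p3:
  fixes D :: "('a, 'b) monoid_scheme" and n :: nat and A :: "('a \<Rightarrow> int) set"
  assumes "dihedral_group D" and "order D = 2 ^ (n + 1)"
    and "sring D A" and "sring_rank D A \<le> 5"
  shows "(\<exists>A'. sring (integer_mod_group 2 \<times>\<times> integer_mod_group (2 ^ n)) A' \<and>
               sring_iso D A (integer_mod_group 2 \<times>\<times> integer_mod_group (2 ^ n)) A')
       \<or> (proper_dot_product D A \<or> proper_wreath_product D A)
       \<or> (sring_rank D A = 5 \<and> associated_with_dds D A)"
proof -
  obtain C where D: "group D" and C: "dihedral_cyclic_part D C"
    using assms(1) by (auto simp: dihedral_group_def)
  obtain c s where cs: "dihedral_coordinates D n c s" and C_range: "C = range (\<lambda>i :: int. c [^]\<^bsub>D\<^esub> i)"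
    using dihedral_cyclic_part_coordinates[OF D C assms(2)] by blast
  interpret dihedral_sring D n c s A
    using cs assms(3) by (simp add: dihedral_sring_def dihedral_sring_axioms_def)
  show ?thesis
  proof (cases n)
    case 0
    \<comment> \<open>With period 1 all exponents coincide, so both symmetry conditions hold
      trivially.\<close>
    then have "N = 1" unfolding N_def by simp
    then have "E (p, i) (p, j)" for p i j by (intro E_per) simp
    then show ?thesis using isomorphic_abelian[of 0] by blast
  next
    case (Suc m)
    interpret R: rank5_sring m N "2 ^ m" E
      using rank5_sring[OF Suc] assms(4) by (simp add: sring_rank_def)
    from R.trichotomy consider R.symm | R.wreath | R.dds by blast
    then show ?thesis
    proof cases
      case 1
      then show ?thesis using isomorphic_abelian unfolding R.symm_def by blast
    next
      case 2
      then obtain r where "r \<le> m"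
        "\<And>i y. 2 ^ r dvd i \<Longrightarrow> E (False, i) y \<Longrightarrow> \<not> fst y \<and> 2 ^ r dvd snd y"
        "\<And>p i j. p \<or> \<not> 2 ^ r dvd i \<Longrightarrow> 2 ^ r dvd j \<Longrightarrow> E (p, i) (p, i + j)"
        unfolding R.wreath_def by blast
      then have "proper_wreath_product D A" using Suc by (intro proper_wreath[of r]) auto
      then show ?thesis by blast
    next
      case 3
      then show ?thesis
        unfolding R.dds_def
      proof (elim exE conjE)
        fix r t1 t2
        assume d: "r \<le> m" "r > 0"
          "\<forall>p j. E (False, 2 ^ m) (p, j) \<longleftrightarrow> \<not> p \<and> 2 ^ r dvd j \<and> \<not> N dvd j"
          "\<forall>p j. E (False, 1) (p, j) \<longleftrightarrow> \<not> p \<and> \<not> 2 ^ r dvd j"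
          "\<not> E (True, t1) (True, t2)" "\<forall>j. E (True, t1) (True, j) \<or> E (True, t2) (True, j)"
        from associated_dds[OF Suc d(1,2) d(3)[rule_format] d(4)[rule_format] d(5) d(6)[rule_format] C C_range]
        show ?thesis by blast
      qed
    qed
  qed
qed

end
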